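(* Let $\pi_n$, with $\frac{d\pi_n}{d\tilde\pi_n}(x)=\exp\{-\phi_n(x)\}$, $\tilde{\pi}_n(x)=\prod_{i=1}^n \lambda_i^{-1} f(x_i/\lambda_i)$, $\lambda_i=i^{-\kappa}$, $\kappa\ge 0$, be the target distribution for RWM and SLA. Assume that $\sigma_n^2=l^2n^{-\rho}$ for constants $l,\rho>0$. Suppose that: (A) there exists $M\in\mathbb{R}$ such that, for all sufficiently large $n$, $\phi_n(x)\ge M$ for all $x\in\mathbb{R}^n$; (B) there exist a locally bounded function $\delta:\mathbb{R}^+\times\mathbb{R}^+\to\mathbb{R}^+$ and constants $C>0$, $p>0$ and $s,s',s''$, all three strictly smaller than $\kappa-1/2$, such that, for all sufficiently large $n$ and all $x,y\in\mathbb{R}^n$, $$|\phi_n(y)-\phi_n(x)|\le\delta(|x|_s,|y|_s)\,|y-x|_{s'},\qquad |\phi_n(x)|\le C(1+|x|_{s''}^p).$$ Let $I=1$ for RWM and $I=1/3$ for SLA. Then, for each of the two algorithms with its own $I$, with $x\sim\pi_n$ and $y$ the proposal from $x$, as $n\to\infty$: (i) if $\rho=2\kappa+I$, then $E[a_n(x,y)]\to a(l)$, where $a(l)=2\Phi\big(-\frac{l}{2}\sqrt{K^{\mathrm{RWM}}/(1+2\kappa)}\big)$ for RWM and $a(l)=2\Phi\big(-\frac{l^3}{2}\sqrt{K^{\mathrm{SLA}}/(1+6\kappa)}\big)$ for SLA; (ii) if $\rho>2\kappa+I$, then $E[a_n(x,y)]\to 1$; (iii) if $2\kappa<\rho<2\kappa+I$,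 then $n^pE[a_n(x,y)]\to 0$ for any $p\ge 0$.
   Context: $\mathbb{R}^+=[0,\infty)$; for $s\in\mathbb{R}$ and $x\in\mathbb{R}^n$, $|x|_s=\big(\sum_{i=1}^n i^{2s}x_i^2\big)^{1/2}$. "Locally bounded" means bounded on bounded sets. $\Phi$ is the CDF of $\mathcal{N}(0,1)$. Density $f$. $f=\exp\{-g\}$ is a probability density on $\mathbb{R}$, where $g:\mathbb{R}\to\mathbb{R}$ is infinitely differentiable, $g$ and each of its derivatives are bounded in absolute value by a polynomial, and all moments of $f$ are finite. With $E_f$ denoting expectation for $X$ with density $f$, $K^{\mathrm{RWM}}=E_f[(g'(X))^2]$ and $K^{\mathrm{SLA}}=\tfrac{1}{48}E_f[3g''(X)^3+5(g^{(3)}(X))^2]$. Target. For each $n$, $\phi_n:\mathbb{R}^n\to\mathbb{R}$ is Borel measurable and $\pi_n$ is the probability measure with density $\exp\{-\phi_n\}$ with respect to $\tilde\pi_n$; $\pi_n(x)$ also denotes its Lebesgue density. Algorithms. A Metropolis–Hastings step from $x\in\mathbb{R}^n$ draws a proposal $y$ from a transition density $q_n(x,\cdot)$ and moves to $x'=y$ with probability $a_n(x,y)$, otherwise $x'=x$, where $a_n(x,y)=1\wedge\frac{\pi_n(y)q_n(y,x)}{\pi_n(x)q_n(x,y)}$ if $\pi_n(x)q_n(x,y)>0$ and $a_n(x,y)=0$ otherwise. With $Z\sim\mathcal{N}(0,I_n)$ independent of $x$ and step-size $\sigma_n>0$, the proposals are RWM: $y=x+\sigma_n Z$; SLA: $y=x+\frac{\sigma_n^2}{2}\nabla\log\tilde\pi_n(x)+\sigma_n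 Z$, i.e. $y_i=x_i-\frac{\sigma_n^2}{2\lambda_i}g'(x_i/\lambda_i)+\sigma_nZ_i$ (the gradient uses $\tilde\pi_n$, the acceptance probability uses $\pi_n$). *)

theory Defs
  imports "HOL-Probability.Probability" "HOL-Computational_Algebra.Polynomial"
begin

text \<open>
  Vectors of dimension \<open>n\<close> are extensional functions on \<open>{1..n}\<close>, so that a sequence of problems of
  growing dimension can be considered; \<open>Rn n\<close> is Lebesgue measure on this space.
\<close>

definition Rn :: "nat \<Rightarrow> (nat \<Rightarrow> real) measure" where
  "Rn n = PiM {1..n} (\<lambda>_. lborel)"

definition std_gauss :: "nat \<Rightarrow> (nat \<Rightarrow> real) measure" where
  "std_gauss n = PiM {1..n} (\<lambda>_. std_normal_distribution)"

definition wnorm :: "nat \<Rightarrow> real \<Rightarrow> (nat \<Rightarrow> real) \<Rightarrow> real" where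
  "wnorm n s x = sqrt (\<Sum>i=1..n. real i powr (2 * s) * (x i)\<^sup>2)"

definition locally_bounded_on :: "'a::metric_space set \<Rightarrow> ('a \<Rightarrow> 'b::metric_space) \<Rightarrow> bool" where
  "locally_bounded_on S h \<longleftrightarrow> (\<forall>B\<subseteq>S. bounded B \<longrightarrow> bounded (h ` B))"

definition coord_scale :: "real \<Rightarrow> nat \<Rightarrow> real" where
  "coord_scale \<kappa> i = real i powr (- \<kappa>)"

definition ref_density :: "nat \<Rightarrow> real \<Rightarrow> (real \<Rightarrow> real) \<Rightarrow> (nat \<Rightarrow> real) \<Rightarrow> real" where
  "ref_density n \<kappa> f x = (\<Prod>i=1..n. inverse (coord_scale \<kappa> i) * f (x i / coord_scale \<kappa> i))"

definition ref_measure :: "nat \<Rightarrow> real \<Rightarrow> (real \<Rightarrow> real) \<Rightarrow> (nat \<Rightarrow> real) measure" where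
  "ref_measure n \<kappa> f = density (Rn n) (\<lambda>x. ennreal (ref_density n \<kappa> f x))"

definition target :: "nat \<Rightarrow> real \<Rightarrow> (real \<Rightarrow> real) \<Rightarrow> ((nat \<Rightarrow> real) \<Rightarrow> real) \<Rightarrow> (nat \<Rightarrow> real) measure" where
  "target n \<kappa> f \<phi> = density (ref_measure n \<kappa> f) (\<lambda>x. ennreal (exp (- \<phi> x)))"

definition target_density :: "nat \<Rightarrow> real \<Rightarrow> (real \<Rightarrow> real) \<Rightarrow> ((nat \<Rightarrow> real) \<Rightarrow> real) \<Rightarrow> (nat \<Rightarrow> real) \<Rightarrow> real" where
  "target_density n \<kappa> f \<phi> x = exp (- \<phi> x) * ref_density n \<kappa> f x"

text \<open>
  Both algorithms propose \<open>y = m x + \<sigma> Z\<close> with \<open>Z\<close> standard Gaussian and differ only in the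
  mean \<open>m x\<close> given the current state \<open>x\<close>.
\<close>

definition proposal ::
    "nat \<Rightarrow> real \<Rightarrow> ((nat \<Rightarrow> real) \<Rightarrow> nat \<Rightarrow> real) \<Rightarrow> (nat \<Rightarrow> real) \<Rightarrow> (nat \<Rightarrow> real) \<Rightarrow> nat \<Rightarrow> real" where
  "proposal n \<sigma> m x z = (\<lambda>i\<in>{1..n}. m x i + \<sigma> * z i)"

definition proposal_density ::
    "nat \<Rightarrow> real \<Rightarrow> ((nat \<Rightarrow> real) \<Rightarrow> nat \<Rightarrow> real) \<Rightarrow> (nat \<Rightarrow> real) \<Rightarrow> (nat \<Rightarrow> real) \<Rightarrow> real" where
  "proposal_density n \<sigma> m x y = (\<Prod>i=1..n. normal_density (m x i) \<sigma> (y i))"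

definition rwm_mean :: "(nat \<Rightarrow> real) \<Rightarrow> nat \<Rightarrow> real" where
  "rwm_mean x = x"

definition grad_log_ref :: "nat \<Rightarrow> real \<Rightarrow> (real \<Rightarrow> real) \<Rightarrow> (nat \<Rightarrow> real) \<Rightarrow> nat \<Rightarrow> real" where
  "grad_log_ref n \<kappa> f x i = deriv (\<lambda>t. ln (ref_density n \<kappa> f (x(i := t)))) (x i)"

definition sla_mean ::
    "nat \<Rightarrow> real \<Rightarrow> (real \<Rightarrow> real) \<Rightarrow> real \<Rightarrow> (nat \<Rightarrow> real) \<Rightarrow> nat \<Rightarrow> real" where
  "sla_mean n \<kappa> f \<sigma> x i = x i + \<sigma>\<^sup>2 / 2 * grad_log_ref n \<kappa> f x i"

definition accept_prob :: "('a \<Rightarrow> real) \<Rightarrow> ('a \<Rightarrow> 'a \<Rightarrow> real) \<Rightarrow> 'a \<Rightarrow> 'a \<Rightarrow> real" where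
  "accept_prob p q x y =
     (if p x * q x y > 0 then min 1 ((p y * q y x) / (p x * q x y)) else 0)"

text \<open>The expectation of \<open>a\<^sub>n(x,y)\<close> over independent \<open>x \<sim> \<pi>\<^sub>n\<close> and \<open>Z\<close>, with \<open>y\<close> the proposal from \<open>x\<close>.\<close>

definition expected_acceptance ::
    "nat \<Rightarrow> real \<Rightarrow> (real \<Rightarrow> real) \<Rightarrow> ((nat \<Rightarrow> real) \<Rightarrow> real) \<Rightarrow> real
      \<Rightarrow> ((nat \<Rightarrow> real) \<Rightarrow> nat \<Rightarrow> real) \<Rightarrow> real" where
  "expected_acceptance n \<kappa> f \<phi> \<sigma> m =
     (\<integral>(x, z). accept_prob (target_density n \<kappa> f \<phi>) (proposal_density n \<sigma> m) x (proposal n \<sigma> m x z)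
        \<partial>(target n \<kappa> f \<phi> \<Otimes>\<^sub>M std_gauss n))"

definition dens_expectation :: "(real \<Rightarrow> real) \<Rightarrow> (real \<Rightarrow> real) \<Rightarrow> real" where
  "dens_expectation f h = (\<integral>x. h x \<partial>density lborel (\<lambda>x. ennreal (f x)))"

definition K_RWM :: "(real \<Rightarrow> real) \<Rightarrow> (real \<Rightarrow> real) \<Rightarrow> real" where
  "K_RWM f g = dens_expectation f (\<lambda>x. (deriv g x)\<^sup>2)"

definition K_SLA :: "(real \<Rightarrow> real) \<Rightarrow> (real \<Rightarrow> real) \<Rightarrow> real" where
  "K_SLA f g = 1 / 48 *
     dens_expectation f (\<lambda>x. 3 * ((deriv ^^ 2) g x) ^ 3 + 5 * ((deriv ^^ 3) g x)\<^sup>2)"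

definition std_normal_cdf :: "real \<Rightarrow> real" where
  "std_normal_cdf = cdf std_normal_distribution"

lemma target_eq_density:
  assumes [measurable]: "f \<in> borel_measurable borel" "\<phi> \<in> borel_measurable (Rn n)"
    and "\<And>x. f x \<ge> 0"
  shows "target n \<kappa> f \<phi> = density (Rn n) (\<lambda>x. ennreal (target_density n \<kappa> f \<phi> x))"
proof -
  have [measurable]: "ref_density n \<kappa> f \<in> borel_measurable (Rn n)"
    unfolding ref_density_def Rn_def by measurable
  have nn: "ref_density n \<kappa> f x \<ge> 0" for x
    unfolding ref_density_def coord_scale_def by (intro prod_nonneg) (auto simp: assms)
  show ?thesis
    unfolding target_def ref_measure_def target_density_def
    by (subst density_density_eq) (auto simp: ennreal_mult nn mult.commute intro!: density_cong)
qed

lemma distr_affine_std_normal: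
  assumes "\<sigma> > 0"
  shows "distr std_normal_distribution lborel (\<lambda>z. c + \<sigma> * z) =
         density lborel (\<lambda>y. ennreal (normal_density c \<sigma> y))"
proof -
  interpret N: prob_space std_normal_distribution
    by (rule prob_space_normal_density) simp
  have "distributed std_normal_distribution lborel (\<lambda>z. z) std_normal_density"
    unfolding distributed_def by (auto simp: distr_id2)
  from N.normal_density_affine[OF this, of \<sigma> c] assms
  show ?thesis by (simp add: distributed_def)
qed

lemma PiM_density_lborel:
  fixes h :: "'i \<Rightarrow> real \<Rightarrow> real" and I :: "'i set"
  assumes "finite I"
    and [measurable]: "\<And>i. h i \<in> borel_measurable lborel"
    and ps: "\<And>i. prob_space (density lborel (\<lambda>y. ennreal (h i y)))"
    and nn: "\<And>i y. h i y \<ge> 0"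
  shows "PiM I (\<lambda>i. density lborel (\<lambda>y. ennreal (h i y))) =
         density (PiM I (\<lambda>_. lborel)) (\<lambda>y. ennreal (\<Prod>i\<in>I. h i (y i)))"
proof -
  interpret P: product_prob_space "\<lambda>i. density lborel (\<lambda>y. ennreal (h i y))" I
    by (intro product_prob_spaceI ps)
  interpret L: product_sigma_finite "\<lambda>_. lborel :: real measure"
    by standard
  have [measurable]: "(\<lambda>y. ennreal (\<Prod>i\<in>I. h i (y i))) \<in> borel_measurable (PiM I (\<lambda>_. lborel))"
    by measurable
  show ?thesis
  proof (rule P.PiM_eqI[symmetric])
    show "finite I" by fact
    show "sets (density (PiM I (\<lambda>_. lborel)) (\<lambda>y. ennreal (\<Prod>i\<in>I. h i (y i)))) =
        sets (PiM I (\<lambda>i. density lborel (\<lambda>y. ennreal (h i y))))"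
      by (auto intro!: sets_PiM_cong)
    fix A assume A: "\<And>i. i \<in> I \<Longrightarrow> A i \<in> sets (density lborel (\<lambda>y. ennreal (h i y)))"
    then have [measurable]: "i \<in> I \<Longrightarrow> A i \<in> sets borel" for i by simp
    have "emeasure (density (PiM I (\<lambda>_. lborel)) (\<lambda>y. ennreal (\<Prod>i\<in>I. h i (y i)))) (Pi\<^sub>E I A) =
        (\<integral>\<^sup>+y. ennreal (\<Prod>i\<in>I. h i (y i)) * indicator (Pi\<^sub>E I A) y \<partial>PiM I (\<lambda>_. lborel))"
      using \<open>finite I\<close> by (subst emeasure_density) (auto intro!: sets_PiM_I_finite)
    also have "\<dots> = (\<integral>\<^sup>+y. (\<Prod>i\<in>I. ennreal (h i (y i)) * indicator (A i) (y i)) \<partial>PiM I (\<lambda>_. lborel))"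
    proof (rule nn_integral_cong)
      fix y :: "'i \<Rightarrow> real" assume y: "y \<in> space (PiM I (\<lambda>_. lborel :: real measure))"
      have "indicator (Pi\<^sub>E I A) y = (\<Prod>i\<in>I. indicator (A i) (y i) :: ennreal)"
        using y \<open>finite I\<close> by (auto simp: indicator_def space_PiM PiE_iff prod_zero_iff)
      then show "ennreal (\<Prod>i\<in>I. h i (y i)) * indicator (Pi\<^sub>E I A) y =
          (\<Prod>i\<in>I. ennreal (h i (y i)) * indicator (A i) (y i))"
        by (simp add: prod.distrib prod_ennreal nn)
    qed
    also have "\<dots> = (\<Prod>i\<in>I. \<integral>\<^sup>+y. ennreal (h i y) * indicator (A i) y \<partial>lborel)"
      using \<open>finite I\<close> by (subst L.product_nn_integral_prod) auto
    also have "\<dots> = (\<Prod>i\<in>I. emeasure (density lborel (\<lambda>y. ennreal (h i y))) (A i))"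
      by (intro prod.cong refl) (subst emeasure_density, auto)
    finally show "emeasure (density (PiM I (\<lambda>_. lborel)) (\<lambda>y. ennreal (\<Prod>i\<in>I. h i (y i)))) (Pi\<^sub>E I A) =
        (\<Prod>i\<in>I. emeasure (density lborel (\<lambda>y. ennreal (h i y))) (A i))" .
  qed
qed

lemma distr_PiM_componentwise:
  fixes h :: "'i \<Rightarrow> real \<Rightarrow> real"
  assumes "finite I" and ps: "prob_space N"
    and [measurable]: "\<And>i. h i \<in> N \<rightarrow>\<^sub>M lborel"
  shows "distr (PiM I (\<lambda>_. N)) (PiM I (\<lambda>_. lborel)) (\<lambda>z. \<lambda>i\<in>I. h i (z i)) =
         PiM I (\<lambda>i. distr N lborel (h i))"
proof -
  interpret N: product_prob_space "\<lambda>_. N" I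
    by (intro product_prob_spaceI ps)
  interpret P: product_prob_space "\<lambda>i. distr N lborel (h i)" I
    by (intro product_prob_spaceI prob_space.prob_space_distr ps) measurable
  have hb: "h i \<in> borel_measurable N" for i
    using assms(3)[of i] by simp
  have [measurable]: "(\<lambda>z. \<lambda>i\<in>I. h i (z i)) \<in> PiM I (\<lambda>_. N) \<rightarrow>\<^sub>M PiM I (\<lambda>_. lborel)"
    by measurable
  show ?thesis
  proof (rule P.PiM_eqI)
    show "finite I" by fact
    show "sets (distr (PiM I (\<lambda>_. N)) (PiM I (\<lambda>_. lborel)) (\<lambda>z. \<lambda>i\<in>I. h i (z i))) =
        sets (PiM I (\<lambda>i. distr N lborel (h i)))"
      unfolding sets_distr by (rule sets_PiM_cong) auto
    fix A assume A: "\<And>i. i \<in> I \<Longrightarrow> A i \<in> sets (distr N lborel (h i))"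
    then have meas: "Pi\<^sub>E I A \<in> sets (PiM I (\<lambda>_. lborel))"
      using \<open>finite I\<close> by (intro sets_PiM_I_finite) auto
    have vimage: "(\<lambda>z. \<lambda>i\<in>I. h i (z i)) -` Pi\<^sub>E I A \<inter> space (PiM I (\<lambda>_. N)) =
        Pi\<^sub>E I (\<lambda>i. h i -` A i \<inter> space N)"
      by (auto simp: space_PiM PiE_def Pi_def extensional_def)
    have "emeasure (distr (PiM I (\<lambda>_. N)) (PiM I (\<lambda>_. lborel)) (\<lambda>z. \<lambda>i\<in>I. h i (z i))) (Pi\<^sub>E I A) =
        emeasure (PiM I (\<lambda>_. N)) (Pi\<^sub>E I (\<lambda>i. h i -` A i \<inter> space N))"
      using meas by (simp add: emeasure_distr vimage)
    also have "\<dots> = (\<Prod>i\<in>I. emeasure N (h i -` A i \<inter> space N))"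
    proof (rule N.emeasure_PiM)
      show "h i -` A i \<inter> space N \<in> sets N" if "i \<in> I" for i
        using measurable_sets[OF hb, of "A i" i] A[OF that] by simp
    qed fact
    also have "\<dots> = (\<Prod>i\<in>I. emeasure (distr N lborel (h i)) (A i))"
      using A by (intro prod.cong emeasure_distr [symmetric]) (auto simp: hb)
    finally show "emeasure (distr (PiM I (\<lambda>_. N)) (PiM I (\<lambda>_. lborel)) (\<lambda>z. \<lambda>i\<in>I. h i (z i))) (Pi\<^sub>E I A) =
        (\<Prod>i\<in>I. emeasure (distr N lborel (h i)) (A i))" .
  qed
qed

lemma distr_proposal:
  assumes "\<sigma> > 0"
  shows "distr (std_gauss n) (Rn n) (proposal n \<sigma> m x) =
         density (Rn n) (\<lambda>y. ennreal (proposal_density n \<sigma> m x y))"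
proof -
  have ps: "prob_space std_normal_distribution"
    by (rule prob_space_normal_density) simp
  have "distr (std_gauss n) (Rn n) (proposal n \<sigma> m x) =
      PiM {1..n} (\<lambda>i. distr std_normal_distribution lborel (\<lambda>z. m x i + \<sigma> * z))"
    unfolding std_gauss_def Rn_def proposal_def by (rule distr_PiM_componentwise) (use ps in auto)
  also have "\<dots> = PiM {1..n} (\<lambda>i. density lborel (\<lambda>y. ennreal (normal_density (m x i) \<sigma> y)))"
    using assms by (simp add: distr_affine_std_normal)
  also have "\<dots> = density (Rn n) (\<lambda>y. ennreal (proposal_density n \<sigma> m x y))"
    unfolding Rn_def proposal_density_def
    using assms by (intro PiM_density_lborel) (auto intro: prob_space_normal_density)
  finally show ?thesis .
qed

lemma sla_mean_eq:
  assumes f: "\<And>x. f x = exp (- g x)" and g: "g differentiable (at (x i / coord_scale \<kappa> i))"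
    and i: "i \<in> {1..n}"
  shows "sla_mean n \<kappa> f \<sigma> x i = x i - \<sigma>\<^sup>2 / (2 * coord_scale \<kappa> i) * deriv g (x i / coord_scale \<kappa> i)"
proof -
  have pos: "coord_scale \<kappa> j > 0" if "j \<in> {1..n}" for j
    using that by (simp add: coord_scale_def)
  define c where "c = (\<Sum>j\<in>{1..n} - {i}. ln (inverse (coord_scale \<kappa> j)) - g (x j / coord_scale \<kappa> j))"
  have "ln (ref_density n \<kappa> f (x(i := t))) =
      ln (inverse (coord_scale \<kappa> i)) - g (t / coord_scale \<kappa> i) + c" for t
  proof -
    have "ln (ref_density n \<kappa> f (x(i := t))) =
       (\<Sum>j=1..n. ln (inverse (coord_scale \<kappa> j)) - g ((x(i := t)) j / coord_scale \<kappa> j))"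
      unfolding ref_density_def f using pos
      by (subst ln_prod) (auto intro!: sum.cong simp: ln_mult order_less_imp_not_eq2)
    also have "\<dots> = ln (inverse (coord_scale \<kappa> i)) - g (t / coord_scale \<kappa> i) + c"
      using i unfolding c_def by (subst sum.remove[of _ i]) auto
    finally show ?thesis .
  qed
  moreover have "((\<lambda>t. ln (inverse (coord_scale \<kappa> i)) - g (t / coord_scale \<kappa> i) + c) has_real_derivative
      - (deriv g (x i / coord_scale \<kappa> i) / coord_scale \<kappa> i)) (at (x i))"
  proof -
    have "(g has_real_derivative deriv g (x i / coord_scale \<kappa> i)) (at (x i / coord_scale \<kappa> i))"
      using g by (simp add: DERIV_deriv_iff_real_differentiable)
    moreover have "((\<lambda>t. t / coord_scale \<kappa> i) has_real_derivative 1 / coord_scale \<kappa> i) (at (x i))"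
      using pos[OF i] by (auto intro!: derivative_eq_intros)
    ultimately have "((\<lambda>t. g (t / coord_scale \<kappa> i)) has_real_derivative
        deriv g (x i / coord_scale \<kappa> i) * (1 / coord_scale \<kappa> i)) (at (x i))"
      by (rule DERIV_chain2)
    then show ?thesis
      using pos[OF i] by (auto intro!: derivative_eq_intros)
  qed
  ultimately show ?thesis
    unfolding sla_mean_def grad_log_ref_def by (simp add: DERIV_imp_deriv)
qed

end

theory Submission
  imports Defs
begin

text \<open>
  In the coordinates \<open>\<xi>\<^sub>i = x\<^sub>i / \<lambda>\<^sub>i\<close> the log acceptance ratio under the reference measure is a sum
  \<open>\<Sum> r(\<xi>\<^sub>i, z\<^sub>i, \<epsilon>\<^sub>i)\<close> of independent terms with \<open>\<epsilon>\<^sub>i = \<sigma>\<^sub>n i powr \<kappa>\<close>, and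
  \<open>r = \<epsilon>^k C(\<xi>, z) + O(\<epsilon>^(k + 1))\<close> with \<open>k = 1\<close> for RWM and \<open>k = 3\<close> for SLA, so that \<open>I = 1/k\<close>.
  One-dimensional detailed balance, \<open>E c(- r) = E c(r) exp r\<close>, turns this single expansion into
  everything else: \<open>E r\<close> is \<open>- E r\<^sup>2 / 2\<close> up to third moments, and
  \<open>2 (1 - E exp (r/2)) = E (1 - exp (r/2))\<^sup>2\<close> is comparable to \<open>\<epsilon>^(2k)\<close>.
  Hence the sum is asymptotically \<open>N(- v/2, v)\<close> if \<open>\<Sum> \<epsilon>\<^sub>i^(2k)\<close> converges, tends to 0 if it vanishes, and
  \<open>E min 1 (exp (\<Sum> r)) \<le> \<Prod> E exp (r/2)\<close> decays like \<open>exp (- c n^\<gamma>)\<close> if it grows like \<open>n^\<gamma>\<close>.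

  The perturbation \<open>\<phi>\<^sub>n\<close> is harmless: realizing all dimensions on one infinite product space, the
  weighted norms in assumption (B) are almost surely bounded in \<open>n\<close>, so that \<open>\<phi>\<^sub>n(y) - \<phi>\<^sub>n(x) \<rightarrow> 0\<close> almost surely
  and \<open>\<phi>\<^sub>n\<close> essentially depends on few coordinates only, which makes the change of
  measure asymptotically independent of the log-ratio.
\<close>

section \<open>Elementary estimates\<close>

text \<open>The target is not a product measure; of its density against the product reference only
  the upper bound \<open>exp (- L)\<close> is at hand. In the subcritical regime the acceptance
  probability converges in mean to the constant 1, which survives a change to a bounded density. In
  the critical regime convergence is only in distribution, which does not, hence the need for
  asymptotic independence. The supercritical claim carries a rate, so that almost sure convergence
  of the perturbation is too weak: the growth bound keeps its share of the exponent at order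
  \<open>n powr (\<gamma> / 2)\<close>, below the decay \<open>n powr \<gamma>\<close>, outside an
  event controlled by high moments.

  The order \<open>k = 3\<close> of SLA has a classical source: with drift \<open>- g' / 2\<close>
  the log-ratio is the error of the trapezoidal rule for the integral of \<open>g'\<close> over the
  step plus \<open>\<epsilon>\<^sup>2 / 8\<close> times a difference of squares of
  \<open>g'\<close>, and neither has terms below order 3. All remainders are bounded by one envelope
  \<open>W\<close> with moments of every order, which makes the estimates uniform over the
  coordinates.\<close>

lemma powr_Suc_diff_bounds:
  fixes a x :: real
  assumes "a \<ge> 0" "x > 0"
  shows "(a + 1) * x powr a \<le> (x + 1) powr (a + 1) - x powr (a + 1)"
    and "(x + 1) powr (a + 1) - x powr (a + 1) \<le> (a + 1) * (x + 1) powr a"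
proof -
  have "\<exists>z. x < z \<and> z < x + 1 \<and>
      (x + 1) powr (a + 1) - x powr (a + 1) = (x + 1 - x) * ((a + 1) * z powr a)"
  proof (rule MVT2)
    fix y assume "x \<le> y"
    then show "((\<lambda>y. y powr (a + 1)) has_real_derivative (a + 1) * y powr a) (at y)"
      using assms by (auto intro!: derivative_eq_intros)
  qed simp
  then obtain z where z: "x < z" "z < x + 1"
    and eq: "(x + 1) powr (a + 1) - x powr (a + 1) = (a + 1) * z powr a" by auto
  show "(a + 1) * x powr a \<le> (x + 1) powr (a + 1) - x powr (a + 1)"
    "(x + 1) powr (a + 1) - x powr (a + 1) \<le> (a + 1) * (x + 1) powr a"
    unfolding eq using z assms by (auto intro!: mult_left_mono powr_mono2)
qed

text \<open>The two mean value bounds telescope and enclose \<open>a + 1\<close> times the sum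
  between \<open>n powr (a + 1)\<close> and \<open>(n + 1) powr (a + 1)\<close>, whose ratio tends
  to 1.\<close>

lemma sum_powr_asymp:
  fixes a :: real
  assumes "a \<ge> 0"
  shows "(\<lambda>n. (\<Sum>i=1..n. real i powr a) / real n powr (a + 1)) \<longlonglongrightarrow> 1 / (a + 1)"
proof (rule tendsto_sandwich)
  have lower: "real n powr (a + 1) \<le> (a + 1) * (\<Sum>i=1..n. real i powr a)" for n
  proof (induction n)
    case (Suc n)
    have "real (Suc n) powr (a + 1) - real n powr (a + 1) \<le> (a + 1) * real (Suc n) powr a"
      \<comment> \<open>The mean value bound requires a positive left end; at \<open>n = 0\<close>
        the inequality reads \<open>1 \<le> a + 1\<close>.\<close>
      using powr_Suc_diff_bounds(2)[of a "real n"] assms by (cases "n = 0") (auto simp: add.commute)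
    then show ?case using Suc by (simp add: distrib_left)
  qed simp
  have upper: "(a + 1) * (\<Sum>i=1..n. real i powr a) \<le> real (n + 1) powr (a + 1)" for n
  proof (induction n)
    case (Suc n)
    have "(a + 1) * real (Suc n) powr a \<le> real (Suc n + 1) powr (a + 1) - real (Suc n) powr (a + 1)"
      using powr_Suc_diff_bounds(1)[of a "real (Suc n)"] assms by (simp add: add.commute)
    then show ?case using Suc by (simp add: distrib_left)
  qed simp
  show "\<forall>\<^sub>F n in sequentially. 1 / (a + 1) \<le> (\<Sum>i=1..n. real i powr a) / real n powr (a + 1)"
    using eventually_gt_at_top[of 0]
  proof eventually_elim
    case (elim n)
    then show ?case using lower[of n] assms by (simp add: field_simps)
  qed
  show "\<forall>\<^sub>F n in sequentially. (\<Sum>i=1..n. real i powr a) / real n powr (a + 1)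
      \<le> (1 + 1 / real n) powr (a + 1) / (a + 1)"
    using eventually_gt_at_top[of 0]
  proof eventually_elim
    case (elim n)
    have "(1 + 1 / real n) powr (a + 1) = real (n + 1) powr (a + 1) / real n powr (a + 1)"
      using elim by (simp add: powr_divide flip: powr_divide) (simp add: field_simps)
    then show ?case using upper[of n] assms elim by (simp add: field_simps)
  qed
  have "(\<lambda>n. 1 + 1 / real n) \<longlonglongrightarrow> 1 + 0"
    by (intro tendsto_intros lim_1_over_n)
  then show "(\<lambda>n. (1 + 1 / real n) powr (a + 1) / (a + 1)) \<longlonglongrightarrow> 1 / (a + 1)"
    using assms by (auto intro!: tendsto_eq_intros)
qed simp

text \<open>\<open>min 1 (exp x) = exp (min 0 x)\<close>, and \<open>exp\<close> has slope at most 1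
  on the negative half-line. The cap at 1 allows bounded convergence to be applied to the right-hand
  side without any moment of the perturbation.\<close>

lemma min_1_exp_lipschitz:
  fixes a b :: real
  shows "\<bar>min 1 (exp a) - min 1 (exp b)\<bar> \<le> min 1 \<bar>a - b\<bar>"
proof -
  have *: "exp x - exp y \<le> x - y" if "y \<le> x" "x \<le> 0" for x y :: real
  proof -
    have "exp x - exp y = exp x * (1 - exp (y - x))" by (simp add: right_diff_distrib flip: exp_add)
    also have "\<dots> \<le> 1 * (x - y)"
    proof (intro mult_mono)
      show "1 - exp (y - x) \<le> x - y" using exp_ge_add_one_self[of "y - x"] by linarith
    qed (use that in auto)
    finally show ?thesis by simp
  qed
  have "\<bar>min 1 (exp a) - min 1 (exp b)\<bar> \<le> \<bar>a - b\<bar>" if "b \<le> a" for a b :: real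
  proof -
    have "min 1 (exp x) = exp (min 0 x)" for x :: real by (auto simp: min_def)
    moreover have "exp (min 0 a) - exp (min 0 b) \<le> min 0 a - min 0 b"
      using that by (intro *) auto
    moreover have "exp (min 0 b) \<le> exp (min 0 a)" using that by simp
    ultimately show ?thesis using that by (auto simp: min_def split: if_splits)
  qed
  from this[of a b] this[of b a] have "\<bar>min 1 (exp a) - min 1 (exp b)\<bar> \<le> \<bar>a - b\<bar>"
    by (cases "a \<le> b") (auto simp: abs_minus_commute)
  moreover have "\<bar>min 1 (exp a) - min 1 (exp b)\<bar> \<le> 1"
  proof -
    have "0 \<le> min 1 (exp x)" "min 1 (exp x) \<le> 1" for x :: real by auto
    from this[of a] this[of b] show ?thesis by linarith
  qed
  ultimately show ?thesis by simp
qed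

text \<open>The exponential is the likelihood ratio of \<open>N(s, 1)\<close> to
  \<open>N(0, 1)\<close>, so the integral is the area under the minimum of the two densities. They
  cross at \<open>s / 2\<close>, and by symmetry each side contributes a Gaussian tail of the same
  mass.\<close>

lemma expectation_min_1_exp_std_normal:
  fixes s :: real
  assumes "s \<ge> 0"
  shows "(\<integral>z. min 1 (exp (s * z - s\<^sup>2 / 2)) \<partial>std_normal_distribution) = 2 * std_normal_cdf (- s / 2)"
proof -
  let ?d = std_normal_density and ?I = "indicator {..- s / 2} :: real \<Rightarrow> real"
  have int: "integrable lborel (\<lambda>x. ?d x * ?I x)"
    by (intro integrable_real_mult_indicator integrable_normal_density) auto
  have cdf: "(\<integral>x. ?d x * ?I x \<partial>lborel) = std_normal_cdf (- s / 2)"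
  proof -
    have "std_normal_cdf (- s / 2) = (\<integral>x. ?I x \<partial>std_normal_distribution)"
      by (simp add: std_normal_cdf_def cdf_def)
    also have "\<dots> = (\<integral>x. ?d x * ?I x \<partial>lborel)"
      by (subst integral_density) (auto simp: normal_density_nonneg)
    finally show ?thesis by simp
  qed
  have 1: "has_bochner_integral lborel (\<lambda>z. ?d z * indicator {s / 2..} z) (std_normal_cdf (- s / 2))"
  proof -
    have eq: "?d (0 + - 1 * z) * ?I (0 + - 1 * z) = ?d z * indicator {s / 2..} z" for z
      by (auto simp: std_normal_density_def indicator_def)
    have "integrable lborel (\<lambda>z. ?d z * indicator {s / 2..} z)"
      unfolding eq[symmetric] by (rule lborel_integrable_real_affine[OF int]) simp
    moreover have "(\<integral>z. ?d z * ?I z \<partial>lborel) = \<bar>- 1\<bar> *\<^sub>R (\<integral>z. ?d z * indicator {s / 2..} z \<partial>lborel)"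
      unfolding eq[symmetric] by (rule lborel_integral_real_affine) simp
    ultimately show ?thesis using cdf by (simp add: has_bochner_integral_iff)
  qed
  have 2: "has_bochner_integral lborel (\<lambda>z. ?d (z - s) * indicator {..s / 2} z) (std_normal_cdf (- s / 2))"
  proof -
    have eq: "?d (- s + 1 * z) * ?I (- s + 1 * z) = ?d (z - s) * indicator {..s / 2} z" for z
      by (auto simp: indicator_def)
    have "integrable lborel (\<lambda>z. ?d (z - s) * indicator {..s / 2} z)"
      unfolding eq[symmetric] by (rule lborel_integrable_real_affine[OF int]) simp
    moreover have "(\<integral>z. ?d z * ?I z \<partial>lborel) = \<bar>1\<bar> *\<^sub>R (\<integral>z. ?d (z - s) * indicator {..s / 2} z \<partial>lborel)"
      unfolding eq[symmetric] by (rule lborel_integral_real_affine) simp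
    ultimately show ?thesis using cdf by (simp add: has_bochner_integral_iff)
  qed
  have "(\<integral>z. min 1 (exp (s * z - s\<^sup>2 / 2)) \<partial>std_normal_distribution)
      = (\<integral>z. ?d z * min 1 (exp (s * z - s\<^sup>2 / 2)) \<partial>lborel)"
    by (subst integral_density) (auto simp: normal_density_nonneg)
  also have "\<dots> = (\<integral>z. ?d z * indicator {s / 2..} z + ?d (z - s) * indicator {..s / 2} z \<partial>lborel)"
  proof (rule integral_cong_AE)
    show "AE z in lborel. ?d z * min 1 (exp (s * z - s\<^sup>2 / 2)) =
        ?d z * indicator {s / 2..} z + ?d (z - s) * indicator {..s / 2} z"
      \<comment> \<open>At the crossing point both indicators equal 1 and the pointwise identity
        fails; a null set.\<close>
      using AE_lborel_singleton[of "s / 2"]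
    proof eventually_elim
      case (elim z)
      have tilt: "?d (z - s) = ?d z * exp (s * z - s\<^sup>2 / 2)"
        by (simp add: std_normal_density_def power2_eq_square algebra_simps add_divide_distrib
            diff_divide_distrib flip: exp_add)
      show ?case
      proof (cases "z < s / 2")
        case True
        then have "s * z \<le> s * (s / 2)" using assms by (intro mult_left_mono) auto
        then show ?thesis using True tilt by (simp add: power2_eq_square)
      next
        case False
        then have "s * (s / 2) \<le> s * z" using assms by (intro mult_left_mono) auto
        then show ?thesis using False elim by (simp add: power2_eq_square)
      qed
    qed
  qed measurable
  also have "\<dots> = 2 * std_normal_cdf (- s / 2)"
    using has_bochner_integral_add[OF 1 2] by (simp add: has_bochner_integral_iff)
  finally show ?thesis .
qed

text \<open>The Weierstrass product inequality; it bounds the defect of a product of Hellinger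
  affinities by the sum of the defects.\<close>

lemma one_minus_prod_le_sum:
  fixes a :: "'i \<Rightarrow> real"
  assumes "\<And>i. i \<in> I \<Longrightarrow> 0 \<le> a i" "\<And>i. i \<in> I \<Longrightarrow> a i \<le> 1"
  shows "1 - (\<Prod>i\<in>I. a i) \<le> (\<Sum>i\<in>I. 1 - a i)"
  using assms
proof (induction I rule: infinite_finite_induct)
  case (insert j I)
  have "0 \<le> (\<Prod>i\<in>I. a i)" "(\<Prod>i\<in>I. a i) \<le> 1"
    using insert.prems by (auto intro!: prod_nonneg prod_le_1)
  then have "0 \<le> (1 - a j) * (1 - (\<Prod>i\<in>I. a i))"
    using insert.prems by (intro mult_nonneg_nonneg) auto
  moreover have "1 - (\<Prod>i\<in>I. a i) \<le> (\<Sum>i\<in>I. 1 - a i)"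
    using insert.prems by (intro insert.IH) auto
  ultimately show ?case using insert.hyps by (simp add: algebra_simps)
qed simp_all

lemma min_1_exp_bounds: "0 \<le> min 1 (exp x)" "min 1 (exp x) \<le> 1" for x :: real
  by auto

lemma wnorm_nonneg: "wnorm n a v \<ge> 0"
  by (auto simp: wnorm_def intro!: sum_nonneg)

lemma space_Rn: "space (Rn n) = extensional {1..n}"
  by (simp add: Rn_def space_PiM PiE_def)

lemma fst_measurable: "fst \<in> borel_measurable (borel :: (real \<times> real) measure)"
  by (intro borel_measurable_continuous_onI continuous_intros)

section \<open>The one-dimensional balanced step\<close>

lemma exp_diff_le_square:
  fixes u :: real
  assumes "\<bar>u\<bar> \<le> 1"
  shows "\<bar>exp u - 1 - u\<bar> \<le> u\<^sup>2"
proof -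
  have "u \<le> exp u - 1"
    using exp_ge_add_one_self[of u] by linarith
  moreover have "exp u \<le> 1 + u + u\<^sup>2"
  proof (cases "u \<ge> 0")
    case True
    then show ?thesis using exp_bound[of u] assms by simp
  next
    case False
    have "1 / (1 - u) = 1 + u + u\<^sup>2 / (1 - u)"
      using False by (simp add: field_simps power2_eq_square)
    moreover have "exp u \<le> 1 / (1 - u)"
    proof -
      have "1 - u \<le> exp (- u)"
        using exp_ge_add_one_self[of "- u"] by simp
      then have "1 / exp (- u) \<le> 1 / (1 - u)"
        using False by (intro divide_left_mono) (auto intro: mult_pos_pos)
      then show ?thesis by (simp add: exp_minus field_simps)
    qed
    moreover have "u\<^sup>2 / (1 - u) \<le> u\<^sup>2 / 1"
      using False by (intro divide_left_mono) auto
    ultimately show ?thesis by simp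
  qed
  ultimately show ?thesis by (simp add: abs_le_iff)
qed

text \<open>For \<open>\<bar>u\<bar> > 1\<close> the cubic term makes the left side negative.
  Otherwise \<open>v = u / 2\<close> satisfies \<open>\<bar>1 - exp v\<bar> \<ge> \<bar>v\<bar> / 2
  = \<bar>u\<bar> / 4\<close>, and squaring gives the constant 16.\<close>

lemma exp_half_square_ge:
  fixes u :: real
  shows "(u\<^sup>2 - \<bar>u\<bar> ^ 3) / 16 \<le> (1 - exp (u / 2))\<^sup>2"
proof (cases "\<bar>u\<bar> \<le> 1")
  case False
  then have "u\<^sup>2 * 1 \<le> u\<^sup>2 * \<bar>u\<bar>"
    by (intro mult_left_mono) auto
  also have "u\<^sup>2 * \<bar>u\<bar> = \<bar>u\<bar> ^ 3"
    by (simp add: power2_eq_square power3_eq_cube abs_mult_self_eq)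
  finally have "(u\<^sup>2 - \<bar>u\<bar> ^ 3) / 16 \<le> 0" by simp
  then show ?thesis by (rule order_trans) simp
next
  case True
  define v where "v = u / 2"
  have v: "\<bar>v\<bar> \<le> 1 / 2" using True by (simp add: v_def)
  have "\<bar>exp v - 1 - v\<bar> \<le> v\<^sup>2" using v by (intro exp_diff_le_square) simp
  moreover have "v\<^sup>2 \<le> \<bar>v\<bar> / 2"
    using mult_right_mono[OF v, of "\<bar>v\<bar>"] by (simp add: power2_eq_square abs_mult_self_eq)
  ultimately have "\<bar>v\<bar> / 2 \<le> \<bar>1 - exp v\<bar>" by (auto simp: abs_if split: if_splits)
  then have "(\<bar>v\<bar> / 2)\<^sup>2 \<le> \<bar>1 - exp v\<bar>\<^sup>2" by (intro power_mono) auto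
  then have "u\<^sup>2 / 16 \<le> (1 - exp (u / 2))\<^sup>2"
    by (simp add: v_def power_divide)
  moreover have "(u\<^sup>2 - \<bar>u\<bar> ^ 3) / 16 \<le> u\<^sup>2 / 16" by simp
  ultimately show ?thesis by linarith
qed

text \<open>Shaped for the balance relation: the even function \<open>min 1 (u\<^sup>2)\<close> has
  the same expectation with and without the weight \<open>exp u\<close>. Positive \<open>u\<close>
  reduce to negative ones by factoring out \<open>exp u\<close>.\<close>

lemma exp_half_square_le:
  fixes u :: real
  shows "(1 - exp (u / 2))\<^sup>2 \<le> min 1 (u\<^sup>2) * (1 + exp u)"
proof -
  have *: "(1 - exp (v / 2))\<^sup>2 \<le> min 1 (v\<^sup>2)" if "v \<le> 0" for v :: real
  proof -
    have "1 - exp (v / 2) \<le> - v / 2"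
      using exp_ge_add_one_self[of "v / 2"] by linarith
    then have "(1 - exp (v / 2))\<^sup>2 \<le> (- v / 2)\<^sup>2"
      using that by (intro power_mono) auto
    also have "\<dots> \<le> v\<^sup>2" by (simp add: power_divide)
    finally show ?thesis using that
      by (auto simp: power_le_one)
  qed
  show ?thesis
  proof (cases "u \<le> 0")
    case True
    have "min 1 (u\<^sup>2) * 1 \<le> min 1 (u\<^sup>2) * (1 + exp u)" by (intro mult_left_mono) auto
    then show ?thesis using *[OF True] by linarith
  next
    case False
    have "(1 - exp (u / 2))\<^sup>2 = exp u * (1 - exp (- u / 2))\<^sup>2"
    proof -
      have "exp u = (exp (u / 2))\<^sup>2" by (simp add: power2_eq_square flip: exp_add)
      then have "exp u * (1 - exp (- u / 2))\<^sup>2 = (exp (u / 2) * (1 - exp (- u / 2)))\<^sup>2"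
        by (simp add: power_mult_distrib)
      also have "exp (u / 2) * (1 - exp (- u / 2)) = exp (u / 2) - 1"
        by (simp add: algebra_simps flip: exp_add)
      finally show ?thesis by (simp add: power2_commute)
    qed
    also have "\<dots> \<le> exp u * min 1 ((- u)\<^sup>2)"
      using *[of "- u"] False by (intro mult_left_mono) auto
    also have "\<dots> \<le> min 1 (u\<^sup>2) * (1 + exp u)" by (simp add: algebra_simps)
    finally show ?thesis .
  qed
qed

text \<open>One rescaled coordinate: \<open>P\<close> is the joint law of state and Gaussian noise,
  \<open>Y \<epsilon>\<close> the proposed point, \<open>r \<epsilon>\<close> the log acceptance
  ratio at step size \<open>\<epsilon>\<close>, and \<open>C\<close> its leading coefficient at
  order \<open>k\<close>. The single envelope \<open>W\<close> dominates state, coefficient and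
  remainders. Balance is required for nonnegative extended-real test functions, so that it can be
  invoked before any integrability of \<open>exp r\<close> is known.\<close>

locale balanced_step = prob_space P for P :: "(real \<times> real) measure" +
  fixes r Y :: "real \<Rightarrow> real \<times> real \<Rightarrow> real" and C W :: "real \<times> real \<Rightarrow> real" and k :: nat
  assumes sets_P: "sets P = sets borel"
    and r_meas: "\<And>\<epsilon>. r \<epsilon> \<in> borel_measurable borel"
    and Y_meas: "\<And>\<epsilon>. Y \<epsilon> \<in> borel_measurable borel"
    and C_meas: "C \<in> borel_measurable borel"
    and W_meas: "W \<in> borel_measurable borel"
    and balance: "\<And>\<epsilon> c. \<epsilon> > 0 \<Longrightarrow> c \<in> borel_measurable borel \<Longrightarrow>
      (\<integral>\<^sup>+u. c (- r \<epsilon> u) \<partial>P) = (\<integral>\<^sup>+u. c (r \<epsilon> u) * ennreal (exp (r \<epsilon> u)) \<partial>P)"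
    and W_moment: "\<And>j. integrable P (\<lambda>u. W u ^ j)"
    and W_ge_1: "\<And>u. W u \<ge> 1"
    and fst_le_W: "\<And>u. \<bar>fst u\<bar> \<le> W u"
    and C_le_W: "\<And>u. \<bar>C u\<bar> \<le> W u"
    and Y_approx: "\<And>\<epsilon> u. 0 < \<epsilon> \<Longrightarrow> \<epsilon> \<le> 1 \<Longrightarrow> \<bar>Y \<epsilon> u - fst u\<bar> \<le> \<epsilon> * W u"
    and r_approx: "\<And>\<epsilon> u. 0 < \<epsilon> \<Longrightarrow> \<epsilon> \<le> 1 \<Longrightarrow> \<bar>r \<epsilon> u - \<epsilon> ^ k * C u\<bar> \<le> \<epsilon> ^ (k + 1) * W u"
    and k_pos: "k \<ge> 1"
    and C_nonzero: "expectation (\<lambda>u. (C u)\<^sup>2) > 0"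
begin

declare sets_P [measurable_cong] r_meas [measurable] Y_meas [measurable] C_meas [measurable]
  W_meas [measurable]

section \<open>Moments of the log-ratio\<close>

definition K :: real where "K = expectation (\<lambda>u. (C u)\<^sup>2)"

text \<open>One constant for the first three moments: because \<open>W \<ge> 1\<close>, lower powers
  of \<open>W\<close> are dominated by the cube.\<close>

definition B :: real where "B = expectation (\<lambda>u. W u ^ 3)"

lemma K_pos: "K > 0"
  using C_nonzero by (simp add: K_def)

lemma W_nonneg: "W u \<ge> 0"
  using W_ge_1[of u] by simp

lemma integrable_W_bound:
  assumes "h \<in> borel_measurable P" "\<And>u. \<bar>h u\<bar> \<le> c * W u ^ j"
  shows "integrable P h"
proof (rule Bochner_Integration.integrable_bound)
  show "integrable P (\<lambda>u. c * W u ^ j)" by (intro integrable_mult_right W_moment)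
  show "AE u in P. norm (h u) \<le> norm (c * W u ^ j)"
    using order_trans[OF assms(2) abs_ge_self] by (intro AE_I2) simp
qed fact

lemma expectation_W_bound:
  assumes "h \<in> borel_measurable P" "\<And>u. \<bar>h u\<bar> \<le> c * W u ^ 3"
  shows "\<bar>expectation h\<bar> \<le> c * B"
proof -
  have "\<bar>expectation h\<bar> \<le> expectation (\<lambda>u. \<bar>h u\<bar>)"
    by (rule integral_abs_bound)
  also have "\<dots> \<le> expectation (\<lambda>u. c * W u ^ 3)"
    using assms by (intro integral_mono integrable_mult_right W_moment integrable_abs
        integrable_W_bound[where c = c and j = 3]) auto
  finally show ?thesis by (simp add: B_def)
qed

lemma B_nonneg: "B \<ge> 0"
  unfolding B_def by (intro integral_nonneg_AE AE_I2) (simp add: W_nonneg)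

lemma r_bound:
  assumes "0 < \<epsilon>" "\<epsilon> \<le> 1"
  shows "\<bar>r \<epsilon> u\<bar> \<le> 2 * \<epsilon> ^ k * W u"
proof -
  have "\<epsilon> ^ (k + 1) * W u \<le> \<epsilon> ^ k * W u"
    using assms W_nonneg[of u] by (intro mult_right_mono power_decreasing) auto
  moreover have "\<bar>\<epsilon> ^ k * C u\<bar> \<le> \<epsilon> ^ k * W u"
    using assms C_le_W[of u] by (simp add: abs_mult)
  ultimately show ?thesis using r_approx[OF assms, of u] by (auto simp: algebra_simps)
qed

lemma integrable_r_power:
  assumes "0 < \<epsilon>" "\<epsilon> \<le> 1"
  shows "integrable P (\<lambda>u. r \<epsilon> u ^ j)"
proof (rule integrable_W_bound)
  show "\<bar>r \<epsilon> u ^ j\<bar> \<le> (2 * \<epsilon> ^ k) ^ j * W u ^ j" for u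
    using power_mono[OF r_bound[OF assms, of u], of j] by (simp add: power_abs power_mult_distrib)
qed measurable

lemma integrable_r_abs_power:
  assumes "0 < \<epsilon>" "\<epsilon> \<le> 1"
  shows "integrable P (\<lambda>u. \<bar>r \<epsilon> u\<bar> ^ j)"
  using integrable_abs[OF integrable_r_power[OF assms, of j]] by (simp add: power_abs)

lemma W_power_le:
  assumes "j \<le> 3" shows "W u ^ j \<le> W u ^ 3"
  using assms W_ge_1 by (intro power_increasing) auto

text \<open>Measures the cost of removing one coordinate from the log-ratio, which is paid for an
  initial block in the critical regime.\<close>

lemma r_first_abs_moment:
  assumes "0 < \<epsilon>" "\<epsilon> \<le> 1"
  shows "expectation (\<lambda>u. \<bar>r \<epsilon> u\<bar>) \<le> 2 * B * \<epsilon> ^ k"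
proof -
  have "\<bar>expectation (\<lambda>u. \<bar>r \<epsilon> u\<bar>)\<bar> \<le> (2 * \<epsilon> ^ k) * B"
  proof (rule expectation_W_bound)
    show "\<bar>\<bar>r \<epsilon> u\<bar>\<bar> \<le> 2 * \<epsilon> ^ k * W u ^ 3" for u
    proof -
      have "2 * \<epsilon> ^ k * W u ^ 1 \<le> 2 * \<epsilon> ^ k * W u ^ 3"
        using assms by (intro mult_left_mono W_power_le) auto
      then show ?thesis using r_bound[OF assms, of u] by simp
    qed
  qed measurable
  then show ?thesis by (simp add: mult_ac)
qed

lemma r_third_moment:
  assumes "0 < \<epsilon>" "\<epsilon> \<le> 1"
  shows "expectation (\<lambda>u. \<bar>r \<epsilon> u\<bar> ^ 3) \<le> 8 * B * \<epsilon> ^ (2 * k + 1)"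
proof -
  have "\<bar>expectation (\<lambda>u. \<bar>r \<epsilon> u\<bar> ^ 3)\<bar> \<le> (8 * \<epsilon> ^ (2 * k + 1)) * B"
  proof (rule expectation_W_bound)
    show "\<bar>\<bar>r \<epsilon> u\<bar> ^ 3\<bar> \<le> 8 * \<epsilon> ^ (2 * k + 1) * W u ^ 3" for u
    proof -
      have "\<bar>r \<epsilon> u\<bar> ^ 3 \<le> (2 * \<epsilon> ^ k * W u) ^ 3"
        by (intro power_mono r_bound assms) auto
      also have "\<dots> = 8 * \<epsilon> ^ (k * 3) * W u ^ 3"
        by (simp add: power_mult_distrib power_mult)
      \<comment> \<open>\<open>3 * k \<ge> 2 * k + 1\<close> because \<open>k \<ge> 1\<close>: third
        moments are of smaller order than the variance \<open>\<epsilon> ^ (2 * k)\<close>.\<close>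
      also have "\<dots> \<le> 8 * \<epsilon> ^ (2 * k + 1) * W u ^ 3"
        using assms k_pos W_nonneg[of u]
        by (intro mult_right_mono mult_left_mono power_decreasing) auto
      finally show ?thesis by simp
    qed
  qed measurable
  then show ?thesis by (simp add: mult_ac)
qed

lemma r_second_moment:
  assumes "0 < \<epsilon>" "\<epsilon> \<le> 1"
  shows "\<bar>expectation (\<lambda>u. (r \<epsilon> u)\<^sup>2) - \<epsilon> ^ (2 * k) * K\<bar> \<le> 3 * B * \<epsilon> ^ (2 * k + 1)"
proof -
  have C2: "integrable P (\<lambda>u. (C u)\<^sup>2)"
    using C_le_W power_mono[of "\<bar>C u\<bar>" "W u" 2 for u]
    by (intro integrable_W_bound[where c = 1 and j = 2]) auto
  have "expectation (\<lambda>u. (r \<epsilon> u)\<^sup>2) - \<epsilon> ^ (2 * k) * K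
      = expectation (\<lambda>u. (r \<epsilon> u)\<^sup>2 - \<epsilon> ^ (2 * k) * (C u)\<^sup>2)"
    using integrable_r_power[OF assms, of 2] C2 by (simp add: K_def)
  also have "\<bar>\<dots>\<bar> \<le> (3 * \<epsilon> ^ (2 * k + 1)) * B"
  proof (rule expectation_W_bound)
    show "\<bar>(r \<epsilon> u)\<^sup>2 - \<epsilon> ^ (2 * k) * (C u)\<^sup>2\<bar> \<le> 3 * \<epsilon> ^ (2 * k + 1) * W u ^ 3" for u
    proof -
      have "(r \<epsilon> u)\<^sup>2 - \<epsilon> ^ (2 * k) * (C u)\<^sup>2 = (r \<epsilon> u - \<epsilon> ^ k * C u) * (r \<epsilon> u + \<epsilon> ^ k * C u)"
        by (simp add: algebra_simps power2_eq_square power_mult)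
      also have "\<bar>\<dots>\<bar> \<le> (\<epsilon> ^ (k + 1) * W u) * (3 * \<epsilon> ^ k * W u)"
      proof -
        have "\<bar>\<epsilon> ^ k * C u\<bar> \<le> \<epsilon> ^ k * W u"
          using assms C_le_W[of u] by (simp add: abs_mult)
        then have "\<bar>r \<epsilon> u + \<epsilon> ^ k * C u\<bar> \<le> 3 * \<epsilon> ^ k * W u"
          using r_bound[OF assms, of u] by linarith
        then show ?thesis
          unfolding abs_mult using assms W_nonneg[of u]
          by (intro mult_mono r_approx assms) auto
      qed
      also have "\<dots> = 3 * \<epsilon> ^ (2 * k + 1) * W u ^ 2"
        by (simp add: power2_eq_square power_add mult_2)
      also have "\<dots> \<le> 3 * \<epsilon> ^ (2 * k + 1) * W u ^ 3"
        using assms by (intro mult_left_mono W_power_le) auto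
      finally show ?thesis .
    qed
  qed measurable
  finally show ?thesis by (simp add: mult_ac)
qed

section \<open>Exponential moments from the balance relation\<close>

lemma integrable_exp_r:
  assumes "\<epsilon> > 0"
  shows "integrable P (\<lambda>u. exp (r \<epsilon> u))" "expectation (\<lambda>u. exp (r \<epsilon> u)) = 1"
proof -
  have "(\<integral>\<^sup>+u. ennreal (exp (r \<epsilon> u)) \<partial>P) = 1"
    using balance[OF assms, of "\<lambda>_. 1"] by (simp add: emeasure_space_1)
  then have "has_bochner_integral P (\<lambda>u. exp (r \<epsilon> u)) 1"
    by (intro has_bochner_integral_nn_integral) auto
  then show "integrable P (\<lambda>u. exp (r \<epsilon> u))" "expectation (\<lambda>u. exp (r \<epsilon> u)) = 1"
    by (auto simp: has_bochner_integral_iff)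
qed

lemma balance_expectation:
  fixes c :: "real \<Rightarrow> real"
  assumes "\<epsilon> > 0" and [measurable]: "c \<in> borel_measurable borel" and c: "\<And>x. 0 \<le> c x" "\<And>x. c x \<le> D"
  shows "expectation (\<lambda>u. c (- r \<epsilon> u)) = expectation (\<lambda>u. c (r \<epsilon> u) * exp (r \<epsilon> u))"
proof -
  have "expectation (\<lambda>u. c (- r \<epsilon> u)) = enn2real (\<integral>\<^sup>+u. ennreal (c (- r \<epsilon> u)) \<partial>P)"
    by (intro integral_eq_nn_integral) (auto simp: c)
  also have "(\<integral>\<^sup>+u. ennreal (c (- r \<epsilon> u)) \<partial>P) = (\<integral>\<^sup>+u. ennreal (c (r \<epsilon> u) * exp (r \<epsilon> u)) \<partial>P)"
    using balance[OF assms(1), of "\<lambda>x. ennreal (c x)"] by (simp add: ennreal_mult c)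
  also have "enn2real \<dots> = expectation (\<lambda>u. c (r \<epsilon> u) * exp (r \<epsilon> u))"
    by (intro integral_eq_nn_integral[symmetric]) (auto simp: c)
  finally show ?thesis .
qed

text \<open>
  Applied to the odd function \<open>u 1{\<bar>u\<bar> \<le> 1}\<close>, the balance relation determines the mean from the
  variance. This replaces the Taylor expansion of the mean to order \<open>2k\<close>.
\<close>

lemma r_mean_variance:
  assumes "0 < \<epsilon>" "\<epsilon> \<le> 1"
  shows "\<bar>expectation (r \<epsilon>) + expectation (\<lambda>u. (r \<epsilon> u)\<^sup>2) / 2\<bar> \<le> 12 * B * \<epsilon> ^ (2 * k + 1)"
proof -
  define \<psi> :: "real \<Rightarrow> real" where "\<psi> u = (if \<bar>u\<bar> \<le> 1 then u else 0)" for u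
  have [measurable]: "\<psi> \<in> borel_measurable borel" unfolding \<psi>_def by measurable
  have \<psi>: "\<bar>\<psi> u\<bar> \<le> 1" "\<psi> (- u) = - \<psi> u" for u by (auto simp: \<psi>_def)
  have int: "integrable P (\<lambda>u. \<psi> (r \<epsilon> u))"
    by (intro integrable_const_bound[where B = 1]) (auto simp: \<psi>)
  have inte: "integrable P (\<lambda>u. \<psi> (r \<epsilon> u) * exp (r \<epsilon> u))"
  proof (rule Bochner_Integration.integrable_bound[OF integrable_exp_r(1)[OF assms(1)]])
    show "AE u in P. norm (\<psi> (r \<epsilon> u) * exp (r \<epsilon> u)) \<le> norm (exp (r \<epsilon> u))"
      by (auto simp: abs_mult \<psi>)
  qed measurable
  have int1: "integrable P (r \<epsilon>)" and int2: "integrable P (\<lambda>u. (r \<epsilon> u)\<^sup>2)"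
    using integrable_r_power[OF assms, of 1] integrable_r_power[OF assms, of 2] by auto
  note int3 = integrable_r_abs_power[OF assms, of 3]
  \<comment> \<open>The shift by 1 makes the test function nonnegative; it drops out again since
    \<open>exp (r \<epsilon>)\<close> has expectation 1.\<close>
  have "expectation (\<lambda>u. 1 + \<psi> (- r \<epsilon> u)) = expectation (\<lambda>u. (1 + \<psi> (r \<epsilon> u)) * exp (r \<epsilon> u))"
  proof (rule balance_expectation[where D = 2])
    show "0 \<le> 1 + \<psi> x" "1 + \<psi> x \<le> 2" for x using \<psi>(1)[of x] by linarith+
  qed (use assms in auto)
  then have *: "- expectation (\<lambda>u. \<psi> (r \<epsilon> u)) = expectation (\<lambda>u. \<psi> (r \<epsilon> u) * exp (r \<epsilon> u))"
    using int inte integrable_exp_r[OF assms(1)] by (simp add: \<psi> distrib_right prob_space)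
  \<comment> \<open>Moving both truncated means to one side leaves
    \<open>\<psi> (r) * (exp r - 1)\<close>, which agrees with \<open>r\<^sup>2\<close> up to a
    cubic error.\<close>
  have "2 * expectation (\<lambda>u. \<psi> (r \<epsilon> u)) + expectation (\<lambda>u. (r \<epsilon> u)\<^sup>2)
      = expectation (\<lambda>u. (r \<epsilon> u)\<^sup>2 - \<psi> (r \<epsilon> u) * (exp (r \<epsilon> u) - 1))"
    using int inte int2 * by (simp add: right_diff_distrib)
  also have "\<bar>\<dots>\<bar> \<le> expectation (\<lambda>u. \<bar>(r \<epsilon> u)\<^sup>2 - \<psi> (r \<epsilon> u) * (exp (r \<epsilon> u) - 1)\<bar>)"
    by (rule integral_abs_bound)
  also have "\<dots> \<le> expectation (\<lambda>u. \<bar>r \<epsilon> u\<bar> ^ 3)"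
  proof (rule integral_mono[OF _ int3])
    show "integrable P (\<lambda>u. \<bar>(r \<epsilon> u)\<^sup>2 - \<psi> (r \<epsilon> u) * (exp (r \<epsilon> u) - 1)\<bar>)"
      using int inte int2 by (simp add: right_diff_distrib)
    have "\<bar>x\<^sup>2 - \<psi> x * (exp x - 1)\<bar> \<le> \<bar>x\<bar> ^ 3" for x :: real
    proof (cases "\<bar>x\<bar> \<le> 1")
      case True
      have "x\<^sup>2 - \<psi> x * (exp x - 1) = - x * (exp x - 1 - x)"
        using True by (simp add: \<psi>_def power2_eq_square algebra_simps)
      also have "\<bar>\<dots>\<bar> \<le> \<bar>x\<bar> * x\<^sup>2"
        unfolding abs_mult abs_minus using exp_diff_le_square[OF True] by (intro mult_left_mono) auto
      finally show ?thesis by (simp add: power2_eq_square power3_eq_cube)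
    next
      case False
      then have "\<bar>x\<bar>\<^sup>2 * 1 \<le> \<bar>x\<bar>\<^sup>2 * \<bar>x\<bar>" by (intro mult_left_mono) auto
      then show ?thesis using False by (simp add: \<psi>_def power2_eq_square power3_eq_cube)
    qed
    then show "\<bar>(r \<epsilon> u)\<^sup>2 - \<psi> (r \<epsilon> u) * (exp (r \<epsilon> u) - 1)\<bar> \<le> \<bar>r \<epsilon> u\<bar> ^ 3" for u by simp
  qed
  finally have 1: "\<bar>2 * expectation (\<lambda>u. \<psi> (r \<epsilon> u)) + expectation (\<lambda>u. (r \<epsilon> u)\<^sup>2)\<bar>
    \<le> expectation (\<lambda>u. \<bar>r \<epsilon> u\<bar> ^ 3)" .
  have "expectation (r \<epsilon>) - expectation (\<lambda>u. \<psi> (r \<epsilon> u)) = expectation (\<lambda>u. r \<epsilon> u - \<psi> (r \<epsilon> u))"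
    using int int1 by simp
  also have "\<bar>\<dots>\<bar> \<le> expectation (\<lambda>u. \<bar>r \<epsilon> u - \<psi> (r \<epsilon> u)\<bar>)"
    by (rule integral_abs_bound)
  also have "\<dots> \<le> expectation (\<lambda>u. \<bar>r \<epsilon> u\<bar> ^ 3)"
  proof (rule integral_mono[OF _ int3])
    show "integrable P (\<lambda>u. \<bar>r \<epsilon> u - \<psi> (r \<epsilon> u)\<bar>)" using int int1 by simp
    have "\<bar>x - \<psi> x\<bar> \<le> \<bar>x\<bar> ^ 3" for x :: real
      using self_le_power[of "\<bar>x\<bar>" 3] by (auto simp: \<psi>_def)
    then show "\<bar>r \<epsilon> u - \<psi> (r \<epsilon> u)\<bar> \<le> \<bar>r \<epsilon> u\<bar> ^ 3" for u by simp
  qed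
  finally have 2: "\<bar>expectation (r \<epsilon>) - expectation (\<lambda>u. \<psi> (r \<epsilon> u))\<bar> \<le> expectation (\<lambda>u. \<bar>r \<epsilon> u\<bar> ^ 3)" .
  \<comment> \<open>Half of the third-moment bound \<open>8 * B\<close> from the balance identity,
    and all of it for undoing the truncation, give \<open>12 * B\<close>.\<close>
  show ?thesis using 1 2 r_third_moment[OF assms] by linarith
qed

text \<open>The square expands to \<open>1 - 2 * exp (r / 2) + exp r\<close>, where the last term
  has expectation 1. So the left side is a squared Hellinger distance and \<open>exp (r / 2)\<close>
  integrates to the affinity.\<close>

lemma exp_half_r:
  assumes "\<epsilon> > 0"
  shows "integrable P (\<lambda>u. exp (r \<epsilon> u / 2))"
    and "integrable P (\<lambda>u. (1 - exp (r \<epsilon> u / 2))\<^sup>2)"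
    and "expectation (\<lambda>u. (1 - exp (r \<epsilon> u / 2))\<^sup>2) = 2 * (1 - expectation (\<lambda>u. exp (r \<epsilon> u / 2)))"
proof -
  have sq: "(1 - exp (x / 2))\<^sup>2 = 1 - 2 * exp (x / 2) + exp x" for x :: real
    by (simp add: power2_eq_square algebra_simps flip: exp_add)
  show 1: "integrable P (\<lambda>u. exp (r \<epsilon> u / 2))"
  proof (rule Bochner_Integration.integrable_bound)
    show "integrable P (\<lambda>u. 1 + exp (r \<epsilon> u))" using integrable_exp_r[OF assms] by simp
    have "exp (x / 2) \<le> 1 + exp x" for x :: real
      using sq[of x] zero_le_power2[of "1 - exp (x / 2)"] exp_ge_zero[of x] by linarith
    then show "AE u in P. norm (exp (r \<epsilon> u / 2)) \<le> norm (1 + exp (r \<epsilon> u))" by auto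
  qed measurable
  show "integrable P (\<lambda>u. (1 - exp (r \<epsilon> u / 2))\<^sup>2)"
    using 1 integrable_exp_r[OF assms] by (simp add: sq)
  show "expectation (\<lambda>u. (1 - exp (r \<epsilon> u / 2))\<^sup>2) = 2 * (1 - expectation (\<lambda>u. exp (r \<epsilon> u / 2)))"
    using 1 integrable_exp_r[OF assms] by (simp add: sq prob_space)
qed

lemma exp_half_r_le_1:
  assumes "\<epsilon> > 0"
  shows "expectation (\<lambda>u. exp (r \<epsilon> u / 2)) \<le> 1"
proof -
  have "0 \<le> expectation (\<lambda>u. (1 - exp (r \<epsilon> u / 2))\<^sup>2)" by simp
  then show ?thesis unfolding exp_half_r(3)[OF assms] by simp
qed

lemma exp_half_r_lower:
  assumes "0 < \<epsilon>" "\<epsilon> \<le> 1"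
  shows "1 - expectation (\<lambda>u. exp (r \<epsilon> u / 2)) \<le> (K + 3 * B) * \<epsilon> ^ (2 * k)"
proof -
  have intm: "integrable P (\<lambda>u. min 1 ((r \<epsilon> u)\<^sup>2))"
    by (intro integrable_const_bound[where B = 1]) (auto simp: min_def)
  have inte: "integrable P (\<lambda>u. min 1 ((r \<epsilon> u)\<^sup>2) * exp (r \<epsilon> u))"
  proof (rule Bochner_Integration.integrable_bound[OF integrable_exp_r(1)[OF assms(1)]])
    show "AE u in P. norm (min 1 ((r \<epsilon> u)\<^sup>2) * exp (r \<epsilon> u)) \<le> norm (exp (r \<epsilon> u))"
      by (intro AE_I2) (auto simp: abs_mult intro!: mult_left_le_one_le)
  qed measurable
  \<comment> \<open>For an even test function balance says that the weight \<open>exp r\<close>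
    leaves the expectation unchanged, which removes the exponential from the pointwise
    bound.\<close>
  have bal: "expectation (\<lambda>u. min 1 ((- r \<epsilon> u)\<^sup>2)) = expectation (\<lambda>u. min 1 ((r \<epsilon> u)\<^sup>2) * exp (r \<epsilon> u))"
    using assms by (intro balance_expectation[where D = 1]) auto
  have "2 * (1 - expectation (\<lambda>u. exp (r \<epsilon> u / 2))) = expectation (\<lambda>u. (1 - exp (r \<epsilon> u / 2))\<^sup>2)"
    using exp_half_r(3)[OF assms(1)] by simp
  also have "\<dots> \<le> expectation (\<lambda>u. min 1 ((r \<epsilon> u)\<^sup>2) + min 1 ((r \<epsilon> u)\<^sup>2) * exp (r \<epsilon> u))"
    using exp_half_square_le intm inte
    by (intro integral_mono exp_half_r assms) (auto simp: algebra_simps)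
  also have "\<dots> = 2 * expectation (\<lambda>u. min 1 ((r \<epsilon> u)\<^sup>2))"
    using intm inte bal by simp
  also have "expectation (\<lambda>u. min 1 ((r \<epsilon> u)\<^sup>2)) \<le> expectation (\<lambda>u. (r \<epsilon> u)\<^sup>2)"
    using intm integrable_r_power[OF assms, of 2] by (intro integral_mono) auto
  also have "\<dots> \<le> \<epsilon> ^ (2 * k) * K + 3 * B * \<epsilon> ^ (2 * k + 1)"
    using r_second_moment[OF assms] by linarith
  also have "\<dots> \<le> \<epsilon> ^ (2 * k) * K + 3 * B * \<epsilon> ^ (2 * k)"
    using assms B_nonneg by (intro add_left_mono mult_left_mono power_decreasing) auto
  finally show ?thesis by (simp add: algebra_simps)
qed

text \<open>The quadratic lower bound for the Hellinger integrand gives \<open>32 * (1 - affinity)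
  \<ge> \<epsilon> ^ (2 * k) * (K - 11 * B * \<epsilon>)\<close>, with \<open>11 = 3 + 8\<close>
  from the second and third moments. The smallness condition keeps at least \<open>K / 2\<close>,
  whence \<open>K / 64\<close>.\<close>

lemma exp_half_r_upper:
  assumes "0 < \<epsilon>" "\<epsilon> \<le> 1" "\<epsilon> * (22 * B) \<le> K"
  shows "expectation (\<lambda>u. exp (r \<epsilon> u / 2)) \<le> 1 - K / 64 * \<epsilon> ^ (2 * k)"
proof -
  note * = assms(1,2)
  have "(expectation (\<lambda>u. (r \<epsilon> u)\<^sup>2) - expectation (\<lambda>u. \<bar>r \<epsilon> u\<bar> ^ 3)) / 16
      = expectation (\<lambda>u. ((r \<epsilon> u)\<^sup>2 - \<bar>r \<epsilon> u\<bar> ^ 3) / 16)"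
    using integrable_r_power[OF *, of 2] integrable_r_abs_power[OF *, of 3] by simp
  also have "\<dots> \<le> expectation (\<lambda>u. (1 - exp (r \<epsilon> u / 2))\<^sup>2)"
    using integrable_r_power[OF *, of 2] integrable_r_abs_power[OF *, of 3]
    by (intro integral_mono exp_half_r exp_half_square_ge assms) auto
  also have "\<dots> = 2 * (1 - expectation (\<lambda>u. exp (r \<epsilon> u / 2)))"
    by (rule exp_half_r) fact
  finally have "expectation (\<lambda>u. (r \<epsilon> u)\<^sup>2) - expectation (\<lambda>u. \<bar>r \<epsilon> u\<bar> ^ 3)
      \<le> 32 * (1 - expectation (\<lambda>u. exp (r \<epsilon> u / 2)))" by simp
  moreover have "\<epsilon> ^ (2 * k) * K - 3 * B * \<epsilon> ^ (2 * k + 1) \<le> expectation (\<lambda>u. (r \<epsilon> u)\<^sup>2)"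
    using r_second_moment[OF *] by linarith
  moreover note r_third_moment[OF *]
  moreover have "\<epsilon> ^ (2 * k) * (\<epsilon> * (22 * B)) \<le> \<epsilon> ^ (2 * k) * K"
    using assms by (intro mult_left_mono) auto
  ultimately show ?thesis by (simp add: algebra_simps)
qed

end

section \<open>Independent coordinates with growing dimension\<close>

locale balanced_array = balanced_step +
  fixes \<kappa> l \<rho> :: real and \<sigma> :: "nat \<Rightarrow> real"
  assumes kappa: "\<kappa> \<ge> 0"
    and l_pos: "l > 0"
    and rho: "\<rho> > 2 * \<kappa>"
    and sigma: "\<And>n. n \<ge> 1 \<Longrightarrow> \<sigma> n > 0 \<and> (\<sigma> n)\<^sup>2 = l\<^sup>2 * real n powr (- \<rho>)"
begin

section \<open>The infinite product space\<close>

definition \<Omega> :: "(nat \<Rightarrow> real \<times> real) measure" where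
  "\<Omega> = PiM UNIV (\<lambda>_. P)"

sublocale \<Omega>: prob_space \<Omega>
  unfolding \<Omega>_def by (rule prob_space_PiM) (rule prob_space_axioms)

lemma sets_\<Omega> [measurable_cong]: "sets \<Omega> = sets (PiM UNIV (\<lambda>_. borel))"
  unfolding \<Omega>_def by (rule sets_PiM_cong) (auto simp: sets_P)

lemma measurable_coord: "(\<lambda>\<omega>. \<omega> i) \<in> \<Omega> \<rightarrow>\<^sub>M borel"
  by measurable

lemma space_\<Omega> [simp]: "space \<Omega> = UNIV"
  using sets_eq_imp_space_eq[OF sets_\<Omega>] by (simp add: space_PiM)

lemma prob_UNIV [simp]: "\<Omega>.prob UNIV = 1"
  using \<Omega>.prob_space by simp

lemma distr_coord: "distr \<Omega> P (\<lambda>\<omega>. \<omega> i) = P"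
  unfolding \<Omega>_def by (rule distr_PiM_component) (auto intro: prob_space_axioms)

lemma coord_P: "(\<lambda>\<omega>. \<omega> i) \<in> \<Omega> \<rightarrow>\<^sub>M P"
  unfolding \<Omega>_def by measurable

lemma expectation_coord:
  fixes h :: "real \<times> real \<Rightarrow> 'b::{banach, second_countable_topology}"
  assumes "h \<in> borel_measurable borel"
  shows "\<Omega>.expectation (\<lambda>\<omega>. h (\<omega> i)) = expectation h"
  using integral_distr[OF coord_P[of i], of h] assms
  by (simp add: distr_coord measurable_cong_sets[OF sets_P refl])

lemma integrable_coord:
  fixes h :: "real \<times> real \<Rightarrow> 'b::{banach, second_countable_topology}"
  assumes "integrable P h"
  shows "integrable \<Omega> (\<lambda>\<omega>. h (\<omega> i))"
  using integrable_distr[OF coord_P[of i], of h] assms by (simp add: distr_coord)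

lemma nn_integral_coord:
  assumes "h \<in> borel_measurable borel"
  shows "(\<integral>\<^sup>+\<omega>. h (\<omega> i) \<partial>\<Omega>) = (\<integral>\<^sup>+u. h u \<partial>P)"
  using nn_integral_distr[OF coord_P[of i], of h] assms
  by (simp add: distr_coord measurable_cong_sets[OF sets_P refl])

lemma indep_coord: "\<Omega>.indep_vars (\<lambda>_. borel) (\<lambda>i \<omega>. \<omega> i) UNIV"
proof -
  have "\<Omega>.indep_vars (\<lambda>_. P) (\<lambda>i \<omega>. \<omega> i) UNIV"
  proof (subst \<Omega>.indep_vars_iff_distr_eq_PiM)
    have "distr \<Omega> (\<Pi>\<^sub>M i\<in>UNIV. P) (\<lambda>x. \<lambda>i\<in>UNIV. x i) = \<Omega>"
      by (simp add: \<Omega>_def restrict_UNIV distr_id)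
    also have "\<dots> = (\<Pi>\<^sub>M i\<in>UNIV. distr \<Omega> P (\<lambda>\<omega>. \<omega> i))"
      by (simp add: distr_coord) (simp add: \<Omega>_def)
    finally show "distr \<Omega> (\<Pi>\<^sub>M i\<in>UNIV. P) (\<lambda>x. \<lambda>i\<in>UNIV. x i) = (\<Pi>\<^sub>M i\<in>UNIV. distr \<Omega> P (\<lambda>\<omega>. \<omega> i))" .
  qed auto
  then show ?thesis
    by (rule \<Omega>.indep_vars_compose2[where Y = "\<lambda>_ u. u"]) (rule measurable_ident_sets[OF sets_P])
qed

lemma indep_coord_fun:
  assumes "\<And>i. h i \<in> borel_measurable borel"
  shows "\<Omega>.indep_vars (\<lambda>_. borel) (\<lambda>i \<omega>. h i (\<omega> i)) I"
  by (rule \<Omega>.indep_vars_compose2[OF \<Omega>.indep_vars_subset[OF indep_coord subset_UNIV]])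
    (rule assms)

section \<open>Step sizes and their power sums\<close>

definition eps :: "nat \<Rightarrow> nat \<Rightarrow> real" where
  "eps n i = \<sigma> n * real i powr \<kappa>"

lemma sigma_eq: "n \<ge> 1 \<Longrightarrow> \<sigma> n = l * real n powr (- \<rho> / 2)"
proof -
  assume n: "n \<ge> 1"
  then have "real n powr (- \<rho>) = (real n powr (- \<rho> / 2))\<^sup>2"
    by (simp add: power2_eq_square flip: powr_add)
  then have "(\<sigma> n)\<^sup>2 = (l * real n powr (- \<rho> / 2))\<^sup>2"
    using sigma[OF n] by (simp add: power_mult_distrib)
  then show ?thesis
    by (rule power2_eq_imp_eq) (use sigma[OF n] l_pos in auto)
qed

lemma eps_pos: "1 \<le> i \<Longrightarrow> i \<le> n \<Longrightarrow> 0 < eps n i"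
  unfolding eps_def using sigma[of n] by simp

lemma eps_le: "1 \<le> i \<Longrightarrow> i \<le> n \<Longrightarrow> eps n i \<le> eps n n"
  unfolding eps_def using sigma[of n] kappa by (intro mult_left_mono powr_mono2) auto

lemma eps_diag: "n \<ge> 1 \<Longrightarrow> eps n n = l * real n powr (\<kappa> - \<rho> / 2)"
proof -
  assume "n \<ge> 1"
  then have "eps n n = l * (real n powr (- \<rho> / 2) * real n powr \<kappa>)"
    unfolding eps_def by (simp add: sigma_eq mult.assoc)
  also have "\<dots> = l * real n powr (\<kappa> - \<rho> / 2)"
    by (simp only: powr_add[symmetric]) simp
  finally show ?thesis .
qed

text \<open>The last coordinate has the largest step because \<open>\<kappa> \<ge> 0\<close>, so
  this is uniform smallness of all steps. It is where \<open>\<rho> > 2 * \<kappa>\<close>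
  enters.\<close>

lemma eps_diag_tendsto: "(\<lambda>n. eps n n) \<longlonglongrightarrow> 0"
proof -
  have "(\<lambda>n. l * real n powr (\<kappa> - \<rho> / 2)) \<longlonglongrightarrow> l * 0"
    using rho by (intro tendsto_intros tendsto_neg_powr filterlim_real_sequentially) auto
  moreover have "\<forall>\<^sub>F n in sequentially. l * real n powr (\<kappa> - \<rho> / 2) = eps n n"
    using eventually_ge_at_top[of 1] by eventually_elim (simp add: eps_diag)
  ultimately have "(\<lambda>n. eps n n) \<longlonglongrightarrow> l * 0"
    by (rule Lim_transform_eventually)
  then show ?thesis by simp
qed

lemma eventually_eps_diag_less: "c > 0 \<Longrightarrow> \<forall>\<^sub>F n in sequentially. eps n n < c"
  using order_tendstoD(2)[OF eps_diag_tendsto] .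

definition S :: "nat \<Rightarrow> nat \<Rightarrow> real" where
  "S m n = (\<Sum>i\<in>{m<..n}. eps n i ^ (2 * k))"

text \<open>Growth exponent of the accumulated variance \<open>S 0 n\<close>. It equals
  \<open>k * (2 * \<kappa> + 1 / k - \<rho>)\<close>, so its sign distinguishes the three
  regimes.\<close>

definition \<gamma> :: real where
  "\<gamma> = 1 + 2 * \<kappa> * real k - \<rho> * real k"

lemma S_asymp: "(\<lambda>n. S 0 n / real n powr \<gamma>) \<longlonglongrightarrow> l ^ (2 * k) / (1 + 2 * \<kappa> * real k)"
proof -
  define a where "a = 2 * \<kappa> * real k"
  have a: "a \<ge> 0" using kappa by (simp add: a_def)
  have "(\<lambda>n. l ^ (2 * k) * ((\<Sum>i=1..n. real i powr a) / real n powr (a + 1)))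
      \<longlonglongrightarrow> l ^ (2 * k) * (1 / (a + 1))"
    by (intro tendsto_intros sum_powr_asymp a)
  moreover have "\<forall>\<^sub>F n in sequentially. l ^ (2 * k) * ((\<Sum>i=1..n. real i powr a) / real n powr (a + 1))
      = S 0 n / real n powr \<gamma>"
    using eventually_ge_at_top[of 1]
  proof eventually_elim
    case (elim n)
    have "S 0 n = (\<Sum>i=1..n. l ^ (2 * k) * real n powr (- \<rho> * real k) * real i powr a)"
      unfolding S_def
    proof (rule sum.cong)
      fix i assume "i \<in> {1..n}"
      then have "eps n i ^ (2 * k) = l ^ (2 * k) * (real n powr (- \<rho> / 2)) ^ (2 * k) * (real i powr \<kappa>) ^ (2 * k)"
        unfolding eps_def using elim by (simp add: sigma_eq power_mult_distrib)
      also have "(real n powr (- \<rho> / 2)) ^ (2 * k) = real n powr (- \<rho> * real k)"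
        using elim by (simp add: powr_powr flip: powr_realpow)
      also have "(real i powr \<kappa>) ^ (2 * k) = real i powr a"
        using \<open>i \<in> _\<close> by (simp add: powr_powr a_def mult_ac flip: powr_realpow)
      finally show "eps n i ^ (2 * k) = l ^ (2 * k) * real n powr (- \<rho> * real k) * real i powr a" .
    qed auto
    also have "\<dots> = l ^ (2 * k) * real n powr (- \<rho> * real k) * (\<Sum>i=1..n. real i powr a)"
      by (simp add: sum_distrib_left)
    also have "real n powr (- \<rho> * real k) = real n powr \<gamma> / real n powr (a + 1)"
      by (simp add: \<gamma>_def a_def flip: powr_diff)
    finally show ?case using elim by simp
  qed
  ultimately have "(\<lambda>n. S 0 n / real n powr \<gamma>) \<longlonglongrightarrow> l ^ (2 * k) * (1 / (a + 1))"
    by (rule Lim_transform_eventually)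
  then show ?thesis by (simp add: a_def add.commute)
qed

section \<open>Sums of independent log-ratios\<close>

definition R :: "nat \<Rightarrow> nat \<Rightarrow> (nat \<Rightarrow> real \<times> real) \<Rightarrow> real" where
  "R m n \<omega> = (\<Sum>i\<in>{m<..n}. r (eps n i) (\<omega> i))"

lemma R_measurable [measurable]: "R m n \<in> borel_measurable \<Omega>"
  unfolding R_def by measurable

lemma expectation_exp_half_R:
  shows "integrable \<Omega> (\<lambda>\<omega>. exp (R 0 n \<omega> / 2))"
    and "\<Omega>.expectation (\<lambda>\<omega>. exp (R 0 n \<omega> / 2)) = (\<Prod>i\<in>{0<..n}. expectation (\<lambda>u. exp (r (eps n i) u / 2)))"
proof -
  have eq: "exp (R 0 n \<omega> / 2) = (\<Prod>i\<in>{0<..n}. exp (r (eps n i) (\<omega> i) / 2))" for \<omega>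
    unfolding R_def by (simp add: sum_divide_distrib exp_sum)
  have ind: "\<Omega>.indep_vars (\<lambda>_. borel) (\<lambda>i \<omega>. exp (r (eps n i) (\<omega> i) / 2)) {0<..n}"
    by (rule indep_coord_fun[where h = "\<lambda>i u. exp (r (eps n i) u / 2)"]) measurable
  have int: "integrable \<Omega> (\<lambda>\<omega>. exp (r (eps n i) (\<omega> i) / 2))" if "i \<in> {0<..n}" for i
    using that eps_pos[of i n] by (intro integrable_coord exp_half_r) auto
  show "integrable \<Omega> (\<lambda>\<omega>. exp (R 0 n \<omega> / 2))"
    unfolding eq by (rule \<Omega>.indep_vars_integrable[OF _ ind int]) auto
  show "\<Omega>.expectation (\<lambda>\<omega>. exp (R 0 n \<omega> / 2)) = (\<Prod>i\<in>{0<..n}. expectation (\<lambda>u. exp (r (eps n i) u / 2)))"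
    unfolding eq by (subst \<Omega>.indep_vars_lebesgue_integral[OF _ ind int])
      (simp_all add: expectation_coord[where h = "\<lambda>u. exp (r (eps n i) u / 2)" for i])
qed

lemma expectation_exp_R:
  shows "integrable \<Omega> (\<lambda>\<omega>. exp (R 0 n \<omega>))" and "\<Omega>.expectation (\<lambda>\<omega>. exp (R 0 n \<omega>)) = 1"
proof -
  have eq: "exp (R 0 n \<omega>) = (\<Prod>i\<in>{0<..n}. exp (r (eps n i) (\<omega> i)))" for \<omega>
    unfolding R_def by (simp add: exp_sum)
  have ind: "\<Omega>.indep_vars (\<lambda>_. borel) (\<lambda>i \<omega>. exp (r (eps n i) (\<omega> i))) {0<..n}"
    by (rule indep_coord_fun[where h = "\<lambda>i u. exp (r (eps n i) u)"]) measurable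
  have int: "integrable \<Omega> (\<lambda>\<omega>. exp (r (eps n i) (\<omega> i)))" if "i \<in> {0<..n}" for i
    using that eps_pos[of i n] by (intro integrable_coord integrable_exp_r) auto
  show "integrable \<Omega> (\<lambda>\<omega>. exp (R 0 n \<omega>))"
    unfolding eq by (rule \<Omega>.indep_vars_integrable[OF _ ind int]) auto
  have "\<Omega>.expectation (\<lambda>\<omega>. exp (R 0 n \<omega>)) = (\<Prod>i\<in>{0<..n}. expectation (\<lambda>u. exp (r (eps n i) u)))"
    unfolding eq by (subst \<Omega>.indep_vars_lebesgue_integral[OF _ ind int])
      (simp_all add: expectation_coord[where h = "\<lambda>u. exp (r (eps n i) u)" for i])
  also have "\<dots> = 1"
    using eps_pos by (intro prod.neutral) (auto intro!: integrable_exp_r)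
  finally show "\<Omega>.expectation (\<lambda>\<omega>. exp (R 0 n \<omega>)) = 1" .
qed

text \<open>
  The squared Hellinger distance between the two orderings of the proposal pair is additive over
  coordinates up to its own size, hence of order \<open>S 0 n\<close>.
\<close>

lemma one_minus_min_exp_R_tendsto:
  assumes "\<gamma> < 0"
  shows "(\<lambda>n. \<Omega>.expectation (\<lambda>\<omega>. 1 - min 1 (exp (R 0 n \<omega>)))) \<longlonglongrightarrow> 0"
proof -
  define H where "H n = \<Omega>.expectation (\<lambda>\<omega>. (1 - exp (R 0 n \<omega> / 2))\<^sup>2)" for n
  have sq: "(1 - exp (x / 2))\<^sup>2 = 1 - 2 * exp (x / 2) + exp x" for x :: real
    by (simp add: power2_eq_square algebra_simps flip: exp_add)
  have int: "integrable \<Omega> (\<lambda>\<omega>. (1 - exp (R 0 n \<omega> / 2))\<^sup>2)" for n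
    unfolding sq using expectation_exp_half_R(1)[of n] expectation_exp_R(1)[of n]
    by (intro Bochner_Integration.integrable_add Bochner_Integration.integrable_diff) auto
  have H_eq: "H n = 2 * (1 - (\<Prod>i\<in>{0<..n}. expectation (\<lambda>u. exp (r (eps n i) u / 2))))" for n
  proof -
    have "H n = 1 - 2 * \<Omega>.expectation (\<lambda>\<omega>. exp (R 0 n \<omega> / 2)) + \<Omega>.expectation (\<lambda>\<omega>. exp (R 0 n \<omega>))"
      unfolding H_def sq using expectation_exp_half_R(1)[of n] expectation_exp_R(1)[of n]
      by simp
    then show ?thesis by (simp add: expectation_exp_half_R(2) expectation_exp_R(2))
  qed
  have "\<forall>\<^sub>F n in sequentially. H n \<le> 2 * (K + 3 * B) * S 0 n"
    using eventually_eps_diag_less[of 1, simplified]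
  proof eventually_elim
    case (elim n)
    \<comment> \<open>By independence the affinity of the whole vector is the product of the
      affinities of the coordinates.\<close>
    have "1 - (\<Prod>i\<in>{0<..n}. expectation (\<lambda>u. exp (r (eps n i) u / 2)))
        \<le> (\<Sum>i\<in>{0<..n}. 1 - expectation (\<lambda>u. exp (r (eps n i) u / 2)))"
      using eps_pos by (intro one_minus_prod_le_sum exp_half_r_le_1) auto
    also have "\<dots> \<le> (\<Sum>i\<in>{0<..n}. (K + 3 * B) * eps n i ^ (2 * k))"
    proof (intro sum_mono exp_half_r_lower)
      fix i assume i: "i \<in> {0<..n}"
      then show "0 < eps n i" using eps_pos by simp
      have "eps n i \<le> eps n n" using i eps_le by simp
      then show "eps n i \<le> 1" using elim by simp
    qed
    also have "\<dots> = (K + 3 * B) * S 0 n" unfolding S_def by (rule sum_distrib_left[symmetric])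
    finally have "2 * (1 - (\<Prod>i\<in>{0<..n}. expectation (\<lambda>u. exp (r (eps n i) u / 2))))
        \<le> 2 * ((K + 3 * B) * S 0 n)" by (rule mult_left_mono) simp
    then show ?case unfolding H_eq by (simp only: mult.assoc)
  qed
  moreover have "(\<lambda>n. 2 * (K + 3 * B) * S 0 n) \<longlonglongrightarrow> 0"
  proof -
    have "(\<lambda>n. (S 0 n / real n powr \<gamma>) * real n powr \<gamma>) \<longlonglongrightarrow> l ^ (2 * k) / (1 + 2 * \<kappa> * real k) * 0"
      using assms by (intro tendsto_intros S_asymp tendsto_neg_powr filterlim_real_sequentially)
    moreover have "\<forall>\<^sub>F n in sequentially. (S 0 n / real n powr \<gamma>) * real n powr \<gamma> = S 0 n"
      using eventually_gt_at_top[of 0] by eventually_elim simp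
    ultimately have "S 0 \<longlonglongrightarrow> l ^ (2 * k) / (1 + 2 * \<kappa> * real k) * 0"
      by (rule Lim_transform_eventually)
    then have "S 0 \<longlonglongrightarrow> 0" by simp
    then show ?thesis by (rule tendsto_mult_right_zero)
  qed
  moreover have "H n \<ge> 0" for n unfolding H_def by simp
  ultimately have H_lim: "H \<longlonglongrightarrow> 0"
    by (intro tendsto_sandwich[of "\<lambda>_. 0" H _ "\<lambda>n. 2 * (K + 3 * B) * S 0 n"]) auto
  show ?thesis
  proof (rule LIMSEQ_I)
    fix e :: real assume e: "e > 0"
    have bound: "\<Omega>.expectation (\<lambda>\<omega>. 1 - min 1 (exp (R 0 n \<omega>))) \<le> e / 2 + 2 / e * H n" for n
    proof -
      \<comment> \<open>With \<open>y = 1 - exp (x / 2)\<close> one has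
        \<open>1 - exp x = y * (2 - y) \<le> 2 * y\<close>, and the weighted arithmetic-geometric
        mean inequality splits \<open>2 * y\<close>. The free parameter \<open>e\<close> takes the
        place of the Cauchy-Schwarz inequality.\<close>
      have "1 - min 1 (exp x) \<le> e / 2 + 2 / e * (1 - exp (x / 2))\<^sup>2" for x :: real
      proof (cases "x \<ge> 0")
        case True
        then show ?thesis using e by simp
      next
        case False
        define y where "y = 1 - exp (x / 2)"
        have "exp x = (exp (x / 2))\<^sup>2" by (simp add: power2_eq_square flip: exp_add)
        then have "1 - exp x = y * (2 - y)" by (simp add: y_def power2_eq_square algebra_simps)
        also have "\<dots> \<le> 2 * y" using zero_le_power2[of y] by (simp add: power2_eq_square algebra_simps)
        also have "2 * y \<le> e / 2 + 2 / e * y\<^sup>2"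
        proof -
          have "0 \<le> (e - 2 * y)\<^sup>2" by simp
          then show ?thesis using e by (simp add: field_simps power2_eq_square)
        qed
        finally show ?thesis using False by (simp add: y_def min_def)
      qed
      note pointwise = this
      have "integrable \<Omega> (\<lambda>\<omega>. 1 - min 1 (exp (R 0 n \<omega>)))"
        by (rule \<Omega>.integrable_const_bound[where B = 1]) auto
      then have "\<Omega>.expectation (\<lambda>\<omega>. 1 - min 1 (exp (R 0 n \<omega>)))
          \<le> \<Omega>.expectation (\<lambda>\<omega>. e / 2 + 2 / e * (1 - exp (R 0 n \<omega> / 2))\<^sup>2)"
        using int[of n] pointwise
        by (intro integral_mono Bochner_Integration.integrable_add integrable_mult_right) auto
      also have "\<dots> = \<Omega>.expectation (\<lambda>\<omega>. e / 2) + \<Omega>.expectation (\<lambda>\<omega>. 2 / e * (1 - exp (R 0 n \<omega> / 2))\<^sup>2)"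
        using int[of n] by (intro Bochner_Integration.integral_add integrable_mult_right) auto
      also have "\<dots> = e / 2 + 2 / e * H n"
        unfolding H_def by simp
      finally show ?thesis .
    qed
    \<comment> \<open>The threshold makes the second term \<open>2 / e * H n\<close> smaller than
      \<open>e / 2\<close>.\<close>
    have "\<forall>\<^sub>F n in sequentially. H n < e * e / 4"
      using order_tendstoD(2)[OF H_lim, of "e * e / 4"] e by simp
    then obtain N where N: "\<And>n. n \<ge> N \<Longrightarrow> H n < e * e / 4"
      by (auto simp: eventually_sequentially)
    show "\<exists>no. \<forall>n\<ge>no. norm (\<Omega>.expectation (\<lambda>\<omega>. 1 - min 1 (exp (R 0 n \<omega>))) - 0) < e"
    proof (intro exI[of _ N] allI impI)
      fix n assume "n \<ge> N"
      then have "2 / e * H n < 2 / e * (e * e / 4)"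
        using N e by (intro mult_strict_left_mono) auto
      then have "\<Omega>.expectation (\<lambda>\<omega>. 1 - min 1 (exp (R 0 n \<omega>))) < e"
        using bound[of n] e by simp
      moreover have "0 \<le> \<Omega>.expectation (\<lambda>\<omega>. 1 - min 1 (exp (R 0 n \<omega>)))"
        by (intro integral_nonneg_AE) simp
      ultimately show "norm (\<Omega>.expectation (\<lambda>\<omega>. 1 - min 1 (exp (R 0 n \<omega>))) - 0) < e" by simp
    qed
  qed
qed

text \<open>Each affinity is at most \<open>1 - K / 64 * \<epsilon>\<^sub>i ^ (2 * k)\<close>, hence
  at most the corresponding exponential; the product then involves \<open>S 0 n\<close>, which grows
  like \<open>n powr \<gamma>\<close>. Half of the limiting ratio \<open>L\<close> serves as its
  lower bound.\<close>

lemma expectation_exp_half_R_decay: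
  obtains c where "c > 0" "\<forall>\<^sub>F n in sequentially.
    \<Omega>.expectation (\<lambda>\<omega>. exp (R 0 n \<omega> / 2)) \<le> exp (- c * real n powr \<gamma>)"
proof
  define L where "L = l ^ (2 * k) / (1 + 2 * \<kappa> * real k)"
  have L: "L > 0" unfolding L_def using l_pos kappa
    by (intro divide_pos_pos add_pos_nonneg mult_nonneg_nonneg) auto
  define c where "c = K / 64 * (L / 2)"
  show "c > 0" using L K_pos by (simp add: c_def)
  have "\<forall>\<^sub>F n in sequentially. L / 2 < S 0 n / real n powr \<gamma>"
    by (rule order_tendstoD(1)[OF S_asymp]) (use L in \<open>simp flip: L_def\<close>)
  \<comment> \<open>Below this threshold \<open>\<epsilon> * (22 * B) \<le> K\<close>, as required
    for the upper bound on each affinity; the added 1 guards against a zero denominator.\<close>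
  moreover have "\<forall>\<^sub>F n in sequentially. eps n n < min 1 (K / (22 * B + 1))"
    using K_pos B_nonneg by (intro eventually_eps_diag_less) auto
  ultimately show "\<forall>\<^sub>F n in sequentially.
      \<Omega>.expectation (\<lambda>\<omega>. exp (R 0 n \<omega> / 2)) \<le> exp (- c * real n powr \<gamma>)"
    using eventually_gt_at_top[of 0]
  proof eventually_elim
    case (elim n)
    have "\<Omega>.expectation (\<lambda>\<omega>. exp (R 0 n \<omega> / 2)) \<le> (\<Prod>i\<in>{0<..n}. exp (- (K / 64 * eps n i ^ (2 * k))))"
      unfolding expectation_exp_half_R
    proof (intro prod_mono conjI)
      fix i assume i: "i \<in> {0<..n}"
      have *: "0 < eps n i" "eps n i \<le> eps n n" using i eps_pos eps_le by auto
      have "eps n i * (22 * B) \<le> K / (22 * B + 1) * (22 * B)"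
        using * elim B_nonneg by (intro mult_right_mono) auto
      also have "\<dots> \<le> K" using K_pos B_nonneg by (simp add: field_simps)
      finally have "expectation (\<lambda>u. exp (r (eps n i) u / 2)) \<le> 1 - K / 64 * eps n i ^ (2 * k)"
        using * elim by (intro exp_half_r_upper) auto
      also have "\<dots> \<le> exp (- (K / 64 * eps n i ^ (2 * k)))"
        using exp_ge_add_one_self[of "- (K / 64 * eps n i ^ (2 * k))"] by simp
      finally show "expectation (\<lambda>u. exp (r (eps n i) u / 2)) \<le> exp (- (K / 64 * eps n i ^ (2 * k)))" .
    qed auto
    also have "\<dots> = exp (- (K / 64 * S 0 n))"
      by (simp add: S_def sum_distrib_left sum_negf flip: exp_sum)
    also have "\<dots> \<le> exp (- c * real n powr \<gamma>)"
    proof -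
      have "L / 2 * real n powr \<gamma> \<le> S 0 n" using elim by (simp add: field_simps)
      then have "K / 64 * (L / 2 * real n powr \<gamma>) \<le> K / 64 * S 0 n"
        using K_pos by (intro mult_left_mono) auto
      then show ?thesis by (simp add: c_def mult_ac)
    qed
    finally show ?case .
  qed
qed

end

section \<open>Central limit theorem for the log-ratio\<close>

context balanced_step
begin

text \<open>Mean \<open>- \<epsilon> ^ (2 * k) * K / 2\<close> and variance
  \<open>\<epsilon> ^ (2 * k) * K\<close> make one summand look like a Gaussian whose mean is minus
  half its variance. The error exponent \<open>2 * k + 1\<close> is one better than the variance, so
  that the errors still vanish after summation over all coordinates.\<close>

lemma char_r_approx:
  obtains G where "G \<ge> 0" "\<And>\<epsilon>. 0 < \<epsilon> \<Longrightarrow> \<epsilon> \<le> 1 \<Longrightarrow>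
    cmod (char (distr P borel (r \<epsilon>)) t - exp (of_real (\<epsilon> ^ (2 * k) * K) * (- \<i> * of_real t / 2 - of_real (t\<^sup>2 / 2))))
      \<le> G * \<epsilon> ^ (2 * k + 1)"
proof
  define b :: complex where "b = - \<i> * of_real t / 2 - of_real (t\<^sup>2 / 2)"
  \<comment> \<open>The summands account for the third moment, the mean, the second moment, and the
    second-order error of the exponential.\<close>
  define G where "G = \<bar>t\<bar> ^ 3 * (8 * B) + \<bar>t\<bar> * (14 * B) + t\<^sup>2 * (2 * B) + exp (K * cmod b) * (K * cmod b)\<^sup>2"
  show "G \<ge> 0" unfolding G_def using B_nonneg K_pos by (intro add_nonneg_nonneg mult_nonneg_nonneg) auto
  fix \<epsilon> :: real assume \<epsilon>: "0 < \<epsilon>" "\<epsilon> \<le> 1"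
  define D where "D = distr P borel (r \<epsilon>)"
  define E1 where "E1 = expectation (r \<epsilon>)"
  define E2 where "E2 = expectation (\<lambda>u. (r \<epsilon> u)\<^sup>2)"
  define e where "e = \<epsilon> ^ (2 * k + 1)"
  define a :: complex where "a = of_real (\<epsilon> ^ (2 * k) * K) * b"
  interpret D: real_distribution D
    unfolding D_def by (rule real_distribution_distr) measurable
  have mom: "integrable D (\<lambda>x. x ^ j)" for j
    unfolding D_def using integrable_r_power[OF \<epsilon>, of j] by (simp add: integrable_distr_eq)
  have mom_abs: "integrable D (\<lambda>x. \<bar>x\<bar> ^ j)" for j
    using integrable_abs[OF mom[of j]] by (simp add: power_abs)
  have e_pos: "e \<ge> 0" using \<epsilon> by (simp add: e_def)
  have E1: "\<bar>E1 + E2 / 2\<bar> \<le> 12 * B * e" and E2: "\<bar>E2 - \<epsilon> ^ (2 * k) * K\<bar> \<le> 3 * B * e"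
    using r_mean_variance[OF \<epsilon>] r_second_moment[OF \<epsilon>] by (auto simp: E1_def E2_def e_def)
  have exp1: "D.expectation (\<lambda>x. x) = E1" and exp2: "D.expectation (\<lambda>x. x\<^sup>2) = E2"
    and exp3: "D.expectation (\<lambda>x. \<bar>x\<bar> ^ 3) \<le> 8 * B * e"
    using r_third_moment[OF \<epsilon>] by (auto simp: D_def E1_def E2_def e_def integral_distr)
  have 1: "cmod (char D t - (1 + \<i> * t * E1 - t\<^sup>2 / 2 * E2)) \<le> \<bar>t\<bar> ^ 3 * (8 * B) * e"
  proof -
    have "(\<Sum>j\<le>2. (\<i> * t) ^ j / fact j * D.expectation (\<lambda>x. x ^ j)) = 1 + \<i> * t * E1 - t\<^sup>2 / 2 * E2"
      using exp1 exp2 D.prob_space by (simp add: numeral_2_eq_2 power_mult_distrib)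
    then have "cmod (char D t - (1 + \<i> * t * E1 - t\<^sup>2 / 2 * E2))
        \<le> \<bar>t\<bar>\<^sup>2 / fact (Suc 2) * D.expectation (\<lambda>x. min (2 * \<bar>x\<bar>\<^sup>2 * Suc 2) (\<bar>t\<bar> * \<bar>x\<bar> ^ Suc 2))"
      using D.char_approx2[of 2 t] mom by simp
    also have "\<dots> \<le> \<bar>t\<bar>\<^sup>2 / fact (Suc 2) * D.expectation (\<lambda>x. \<bar>t\<bar> * \<bar>x\<bar> ^ 3)"
    proof (intro mult_left_mono integral_mono)
      show "integrable D (\<lambda>x. \<bar>t\<bar> * \<bar>x\<bar> ^ 3)" by (intro integrable_mult_right mom_abs)
      show "integrable D (\<lambda>x. min (2 * \<bar>x\<bar>\<^sup>2 * Suc 2) (\<bar>t\<bar> * \<bar>x\<bar> ^ Suc 2))"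
        by (intro integrable_min integrable_mult_right integrable_mult_left mom_abs)
    qed (auto simp: numeral_3_eq_3)
    also have "\<dots> = \<bar>t\<bar> ^ 3 / 6 * D.expectation (\<lambda>x. \<bar>x\<bar> ^ 3)"
      by (simp add: fact_numeral power2_eq_square power3_eq_cube)
    also have "\<dots> \<le> \<bar>t\<bar> ^ 3 * D.expectation (\<lambda>x. \<bar>x\<bar> ^ 3)"
      by (intro mult_right_mono) auto
    also have "\<dots> \<le> \<bar>t\<bar> ^ 3 * (8 * B * e)"
      by (intro mult_left_mono exp3) auto
    finally show ?thesis by (simp add: mult_ac)
  qed
  have 2: "cmod ((1 + \<i> * t * E1 - t\<^sup>2 / 2 * E2) - (1 + a)) \<le> \<bar>t\<bar> * (14 * B) * e + t\<^sup>2 * (2 * B) * e"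
  proof -
    have "(1 + \<i> * t * E1 - t\<^sup>2 / 2 * E2) - (1 + a)
        = \<i> * of_real (t * (E1 + \<epsilon> ^ (2 * k) * K / 2)) - of_real (t\<^sup>2 / 2 * (E2 - \<epsilon> ^ (2 * k) * K))"
      unfolding a_def b_def by (simp add: algebra_simps)
    also have "cmod \<dots> \<le> \<bar>t\<bar> * \<bar>E1 + \<epsilon> ^ (2 * k) * K / 2\<bar> + t\<^sup>2 / 2 * \<bar>E2 - \<epsilon> ^ (2 * k) * K\<bar>"
      by (rule norm_triangle_le_diff) (simp only: norm_mult norm_of_real norm_ii abs_mult, simp)
    also have "\<dots> \<le> \<bar>t\<bar> * (14 * B * e) + t\<^sup>2 / 2 * (3 * B * e)"
    proof (intro add_mono mult_left_mono)
      have "B * e \<ge> 0" using e_pos B_nonneg by simp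
      \<comment> \<open>The errors \<open>12 * B\<close> of the mean and \<open>3 * B / 2\<close> of
        half the variance are rounded up to \<open>14 * B\<close>.\<close>
      then show "\<bar>E1 + \<epsilon> ^ (2 * k) * K / 2\<bar> \<le> 14 * B * e" using E1 E2 by linarith
    qed (use E2 in auto)
    also have "\<dots> \<le> \<bar>t\<bar> * (14 * B * e) + t\<^sup>2 * (2 * B * e)"
      using e_pos B_nonneg by (simp add: mult_left_mono mult_nonneg_nonneg)
    finally show ?thesis by (simp add: mult_ac)
  qed
  have 3: "cmod (exp a - (1 + a)) \<le> exp (K * cmod b) * (K * cmod b)\<^sup>2 * e"
  proof -
    have pow: "\<epsilon> ^ (2 * k) \<le> 1" using \<epsilon> by (simp add: power_le_one)
    have a: "cmod a = \<epsilon> ^ (2 * k) * (K * cmod b)"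
      unfolding a_def using \<epsilon> K_pos by (simp add: norm_mult norm_power)
    have "\<bar>Re a\<bar> \<le> cmod a" by (rule abs_Re_le_cmod)
    also have "\<dots> \<le> 1 * (K * cmod b)"
      unfolding a using K_pos pow by (intro mult_right_mono) auto
    finally have Re_a: "\<bar>Re a\<bar> \<le> K * cmod b" by simp
    have "cmod (exp a - (\<Sum>j\<le>1. a ^ j / fact j)) \<le> exp \<bar>Re a\<bar> * (cmod a) ^ Suc 1 / fact 1"
      by (rule Taylor_exp)
    then have "cmod (exp a - (1 + a)) \<le> exp \<bar>Re a\<bar> * (cmod a)\<^sup>2" by (simp add: power2_eq_square)
    also have "\<dots> \<le> exp (K * cmod b) * (e * (K * cmod b)\<^sup>2)"
    proof (intro mult_mono)
      have "(cmod a)\<^sup>2 = \<epsilon> ^ (2 * k * 2) * (K * cmod b)\<^sup>2"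
        by (simp only: a power_mult_distrib power_mult[symmetric])
      also have "\<dots> \<le> e * (K * cmod b)\<^sup>2"
        \<comment> \<open>Again \<open>4 * k \<ge> 2 * k + 1\<close> because
          \<open>k \<ge> 1\<close>.\<close>
        unfolding e_def using \<epsilon> k_pos by (intro mult_right_mono power_decreasing) auto
      finally show "(cmod a)\<^sup>2 \<le> e * (K * cmod b)\<^sup>2" .
    qed (use Re_a in auto)
    finally show ?thesis by (simp add: mult_ac)
  qed
  have "char D t - exp a = (char D t - (1 + \<i> * t * E1 - t\<^sup>2 / 2 * E2))
      + ((1 + \<i> * t * E1 - t\<^sup>2 / 2 * E2) - (1 + a)) + ((1 + a) - exp a)" by simp
  also have "cmod \<dots> \<le> \<bar>t\<bar> ^ 3 * (8 * B) * e + (\<bar>t\<bar> * (14 * B) * e + t\<^sup>2 * (2 * B) * e)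
      + exp (K * cmod b) * (K * cmod b)\<^sup>2 * e"
    using 1 2 3 by (intro norm_triangle_mono) (auto simp: norm_minus_commute)
  also have "\<dots> = G * e" by (simp add: G_def algebra_simps)
  finally show "cmod (char (distr P borel (r \<epsilon>)) t
      - exp (of_real (\<epsilon> ^ (2 * k) * K) * (- \<i> * of_real t / 2 - of_real (t\<^sup>2 / 2)))) \<le> G * \<epsilon> ^ (2 * k + 1)"
    by (simp add: D_def a_def b_def e_def)
qed

end

context balanced_array
begin

text \<open>Levy's continuity theorem with limit law \<open>N(- v / 2, v)\<close>, tested against
  the bounded continuous function \<open>min 1 (exp x)\<close>. The first \<open>m n\<close>
  coordinates may be left out because they carry a vanishing share of the variance.\<close>

lemma expectation_min_exp_R_tendsto:
  fixes m :: "nat \<Rightarrow> nat"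
  assumes \<gamma>: "\<gamma> = 0" and m_le: "\<And>n. m n \<le> n"
    and m: "(\<lambda>n. real (m n) * eps n n ^ (2 * k)) \<longlonglongrightarrow> 0"
  shows "(\<lambda>n. \<Omega>.expectation (\<lambda>\<omega>. min 1 (exp (R (m n) n \<omega>))))
    \<longlonglongrightarrow> 2 * std_normal_cdf (- (l ^ k / 2) * sqrt (K / (1 + 2 * \<kappa> * real k)))"
proof -
  define L where "L = l ^ (2 * k) / (1 + 2 * \<kappa> * real k)"
  define v where "v = L * K"
  have den: "1 + 2 * \<kappa> * real k > 0" using kappa by (intro add_pos_nonneg) auto
  have L: "L \<ge> 0" unfolding L_def using l_pos den by auto
  have v: "v \<ge> 0" unfolding v_def using L K_pos by simp
  have S_lim: "(\<lambda>n. S (m n) n) \<longlonglongrightarrow> L"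
  proof -
    have "(\<lambda>n. S 0 n) \<longlonglongrightarrow> L"
    proof (rule Lim_transform_eventually[OF S_asymp[folded L_def]])
      show "\<forall>\<^sub>F n in sequentially. S 0 n / real n powr \<gamma> = S 0 n"
        using eventually_gt_at_top[of 0] by eventually_elim (simp add: \<gamma>)
    qed
    moreover have "(\<lambda>n. S 0 n - S (m n) n) \<longlonglongrightarrow> 0"
    proof (rule tendsto_sandwich[OF _ _ tendsto_const m])
      have eq: "S 0 n - S (m n) n = (\<Sum>i\<in>{0<..m n}. eps n i ^ (2 * k))" for n
      proof -
        have "{0<..n} = {0<..m n} \<union> {m n<..n}" using m_le[of n] by auto
        then have "S 0 n = (\<Sum>i\<in>{0<..m n}. eps n i ^ (2 * k)) + S (m n) n"
          unfolding S_def by (simp add: sum.union_disjoint ivl_disj_int)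
        then show ?thesis by simp
      qed
      show "\<forall>\<^sub>F n in sequentially. 0 \<le> S 0 n - S (m n) n"
        unfolding eq by (intro always_eventually allI sum_nonneg) simp
      \<comment> \<open>Each of the \<open>m n\<close> omitted summands is at most the one with the
        largest step.\<close>
      have "S 0 n - S (m n) n \<le> real (m n) * eps n n ^ (2 * k)" for n
      proof -
        have "(\<Sum>i\<in>{0<..m n}. eps n i ^ (2 * k)) \<le> (\<Sum>i\<in>{0<..m n}. eps n n ^ (2 * k))"
        proof (intro sum_mono power_mono)
          fix i assume "i \<in> {0<..m n}"
          then have "1 \<le> i" "i \<le> n" using m_le[of n] by auto
          then show "eps n i \<le> eps n n" "0 \<le> eps n i" using eps_le eps_pos by (auto intro: less_imp_le)
        qed
        then show ?thesis unfolding eq by simp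
      qed
      then show "\<forall>\<^sub>F n in sequentially. S 0 n - S (m n) n \<le> real (m n) * eps n n ^ (2 * k)"
        by simp
    qed
    ultimately have "(\<lambda>n. S 0 n - (S 0 n - S (m n) n)) \<longlonglongrightarrow> L - 0" by (rule tendsto_diff)
    then show ?thesis by simp
  qed
  define \<mu> where "\<mu> n = distr \<Omega> borel (R (m n) n)" for n
  \<comment> \<open>Writing the limit as an affine image of the standard normal law gives its
    characteristic function and brings the final integral into the form of
    \<open>expectation_min_1_exp_std_normal\<close> with \<open>s = sqrt v\<close>; it also covers
    \<open>v = 0\<close>.\<close>
  define M where "M = distr std_normal_distribution borel (\<lambda>z. sqrt v * z - v / 2)"
  interpret N: prob_space std_normal_distribution
    by (rule prob_space_normal_density) simp
  have \<mu>: "real_distribution (\<mu> n)" for n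
    unfolding \<mu>_def by (rule \<Omega>.real_distribution_distr) measurable
  have M: "real_distribution M"
    unfolding M_def by (rule N.real_distribution_distr) measurable
  have charM: "char M t = exp (of_real v * (- \<i> * of_real t / 2 - of_real (t\<^sup>2 / 2)))" for t
  proof -
    have "char M t = (CLINT z|std_normal_distribution. iexp (t * (sqrt v * z - v / 2)))"
      unfolding char_def M_def by (subst integral_distr) auto
    also have "\<dots> = (CLINT z|std_normal_distribution. exp (- \<i> * of_real (t * v / 2)) * iexp (t * sqrt v * z))"
      by (intro Bochner_Integration.integral_cong) (auto simp: algebra_simps simp flip: exp_add)
    also have "\<dots> = exp (- \<i> * of_real (t * v / 2)) * char std_normal_distribution (t * sqrt v)"
      unfolding char_def by simp
    also have "char std_normal_distribution (t * sqrt v) = exp (of_real (- (v * t\<^sup>2) / 2))"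
      by (simp only: char_std_normal_distribution exp_of_real)
        (use v in \<open>simp add: power_mult_distrib mult.commute\<close>)
    also have "exp (- \<i> * of_real (t * v / 2)) * exp (of_real (- (v * t\<^sup>2) / 2))
        = exp (- \<i> * of_real (t * v / 2) + of_real (- (v * t\<^sup>2) / 2))"
      by (rule exp_add[symmetric])
    also have "- \<i> * of_real (t * v / 2) + of_real (- (v * t\<^sup>2) / 2) = of_real v * (- \<i> * of_real t / 2 - of_real (t\<^sup>2 / 2))"
      by (simp add: algebra_simps)
    finally show ?thesis .
  qed
  have "(\<lambda>n. char (\<mu> n) t) \<longlonglongrightarrow> char M t" for t
  proof -
    define b :: complex where "b = - \<i> * of_real t / 2 - of_real (t\<^sup>2 / 2)"
    obtain G where G: "G \<ge> 0" "\<And>\<epsilon>. 0 < \<epsilon> \<Longrightarrow> \<epsilon> \<le> 1 \<Longrightarrow>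
        cmod (char (distr P borel (r \<epsilon>)) t - exp (of_real (\<epsilon> ^ (2 * k) * K) * b)) \<le> G * \<epsilon> ^ (2 * k + 1)"
      using char_r_approx[of t] unfolding b_def by metis
    have char\<mu>: "char (\<mu> n) t = (\<Prod>i\<in>{m n<..n}. char (distr P borel (r (eps n i))) t)" for n
    proof -
      have "char (\<mu> n) t = (\<Prod>i\<in>{m n<..n}. char (distr \<Omega> borel (\<lambda>\<omega>. r (eps n i) (\<omega> i))) t)"
        unfolding \<mu>_def R_def
        by (rule \<Omega>.char_distr_sum, rule indep_coord_fun[where h = "\<lambda>i. r (eps n i)"]) measurable
      also have "\<dots> = (\<Prod>i\<in>{m n<..n}. char (distr P borel (r (eps n i))) t)"
      proof (rule prod.cong)
        fix i
        have "distr \<Omega> borel (\<lambda>\<omega>. r (eps n i) (\<omega> i)) = distr (distr \<Omega> P (\<lambda>\<omega>. \<omega> i)) borel (r (eps n i))"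
          by (subst distr_distr) (auto simp: comp_def coord_P measurable_cong_sets[OF sets_P refl])
        then show "char (distr \<Omega> borel (\<lambda>\<omega>. r (eps n i) (\<omega> i))) t = char (distr P borel (r (eps n i))) t"
          by (simp add: distr_coord)
      qed simp
      finally show ?thesis .
    qed
    have prod_exp: "(\<Prod>i\<in>{m n<..n}. exp (of_real (eps n i ^ (2 * k) * K) * b)) = exp (of_real (S (m n) n * K) * b)" for n
      unfolding S_def by (simp add: exp_sum sum_distrib_right)
    have "(\<lambda>n. char (\<mu> n) t - exp (of_real (S (m n) n * K) * b)) \<longlonglongrightarrow> 0"
    proof (rule Lim_null_comparison)
      show "\<forall>\<^sub>F n in sequentially. cmod (char (\<mu> n) t - exp (of_real (S (m n) n * K) * b)) \<le> G * (eps n n * S (m n) n)"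
        using eventually_eps_diag_less[of 1, simplified]
      proof eventually_elim
        case (elim n)
        have "cmod (char (\<mu> n) t - exp (of_real (S (m n) n * K) * b))
            \<le> (\<Sum>i\<in>{m n<..n}. cmod (char (distr P borel (r (eps n i))) t - exp (of_real (eps n i ^ (2 * k) * K) * b)))"
          unfolding char\<mu> prod_exp[symmetric]
        \<comment> \<open>Factors of modulus at most 1 turn the difference of products into the sum
          of differences. For the Gaussian factors this holds because \<open>b\<close> has real part
          \<open>- t\<^sup>2 / 2\<close>.\<close>
        proof (rule norm_prod_diff)
          fix i assume i: "i \<in> {m n<..n}"
          interpret D: real_distribution "distr P borel (r (eps n i))"
            by (rule real_distribution_distr) measurable
          show "cmod (char (distr P borel (r (eps n i))) t) \<le> 1" by (rule D.cmod_char_le_1)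
          have "0 \<le> eps n i ^ (2 * k) * K * (t * t / 2)" using K_pos by (intro mult_nonneg_nonneg) auto
          then show "cmod (exp (of_real (eps n i ^ (2 * k) * K) * b)) \<le> 1"
            by (simp add: b_def power2_eq_square)
        qed
        also have "\<dots> \<le> (\<Sum>i\<in>{m n<..n}. G * (eps n n * eps n i ^ (2 * k)))"
        proof (rule sum_mono)
          fix i assume i: "i \<in> {m n<..n}"
          then have *: "0 < eps n i" "eps n i \<le> eps n n" using eps_pos[of i n] eps_le[of i n] by auto
          then have "cmod (char (distr P borel (r (eps n i))) t - exp (of_real (eps n i ^ (2 * k) * K) * b))
              \<le> G * eps n i ^ (2 * k + 1)" using elim by (intro G) auto
          also have "\<dots> \<le> G * (eps n n * eps n i ^ (2 * k))"
            using * G by (intro mult_left_mono) (auto intro!: mult_right_mono)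
          finally show "cmod (char (distr P borel (r (eps n i))) t - exp (of_real (eps n i ^ (2 * k) * K) * b))
              \<le> G * (eps n n * eps n i ^ (2 * k))" .
        qed
        also have "\<dots> = G * (eps n n * S (m n) n)"
          by (simp add: S_def sum_distrib_left)
        finally show ?case .
      qed
      have "(\<lambda>n. G * (eps n n * S (m n) n)) \<longlonglongrightarrow> G * (0 * L)"
        by (intro tendsto_intros eps_diag_tendsto S_lim)
      then show "(\<lambda>n. G * (eps n n * S (m n) n)) \<longlonglongrightarrow> 0" by simp
    qed
    moreover have "(\<lambda>n. exp (of_real (S (m n) n * K) * b)) \<longlonglongrightarrow> exp (of_real v * b)"
      unfolding v_def by (intro tendsto_intros S_lim)
    ultimately have "(\<lambda>n. (char (\<mu> n) t - exp (of_real (S (m n) n * K) * b)) + exp (of_real (S (m n) n * K) * b))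
        \<longlonglongrightarrow> 0 + exp (of_real v * b)" by (rule tendsto_add)
    then show ?thesis by (simp add: charM b_def)
  qed
  then have "weak_conv_m \<mu> M"
    using \<mu> M by (intro levy_continuity) auto
  then have "(\<lambda>n. \<integral>x. min 1 (exp x) \<partial>\<mu> n) \<longlonglongrightarrow> (\<integral>x. min 1 (exp x) \<partial>M)"
    using \<mu> M by (intro weak_conv_imp_integral_bdd_continuous_conv[where B = 1]) (auto intro!: continuous_intros)
  moreover have "(\<integral>x. min 1 (exp x) \<partial>\<mu> n) = \<Omega>.expectation (\<lambda>\<omega>. min 1 (exp (R (m n) n \<omega>)))" for n
    unfolding \<mu>_def by (subst integral_distr) auto
  moreover have "(\<integral>x. min 1 (exp x) \<partial>M) = 2 * std_normal_cdf (- (l ^ k / 2) * sqrt (K / (1 + 2 * \<kappa> * real k)))"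
  proof -
    have "(\<integral>x. min 1 (exp x) \<partial>M) = (\<integral>z. min 1 (exp (sqrt v * z - (sqrt v)\<^sup>2 / 2)) \<partial>std_normal_distribution)"
      unfolding M_def using v by (subst integral_distr) auto
    also have "\<dots> = 2 * std_normal_cdf (- sqrt v / 2)"
      using v by (intro expectation_min_1_exp_std_normal) simp
    also have "v = (l ^ k)\<^sup>2 * (K / (1 + 2 * \<kappa> * real k))"
      by (simp add: v_def L_def power_mult[symmetric] mult.commute)
    also have "sqrt \<dots> = l ^ k * sqrt (K / (1 + 2 * \<kappa> * real k))"
      unfolding real_sqrt_mult using l_pos by simp
    finally show ?thesis by simp
  qed
  ultimately show ?thesis by simp
qed

end

section \<open>The perturbation along the product space\<close>

text \<open>Jensen's inequality for the convex function \<open>x ^ j\<close> with weights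
  \<open>c i / Z\<close>, \<open>Z\<close> being the total weight; clearing denominators leaves
  \<open>Z ^ (j - 1)\<close>.\<close>

lemma power_weighted_sum_le:
  fixes c w :: "'i \<Rightarrow> real"
  assumes "\<And>i. i \<in> I \<Longrightarrow> 0 \<le> c i" "even j" "j > 0"
  shows "(\<Sum>i\<in>I. c i * w i) ^ j \<le> (\<Sum>i\<in>I. c i) ^ (j - 1) * (\<Sum>i\<in>I. c i * w i ^ j)"
proof (cases "finite I \<and> (\<Sum>i\<in>I. c i) \<noteq> 0")
  case False
  \<comment> \<open>In the degenerate case the index set is infinite, where sums are 0 by
    convention, or the nonnegative weights all vanish.\<close>
  have "c i * w i = 0" if "finite I" "i \<in> I" for i
    using False that assms(1) by (auto simp: sum_nonneg_eq_0_iff)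
  then have "(\<Sum>i\<in>I. c i * w i) = 0"
    by (cases "finite I") (auto intro!: sum.neutral)
  then have "(\<Sum>i\<in>I. c i * w i) ^ j = 0" using \<open>j > 0\<close> by simp
  moreover have "0 \<le> (\<Sum>i\<in>I. c i) ^ (j - 1) * (\<Sum>i\<in>I. c i * w i ^ j)"
    using assms by (intro mult_nonneg_nonneg zero_le_power sum_nonneg zero_le_even_power) auto
  ultimately show ?thesis by (rule ord_eq_le_trans)
next
  case True
  define Z where "Z = (\<Sum>i\<in>I. c i)"
  have "Z \<ge> 0" unfolding Z_def by (rule sum_nonneg) (rule assms(1))
  then have Z: "Z > 0" using True by (simp add: Z_def less_le)
  have "(\<Sum>i\<in>I. (c i / Z) *\<^sub>R w i) ^ j \<le> (\<Sum>i\<in>I. (c i / Z) * w i ^ j)"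
  proof (rule convex_on_sum)
    show "finite I" "I \<noteq> {}" using True by auto
    show "convex_on UNIV (\<lambda>x::real. x ^ j)" by (rule convex_power_even) fact
    show "(\<Sum>i\<in>I. c i / Z) = 1" using Z by (simp add: Z_def flip: sum_divide_distrib)
  qed (use assms Z in auto)
  then have "((\<Sum>i\<in>I. c i * w i) / Z) ^ j \<le> (\<Sum>i\<in>I. c i * w i ^ j) / Z"
    by (simp add: sum_divide_distrib)
  then have "Z ^ j * ((\<Sum>i\<in>I. c i * w i) / Z) ^ j \<le> Z ^ j * ((\<Sum>i\<in>I. c i * w i ^ j) / Z)"
    by (rule mult_left_mono) (use Z in simp)
  moreover have "Z ^ j * ((\<Sum>i\<in>I. c i * w i) / Z) ^ j = (\<Sum>i\<in>I. c i * w i) ^ j"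
    using Z by (simp flip: power_mult_distrib)
  moreover have "Z ^ j * ((\<Sum>i\<in>I. c i * w i ^ j) / Z) = Z ^ (j - 1) * (\<Sum>i\<in>I. c i * w i ^ j)"
    using Z power_minus_mult[OF \<open>j > 0\<close>, of Z, symmetric] by (simp only:) simp
  ultimately show ?thesis by (simp add: Z_def)
qed

text \<open>Meant for \<open>t = n powr (\<gamma> / 2)\<close>: the negative quadratic term is the
  decay of the affinities, the linear one the possible size of the perturbation. Once
  \<open>t \<ge> (b + 1) / c\<close> the exponent is at most \<open>d - t\<close>.\<close>

lemma powr_times_exp_quadratic_tendsto:
  fixes a b c d :: real
  assumes "c > 0"
  shows "((\<lambda>t. t powr a * exp (b * t + d - c * t\<^sup>2)) \<longlongrightarrow> 0) at_top"
proof (rule Lim_null_comparison)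
  define j where "j = nat \<lceil>a\<rceil>"
  show "\<forall>\<^sub>F t in at_top. norm (t powr a * exp (b * t + d - c * t\<^sup>2)) \<le> exp d * (t ^ j / exp t)"
    using eventually_ge_at_top[of 1] eventually_ge_at_top[of "(b + 1) / c"]
  proof eventually_elim
    case (elim t)
    then have "b + 1 \<le> c * t" using assms by (simp add: field_simps)
    then have "(b + 1) * t \<le> (c * t) * t" using elim by (intro mult_right_mono) auto
    then have "b * t + d - c * t\<^sup>2 \<le> d - t" by (simp add: power2_eq_square algebra_simps)
    then have "exp (b * t + d - c * t\<^sup>2) \<le> exp d / exp t" by (simp flip: exp_diff)
    moreover have "t powr a \<le> t powr real j"
      using elim by (intro powr_mono) (auto simp: j_def, linarith)
    ultimately have "t powr a * exp (b * t + d - c * t\<^sup>2) \<le> t powr real j * (exp d / exp t)"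
      by (intro mult_mono) auto
    then show ?case using elim by (simp add: powr_realpow mult.commute)
  qed
  show "((\<lambda>t. exp d * (t ^ j / exp t)) \<longlongrightarrow> 0) at_top"
    by (rule tendsto_mult_right_zero[OF tendsto_power_div_exp_0])
qed

context prob_space
begin

text \<open>Measurability and bounds are asked for large \<open>n\<close> only, since the
  assumptions on the perturbation hold eventually; a shift of the index reduces to dominated
  convergence.\<close>

lemma bounded_convergence:
  fixes X :: "nat \<Rightarrow> 'a \<Rightarrow> real"
  assumes meas: "\<forall>\<^sub>F n in sequentially. X n \<in> borel_measurable M"
    and bound: "\<forall>\<^sub>F n in sequentially. \<forall>x\<in>space M. \<bar>X n x\<bar> \<le> c"
    and lim: "AE x in M. (\<lambda>n. X n x) \<longlonglongrightarrow> 0"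
  shows "(\<lambda>n. expectation (X n)) \<longlonglongrightarrow> 0"
proof -
  obtain N where N: "\<And>n. n \<ge> N \<Longrightarrow> X n \<in> borel_measurable M \<and> (\<forall>x\<in>space M. \<bar>X n x\<bar> \<le> c)"
    using eventually_conj[OF meas bound] unfolding eventually_sequentially by blast
  have "(\<lambda>n. expectation (X (n + N))) \<longlonglongrightarrow> expectation (\<lambda>_. 0)"
  proof (rule integral_dominated_convergence[where w = "\<lambda>_. c"])
    show "AE x in M. (\<lambda>n. X (n + N) x) \<longlonglongrightarrow> 0"
      using lim by eventually_elim (rule LIMSEQ_ignore_initial_segment)
    show "AE x in M. norm (X (n + N) x) \<le> c" for n using N[of "n + N"] by auto
    show "X (n + N) \<in> borel_measurable M" for n using N[of "n + N"] by simp
  qed simp_all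
  then have "(\<lambda>n. expectation (X (n + N))) \<longlonglongrightarrow> 0" by simp
  then show ?thesis by (rule LIMSEQ_offset)
qed

end

section \<open>State and proposal vectors in the weighted norms\<close>

context balanced_array
begin

text \<open>\<open>m\<close> is a cut-off: coordinates beyond it are set to 0, and
  \<open>xv n n\<close> is the full state in dimension \<open>n\<close>.\<close>

definition xv :: "nat \<Rightarrow> nat \<Rightarrow> (nat \<Rightarrow> real \<times> real) \<Rightarrow> nat \<Rightarrow> real" where
  "xv m n \<omega> = (\<lambda>i\<in>{1..n}. if i \<le> m then coord_scale \<kappa> i * fst (\<omega> i) else 0)"

definition yv :: "nat \<Rightarrow> (nat \<Rightarrow> real \<times> real) \<Rightarrow> nat \<Rightarrow> real" where
  "yv n \<omega> = (\<lambda>i\<in>{1..n}. coord_scale \<kappa> i * Y (eps n i) (\<omega> i))"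

lemma xv_space [simp]: "xv m n \<omega> \<in> space (Rn n)" and yv_space [simp]: "yv n \<omega> \<in> space (Rn n)"
  by (simp_all only: space_Rn xv_def yv_def restrict_extensional)

lemma xv_measurable [measurable]: "xv m n \<in> \<Omega> \<rightarrow>\<^sub>M Rn n"
  unfolding xv_def Rn_def
proof (rule measurable_restrict)
  fix i
  have [measurable]: "(\<lambda>\<omega>. fst (\<omega> i)) \<in> borel_measurable \<Omega>"
    by (rule measurable_compose[OF measurable_coord fst_measurable])
  show "(\<lambda>\<omega>. if i \<le> m then coord_scale \<kappa> i * fst (\<omega> i) else 0) \<in> \<Omega> \<rightarrow>\<^sub>M lborel"
    by (cases "i \<le> m") simp_all
qed

lemma yv_measurable [measurable]: "yv n \<in> \<Omega> \<rightarrow>\<^sub>M Rn n"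
  unfolding yv_def Rn_def
proof (rule measurable_restrict)
  fix i
  have "(\<lambda>\<omega>. Y (eps n i) (\<omega> i)) \<in> borel_measurable \<Omega>"
    by (rule measurable_compose[OF measurable_coord Y_meas])
  then show "(\<lambda>\<omega>. coord_scale \<kappa> i * Y (eps n i) (\<omega> i)) \<in> \<Omega> \<rightarrow>\<^sub>M lborel"
    by simp
qed

text \<open>Expresses that the truncated state is a function of the first \<open>m\<close>
  coordinates of \<open>\<omega>\<close>, as independence from the later block demands.\<close>

lemma xv_measurable_block: "xv m n \<in> PiM {0<..m} (\<lambda>_. borel) \<rightarrow>\<^sub>M Rn n"
  unfolding xv_def Rn_def
proof (rule measurable_restrict)
  fix i assume "i \<in> {1..n}"
  show "(\<lambda>\<omega>. if i \<le> m then coord_scale \<kappa> i * fst (\<omega> i) else 0)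
      \<in> PiM {0<..m} (\<lambda>_. borel :: (real \<times> real) measure) \<rightarrow>\<^sub>M lborel"
  proof (cases "i \<le> m")
    case True
    then have "i \<in> {0<..m}" using \<open>i \<in> {1..n}\<close> by auto
    then have "(\<lambda>\<omega>. \<omega> i) \<in> PiM {0<..m} (\<lambda>_. borel :: (real \<times> real) measure) \<rightarrow>\<^sub>M borel"
      by (rule measurable_component_singleton)
    from measurable_compose[OF this fst_measurable]
    have "(\<lambda>\<omega>. coord_scale \<kappa> i * fst (\<omega> i)) \<in> borel_measurable (PiM {0<..m} (\<lambda>_. borel :: (real \<times> real) measure))"
      by (intro borel_measurable_times borel_measurable_const)
    then show ?thesis using True by simp
  qed simp
qed

lemma coord_scale_pos: "i \<ge> 1 \<Longrightarrow> coord_scale \<kappa> i > 0"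
  by (simp add: coord_scale_def)

text \<open>The \<open>i\<close>-th summand of the squared norm with exponent \<open>a\<close> of
  the vector \<open>coord_scale \<kappa> i * W (\<omega> i)\<close>. That vector dominates states,
  up to a factor 2 proposals for small steps, and after scaling by \<open>eps n n\<close> their
  difference.\<close>

definition q :: "real \<Rightarrow> (nat \<Rightarrow> real \<times> real) \<Rightarrow> nat \<Rightarrow> real" where
  "q a \<omega> i = real i powr (2 * a - 2 * \<kappa>) * (W (\<omega> i))\<^sup>2"

lemma q_nonneg: "q a \<omega> i \<ge> 0"
  by (simp add: q_def)

lemma q_measurable [measurable]: "(\<lambda>\<omega>. q a \<omega> i) \<in> borel_measurable \<Omega>"
proof -
  have [measurable]: "(\<lambda>\<omega>. W (\<omega> i)) \<in> borel_measurable \<Omega>"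
    by (rule measurable_compose[OF measurable_coord W_meas])
  show ?thesis unfolding q_def by simp
qed

text \<open>The expected sum is a multiple of the series of
  \<open>i powr (2 * a - 2 * \<kappa>)\<close>, which converges precisely because
  \<open>a < \<kappa> - 1 / 2\<close>. A nonnegative series of finite expectation converges almost
  surely.\<close>

lemma AE_summable_q:
  assumes "a < \<kappa> - 1 / 2"
  shows "AE \<omega> in \<Omega>. summable (q a \<omega>)"
proof -
  have sum: "summable (\<lambda>i. real i powr (2 * a - 2 * \<kappa>))"
    using assms by (subst summable_real_powr_iff) auto
  have W2: "expectation (\<lambda>u. (W u)\<^sup>2) \<ge> 0" by simp
  have "(\<integral>\<^sup>+\<omega>. (\<Sum>i. ennreal (q a \<omega> i)) \<partial>\<Omega>) = (\<Sum>i. \<integral>\<^sup>+\<omega>. ennreal (q a \<omega> i) \<partial>\<Omega>)"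
    by (rule nn_integral_suminf) measurable
  also have "\<dots> = (\<Sum>i. ennreal (real i powr (2 * a - 2 * \<kappa>) * expectation (\<lambda>u. (W u)\<^sup>2)))"
  proof (rule arg_cong[where f = suminf], rule ext)
    fix i
    have "(\<integral>\<^sup>+\<omega>. ennreal (q a \<omega> i) \<partial>\<Omega>) = (\<integral>\<^sup>+u. ennreal (real i powr (2 * a - 2 * \<kappa>) * (W u)\<^sup>2) \<partial>P)"
      unfolding q_def by (rule nn_integral_coord[where h = "\<lambda>u. ennreal (real i powr (2 * a - 2 * \<kappa>) * (W u)\<^sup>2)"]) measurable
    also have "\<dots> = ennreal (expectation (\<lambda>u. real i powr (2 * a - 2 * \<kappa>) * (W u)\<^sup>2))"
      using W_moment[of 2] by (intro nn_integral_eq_integral) auto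
    finally show "(\<integral>\<^sup>+\<omega>. ennreal (q a \<omega> i) \<partial>\<Omega>) = ennreal (real i powr (2 * a - 2 * \<kappa>) * expectation (\<lambda>u. (W u)\<^sup>2))"
      by simp
  qed
  also have "\<dots> \<noteq> top"
    using sum W2 by (intro ennreal_suminf_neq_top summable_mult2) auto
  finally have "AE \<omega> in \<Omega>. (\<Sum>i. ennreal (q a \<omega> i)) \<noteq> \<infinity>"
    by (intro nn_integral_PInf_AE) auto
  then show ?thesis
    by eventually_elim (auto intro: summable_suminf_not_top q_nonneg)
qed

text \<open>\<open>I\<close> contains the support of \<open>v\<close>: all coordinates for states
  and proposals, the tail beyond the cut-off for truncation errors.\<close>

lemma wnorm_le:
  assumes I: "I \<subseteq> {1..n}" and c: "c \<ge> 0"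
    and v: "\<And>i. i \<in> I \<Longrightarrow> \<bar>v i\<bar> \<le> c * (coord_scale \<kappa> i * W (\<omega> i))"
    and v0: "\<And>i. i \<in> {1..n} - I \<Longrightarrow> v i = 0"
  shows "wnorm n a v \<le> c * sqrt (\<Sum>i\<in>I. q a \<omega> i)"
proof -
  have "(\<Sum>i=1..n. real i powr (2 * a) * (v i)\<^sup>2) = (\<Sum>i\<in>I. real i powr (2 * a) * (v i)\<^sup>2)"
    using I v0 by (intro sum.mono_neutral_right) auto
  also have "\<dots> \<le> (\<Sum>i\<in>I. c\<^sup>2 * q a \<omega> i)"
  proof (rule sum_mono)
    fix i assume i: "i \<in> I"
    then have "i \<ge> 1" using I by auto
    have "(v i)\<^sup>2 \<le> (c * (coord_scale \<kappa> i * W (\<omega> i)))\<^sup>2"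
      using power_mono[OF v[OF i], of 2] by simp
    also have "\<dots> = c\<^sup>2 * (real i powr (- 2 * \<kappa>) * (W (\<omega> i))\<^sup>2)"
      using \<open>i \<ge> 1\<close> by (simp add: power_mult_distrib coord_scale_def power2_eq_square flip: powr_add)
    finally have "real i powr (2 * a) * (v i)\<^sup>2 \<le> real i powr (2 * a) * (c\<^sup>2 * (real i powr (- 2 * \<kappa>) * (W (\<omega> i))\<^sup>2))"
      by (rule mult_left_mono) simp
    also have "\<dots> = c\<^sup>2 * ((real i powr (2 * a) * real i powr (- 2 * \<kappa>)) * (W (\<omega> i))\<^sup>2)" by simp
    also have "real i powr (2 * a) * real i powr (- 2 * \<kappa>) = real i powr (2 * a - 2 * \<kappa>)"
      by (simp flip: powr_add)
    finally show "real i powr (2 * a) * (v i)\<^sup>2 \<le> c\<^sup>2 * q a \<omega> i" by (simp add: q_def)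
  qed
  also have "\<dots> = c\<^sup>2 * (\<Sum>i\<in>I. q a \<omega> i)" by (simp add: sum_distrib_left)
  finally have "wnorm n a v \<le> sqrt (c\<^sup>2 * (\<Sum>i\<in>I. q a \<omega> i))"
    unfolding wnorm_def by (rule real_sqrt_le_mono)
  then show ?thesis using c by (simp add: real_sqrt_mult)
qed

lemma wnorm_le_suminf:
  assumes "summable (q a \<omega>)" "c \<ge> 0"
    and "\<And>i. i \<in> {1..n} \<Longrightarrow> \<bar>v i\<bar> \<le> c * (coord_scale \<kappa> i * W (\<omega> i))"
  shows "wnorm n a v \<le> c * sqrt (suminf (q a \<omega>))"
proof -
  have "wnorm n a v \<le> c * sqrt (\<Sum>i\<in>{1..n}. q a \<omega> i)"
    using assms by (intro wnorm_le) auto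
  also have "\<dots> \<le> c * sqrt (suminf (q a \<omega>))"
    using assms q_nonneg by (intro mult_left_mono real_sqrt_le_mono sum_le_suminf) auto
  finally show ?thesis .
qed

lemma xv_le: "i \<in> {1..n} \<Longrightarrow> \<bar>xv m n \<omega> i\<bar> \<le> 1 * (coord_scale \<kappa> i * W (\<omega> i))"
proof -
  assume i: "i \<in> {1..n}"
  have "coord_scale \<kappa> i * \<bar>fst (\<omega> i)\<bar> \<le> coord_scale \<kappa> i * W (\<omega> i)"
    using i coord_scale_pos[of i] fst_le_W[of "\<omega> i"] by (intro mult_left_mono) auto
  moreover have "0 \<le> coord_scale \<kappa> i * W (\<omega> i)"
    using i coord_scale_pos[of i] W_nonneg[of "\<omega> i"] by simp
  ultimately show ?thesis using i coord_scale_pos[of i] by (simp add: xv_def abs_mult)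
qed

lemma yv_xv_le:
  assumes "i \<in> {1..n}" "eps n n < 1"
  shows "\<bar>yv n \<omega> i - xv n n \<omega> i\<bar> \<le> eps n n * (coord_scale \<kappa> i * W (\<omega> i))"
proof -
  have e: "0 < eps n i" "eps n i \<le> eps n n" using assms eps_pos eps_le by auto
  have "\<bar>Y (eps n i) (\<omega> i) - fst (\<omega> i)\<bar> \<le> eps n i * W (\<omega> i)"
    using e assms by (intro Y_approx) auto
  also have "\<dots> \<le> eps n n * W (\<omega> i)" using e W_nonneg by (intro mult_right_mono) auto
  finally have "coord_scale \<kappa> i * \<bar>Y (eps n i) (\<omega> i) - fst (\<omega> i)\<bar> \<le> coord_scale \<kappa> i * (eps n n * W (\<omega> i))"
    using coord_scale_pos[of i] assms by (intro mult_left_mono) auto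
  moreover have "yv n \<omega> i - xv n n \<omega> i = coord_scale \<kappa> i * (Y (eps n i) (\<omega> i) - fst (\<omega> i))"
    using assms by (simp add: yv_def xv_def right_diff_distrib)
  ultimately show ?thesis
    using coord_scale_pos[of i] assms by (simp add: abs_mult mult_ac)
qed

lemma yv_le:
  assumes "i \<in> {1..n}" "eps n n < 1"
  shows "\<bar>yv n \<omega> i\<bar> \<le> 2 * (coord_scale \<kappa> i * W (\<omega> i))"
proof -
  have "eps n n * (coord_scale \<kappa> i * W (\<omega> i)) \<le> 1 * (coord_scale \<kappa> i * W (\<omega> i))"
    using assms coord_scale_pos[of i] W_nonneg by (intro mult_right_mono) auto
  then show ?thesis
    using yv_xv_le[OF assms, of \<omega>] xv_le[OF assms(1), of n \<omega>] by linarith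
qed

end

text \<open>The perturbation in terms of the product space: \<open>phi_norm\<close> says that the
  target has total mass 1, \<open>L\<close> is the lower bound of assumption (A), and assumption (B)
  is separated into its Lipschitz and its growth part.\<close>

locale target_array = balanced_array +
  fixes \<phi> :: "nat \<Rightarrow> (nat \<Rightarrow> real) \<Rightarrow> real" and L :: real
    and \<delta> :: "real \<times> real \<Rightarrow> real" and D p s s' s'' :: real
  assumes phi_meas: "\<And>n. n \<ge> 1 \<Longrightarrow> \<phi> n \<in> borel_measurable (Rn n)"
    and phi_norm: "\<And>n. n \<ge> 1 \<Longrightarrow> \<Omega>.expectation (\<lambda>\<omega>. exp (- \<phi> n (xv n n \<omega>))) = 1"
    and phi_lower: "\<forall>\<^sub>F n in sequentially. \<forall>x\<in>space (Rn n). L \<le> \<phi> n x"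
    and delta_locally_bounded: "locally_bounded_on ({0..} \<times> {0..}) \<delta>"
    and D_pos: "D > 0" and p_pos: "p > 0"
    and exponents: "s < \<kappa> - 1 / 2" "s' < \<kappa> - 1 / 2" "s'' < \<kappa> - 1 / 2"
    and phi_lipschitz: "\<forall>\<^sub>F n in sequentially. \<forall>x\<in>space (Rn n). \<forall>y\<in>space (Rn n).
      \<bar>\<phi> n y - \<phi> n x\<bar> \<le> \<delta> (wnorm n s x, wnorm n s y) * wnorm n s' (\<lambda>i. y i - x i)"
    and phi_growth: "\<forall>\<^sub>F n in sequentially. \<forall>x\<in>space (Rn n). \<bar>\<phi> n x\<bar> \<le> D * (1 + wnorm n s'' x powr p)"
begin

lemma phi_measurable_comp [measurable]:
  "n \<ge> 1 \<Longrightarrow> (\<lambda>\<omega>. \<phi> n (xv m n \<omega>)) \<in> borel_measurable \<Omega>"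
  "n \<ge> 1 \<Longrightarrow> (\<lambda>\<omega>. \<phi> n (yv n \<omega>)) \<in> borel_measurable \<Omega>"
  by (rule measurable_compose[OF xv_measurable phi_meas] measurable_compose[OF yv_measurable phi_meas], assumption)+

text \<open>For fixed \<open>\<omega>\<close> the common envelope confines both norms to an interval
  \<open>{0..r}\<close> that does not depend on \<open>n\<close>. Local boundedness then bounds
  \<open>\<delta>\<close> uniformly in \<open>n\<close>, and the distance in the norm
  \<open>s'\<close> does the rest.\<close>

lemma phi_diff_tendsto:
  assumes sum: "summable (q s \<omega>)"
    and u: "\<And>n. u n \<in> space (Rn n)" "\<forall>\<^sub>F n in sequentially. \<forall>i\<in>{1..n}. \<bar>u n i\<bar> \<le> 2 * (coord_scale \<kappa> i * W (\<omega> i))"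
    and v: "\<And>n. v n \<in> space (Rn n)" "\<forall>\<^sub>F n in sequentially. \<forall>i\<in>{1..n}. \<bar>v n i\<bar> \<le> 2 * (coord_scale \<kappa> i * W (\<omega> i))"
    and lim: "(\<lambda>n. wnorm n s' (\<lambda>i. v n i - u n i)) \<longlonglongrightarrow> 0"
  shows "(\<lambda>n. \<phi> n (v n) - \<phi> n (u n)) \<longlonglongrightarrow> 0"
proof -
  define r where "r = 2 * sqrt (suminf (q s \<omega>))"
  have "bounded ({0..r} \<times> {0..r})" by (intro bounded_Times bounded_closed_interval)
  then have "bounded (\<delta> ` ({0..r} \<times> {0..r}))"
    using delta_locally_bounded unfolding locally_bounded_on_def by (force simp: subset_iff)
  then obtain d where d: "\<And>a b. 0 \<le> a \<Longrightarrow> a \<le> r \<Longrightarrow> 0 \<le> b \<Longrightarrow> b \<le> r \<Longrightarrow> \<bar>\<delta> (a, b)\<bar> \<le> d"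
    unfolding bounded_iff by fastforce
  show ?thesis
  proof (rule Lim_null_comparison)
    show "\<forall>\<^sub>F n in sequentially. norm (\<phi> n (v n) - \<phi> n (u n)) \<le> d * wnorm n s' (\<lambda>i. v n i - u n i)"
      using phi_lipschitz u(2) v(2)
    proof eventually_elim
      case (elim n)
      have "wnorm n s (u n) \<le> r" "wnorm n s (v n) \<le> r"
        unfolding r_def using sum elim by (auto intro!: wnorm_le_suminf)
      then have "\<bar>\<delta> (wnorm n s (u n), wnorm n s (v n))\<bar> \<le> d"
        by (intro d wnorm_nonneg)
      then have "\<delta> (wnorm n s (u n), wnorm n s (v n)) * wnorm n s' (\<lambda>i. v n i - u n i)
          \<le> d * wnorm n s' (\<lambda>i. v n i - u n i)"
        by (intro mult_right_mono wnorm_nonneg) simp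
      moreover have "\<bar>\<phi> n (v n) - \<phi> n (u n)\<bar>
          \<le> \<delta> (wnorm n s (u n), wnorm n s (v n)) * wnorm n s' (\<lambda>i. v n i - u n i)"
        using elim u(1) v(1) by blast
      ultimately show ?case by simp
    qed
    show "(\<lambda>n. d * wnorm n s' (\<lambda>i. v n i - u n i)) \<longlonglongrightarrow> 0"
      using lim by (rule tendsto_mult_right_zero)
  qed
qed

text \<open>The displacement is \<open>eps n n\<close> times a vector of almost surely bounded
  norm.\<close>

lemma AE_phi_proposal_tendsto:
  "AE \<omega> in \<Omega>. (\<lambda>n. \<phi> n (xv n n \<omega>) - \<phi> n (yv n \<omega>)) \<longlonglongrightarrow> 0"
  using AE_summable_q[OF exponents(1)] AE_summable_q[OF exponents(2)]
proof eventually_elim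
  case (elim \<omega>)
  have ev: "\<forall>\<^sub>F n in sequentially. eps n n < 1" by (rule eventually_eps_diag_less) simp
  have "(\<lambda>n. \<phi> n (yv n \<omega>) - \<phi> n (xv n n \<omega>)) \<longlonglongrightarrow> 0"
  proof (rule phi_diff_tendsto[OF elim(1)])
    show "\<forall>\<^sub>F n in sequentially. \<forall>i\<in>{1..n}. \<bar>xv n n \<omega> i\<bar> \<le> 2 * (coord_scale \<kappa> i * W (\<omega> i))"
    proof (intro always_eventually allI ballI)
      fix n i :: nat assume i: "i \<in> {1..n}"
      then have "0 \<le> coord_scale \<kappa> i * W (\<omega> i)"
        using coord_scale_pos[of i] W_nonneg[of "\<omega> i"] by simp
      then show "\<bar>xv n n \<omega> i\<bar> \<le> 2 * (coord_scale \<kappa> i * W (\<omega> i))"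
        using xv_le[OF i, of n \<omega>] by linarith
    qed
    show "\<forall>\<^sub>F n in sequentially. \<forall>i\<in>{1..n}. \<bar>yv n \<omega> i\<bar> \<le> 2 * (coord_scale \<kappa> i * W (\<omega> i))"
      using ev by eventually_elim (blast intro: yv_le)
    show "(\<lambda>n. wnorm n s' (\<lambda>i. yv n \<omega> i - xv n n \<omega> i)) \<longlonglongrightarrow> 0"
    proof (rule Lim_null_comparison)
      show "\<forall>\<^sub>F n in sequentially. norm (wnorm n s' (\<lambda>i. yv n \<omega> i - xv n n \<omega> i)) \<le> eps n n * sqrt (suminf (q s' \<omega>))"
        using ev eventually_ge_at_top[of 1]
      proof eventually_elim
        case (elim n)
        then have "wnorm n s' (\<lambda>i. yv n \<omega> i - xv n n \<omega> i) \<le> eps n n * sqrt (suminf (q s' \<omega>))"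
          using \<open>summable (q s' \<omega>)\<close> eps_pos[of n n] by (intro wnorm_le_suminf yv_xv_le) auto
        then show ?case using wnorm_nonneg by simp
      qed
      show "(\<lambda>n. eps n n * sqrt (suminf (q s' \<omega>))) \<longlonglongrightarrow> 0"
        by (rule tendsto_mult_left_zero[OF eps_diag_tendsto])
    qed
  qed auto
  from tendsto_minus[OF this] show ?case by simp
qed

text \<open>The full and the truncated state differ only beyond \<open>m n\<close>, so their
  distance is the root of a tail of an almost surely convergent series.\<close>

lemma AE_phi_truncation_tendsto:
  assumes m: "filterlim m at_top sequentially" "\<And>n. m n \<le> n"
  shows "AE \<omega> in \<Omega>. (\<lambda>n. \<phi> n (xv n n \<omega>) - \<phi> n (xv (m n) n \<omega>)) \<longlonglongrightarrow> 0"
  using AE_summable_q[OF exponents(1)] AE_summable_q[OF exponents(2)]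
proof eventually_elim
  case (elim \<omega>)
  have xv_le2: "\<bar>xv j n \<omega> i\<bar> \<le> 2 * (coord_scale \<kappa> i * W (\<omega> i))" if i: "i \<in> {1..n}" for j n i :: nat
  proof -
    have "0 \<le> coord_scale \<kappa> i * W (\<omega> i)"
      using i coord_scale_pos[of i] W_nonneg[of "\<omega> i"] by simp
    then show ?thesis using xv_le[OF i, of j \<omega>] by linarith
  qed
  show ?case
  proof (rule phi_diff_tendsto[OF elim(1)])
    show "(\<lambda>n. wnorm n s' (\<lambda>i. xv n n \<omega> i - xv (m n) n \<omega> i)) \<longlonglongrightarrow> 0"
    proof (rule Lim_null_comparison)
      show "\<forall>\<^sub>F n in sequentially. norm (wnorm n s' (\<lambda>i. xv n n \<omega> i - xv (m n) n \<omega> i)) \<le> sqrt (\<Sum>i\<in>{m n<..n}. q s' \<omega> i)"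
      proof (intro always_eventually allI)
        fix n
        have "wnorm n s' (\<lambda>i. xv n n \<omega> i - xv (m n) n \<omega> i) \<le> 1 * sqrt (\<Sum>i\<in>{m n<..n}. q s' \<omega> i)"
        proof (rule wnorm_le)
          show "\<bar>xv n n \<omega> i - xv (m n) n \<omega> i\<bar> \<le> 1 * (coord_scale \<kappa> i * W (\<omega> i))" if "i \<in> {m n<..n}" for i
            using that xv_le[of i n n \<omega>] by (auto simp: xv_def)
        qed (auto simp: xv_def)
        then show "norm (wnorm n s' (\<lambda>i. xv n n \<omega> i - xv (m n) n \<omega> i)) \<le> sqrt (\<Sum>i\<in>{m n<..n}. q s' \<omega> i)"
          using wnorm_nonneg by simp
      qed
      have part: "(\<lambda>n. \<Sum>i\<le>n. q s' \<omega> i) \<longlonglongrightarrow> suminf (q s' \<omega>)"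
        using elim(2) by (rule summable_LIMSEQ')
      have "(\<lambda>n. (\<Sum>i\<le>n. q s' \<omega> i) - (\<Sum>i\<le>m n. q s' \<omega> i)) \<longlonglongrightarrow> suminf (q s' \<omega>) - suminf (q s' \<omega>)"
        by (intro tendsto_diff part filterlim_compose[OF part m(1)])
      moreover have "(\<Sum>i\<le>n. q s' \<omega> i) - (\<Sum>i\<le>m n. q s' \<omega> i) = (\<Sum>i\<in>{m n<..n}. q s' \<omega> i)" for n
      proof -
        have "{..n} = {..m n} \<union> {m n<..n}" using m(2)[of n] by auto
        then have "(\<Sum>i\<le>n. q s' \<omega> i) = (\<Sum>i\<le>m n. q s' \<omega> i) + (\<Sum>i\<in>{m n<..n}. q s' \<omega> i)"
          by (simp add: sum.union_disjoint ivl_disj_int)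
        then show ?thesis by simp
      qed
      ultimately have "(\<lambda>n. \<Sum>i\<in>{m n<..n}. q s' \<omega> i) \<longlonglongrightarrow> 0" by simp
      from tendsto_real_sqrt[OF this] show "(\<lambda>n. sqrt (\<Sum>i\<in>{m n<..n}. q s' \<omega> i)) \<longlonglongrightarrow> 0" by simp
    qed
  qed (auto intro!: always_eventually xv_le2)
qed

end

section \<open>Acceptance probability in the three regimes\<close>

context target_array
begin

text \<open>The first factor is the density of the target with respect to the reference measure;
  hence the expectation over \<open>\<Omega>\<close> is the expected acceptance probability under
  the target.\<close>

definition accept :: "nat \<Rightarrow> (nat \<Rightarrow> real \<times> real) \<Rightarrow> real" where
  "accept n \<omega> = exp (- \<phi> n (xv n n \<omega>)) *
    min 1 (exp (\<phi> n (xv n n \<omega>) - \<phi> n (yv n \<omega>) + R 0 n \<omega>))"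

lemma exp_phi_bounds:
  "\<forall>\<^sub>F n in sequentially. \<forall>m \<omega>. exp (- \<phi> n (xv m n \<omega>)) \<le> exp (- L)"
  using phi_lower by eventually_elim simp

lemma integrable_exp_phi:
  assumes "n \<ge> 1" "\<forall>m \<omega>. exp (- \<phi> n (xv m n \<omega>)) \<le> exp (- L)"
  shows "integrable \<Omega> (\<lambda>\<omega>. exp (- \<phi> n (xv m n \<omega>)))"
  using assms by (intro \<Omega>.integrable_const_bound[where B = "exp (- L)"]) auto

lemma min_phi_proposal_tendsto:
  "(\<lambda>n. \<Omega>.expectation (\<lambda>\<omega>. min 1 \<bar>\<phi> n (xv n n \<omega>) - \<phi> n (yv n \<omega>)\<bar>)) \<longlonglongrightarrow> 0"
proof (rule \<Omega>.bounded_convergence[where c = 1])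
  show "\<forall>\<^sub>F n in sequentially. (\<lambda>\<omega>. min 1 \<bar>\<phi> n (xv n n \<omega>) - \<phi> n (yv n \<omega>)\<bar>) \<in> borel_measurable \<Omega>"
    using eventually_ge_at_top[of 1] by eventually_elim measurable
  show "AE \<omega> in \<Omega>. (\<lambda>n. min 1 \<bar>\<phi> n (xv n n \<omega>) - \<phi> n (yv n \<omega>)\<bar>) \<longlonglongrightarrow> 0"
    using AE_phi_proposal_tendsto
  proof eventually_elim
    case (elim \<omega>)
    have "(\<lambda>n. min 1 \<bar>\<phi> n (xv n n \<omega>) - \<phi> n (yv n \<omega>)\<bar>) \<longlonglongrightarrow> min 1 \<bar>0\<bar>"
      by (intro tendsto_min tendsto_const tendsto_rabs elim)
    then show ?case by simp
  qed
qed (auto intro!: always_eventually)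

text \<open>Because \<open>exp (- \<phi>)\<close> has expectation 1, the defect
  \<open>1 - E accept\<close> is an expectation of \<open>exp (- \<phi>)\<close> times one minus the
  acceptance probability. The bound \<open>exp (- L)\<close> removes the weight, and the Lipschitz
  estimate separates the perturbation from the log-ratio.\<close>

lemma accept_subcritical:
  assumes "\<gamma> < 0"
  shows "(\<lambda>n. \<Omega>.expectation (accept n)) \<longlonglongrightarrow> 1"
proof -
  have "(\<lambda>n. 1 - \<Omega>.expectation (accept n)) \<longlonglongrightarrow> 0"
  proof (rule Lim_null_comparison)
    show "\<forall>\<^sub>F n in sequentially. norm (1 - \<Omega>.expectation (accept n)) \<le>
        exp (- L) * (\<Omega>.expectation (\<lambda>\<omega>. min 1 \<bar>\<phi> n (xv n n \<omega>) - \<phi> n (yv n \<omega>)\<bar>)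
          + \<Omega>.expectation (\<lambda>\<omega>. 1 - min 1 (exp (R 0 n \<omega>))))"
      using exp_phi_bounds eventually_ge_at_top[of 1]
    proof eventually_elim
      case (elim n)
      note [measurable] = phi_measurable_comp[OF elim(2)]
      define A where "A \<omega> = exp (- \<phi> n (xv n n \<omega>))" for \<omega>
      define \<Delta> where "\<Delta> \<omega> = \<phi> n (xv n n \<omega>) - \<phi> n (yv n \<omega>)" for \<omega>
      have [measurable]: "A \<in> borel_measurable \<Omega>" "\<Delta> \<in> borel_measurable \<Omega>"
        unfolding A_def \<Delta>_def by measurable
      have A: "0 \<le> A \<omega>" "A \<omega> \<le> exp (- L)" for \<omega> using elim by (auto simp: A_def)
      have intA: "integrable \<Omega> A" unfolding A_def using elim by (rule_tac integrable_exp_phi)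
      have acc: "accept n \<omega> = A \<omega> * min 1 (exp (\<Delta> \<omega> + R 0 n \<omega>))" for \<omega>
        by (simp add: accept_def A_def \<Delta>_def)
      have int_acc: "integrable \<Omega> (accept n)"
        unfolding acc using A min_1_exp_bounds
        by (intro Bochner_Integration.integrable_bound[OF intA]) (auto simp: abs_mult intro!: mult_left_le)
      have int1: "integrable \<Omega> (\<lambda>\<omega>. min 1 \<bar>\<Delta> \<omega>\<bar>)"
        by (intro \<Omega>.integrable_const_bound[where B = 1]) auto
      have int2: "integrable \<Omega> (\<lambda>\<omega>. 1 - min 1 (exp (R 0 n \<omega>)))"
        by (intro \<Omega>.integrable_const_bound[where B = 1]) auto
      have "1 - \<Omega>.expectation (accept n) = \<Omega>.expectation (\<lambda>\<omega>. A \<omega> - accept n \<omega>)"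
      proof -
        have "\<Omega>.expectation A = 1" unfolding A_def[abs_def] by (rule phi_norm[OF elim(2)])
        then show ?thesis using intA int_acc by simp
      qed
      also have "\<bar>\<dots>\<bar> \<le> \<Omega>.expectation (\<lambda>\<omega>. \<bar>A \<omega> - accept n \<omega>\<bar>)"
        by (rule integral_abs_bound)
      also have "\<dots> \<le> \<Omega>.expectation (\<lambda>\<omega>. exp (- L) * (min 1 \<bar>\<Delta> \<omega>\<bar> + (1 - min 1 (exp (R 0 n \<omega>)))))"
      proof (rule integral_mono)
        show "integrable \<Omega> (\<lambda>\<omega>. \<bar>A \<omega> - accept n \<omega>\<bar>)" using intA int_acc by simp
        show "integrable \<Omega> (\<lambda>\<omega>. exp (- L) * (min 1 \<bar>\<Delta> \<omega>\<bar> + (1 - min 1 (exp (R 0 n \<omega>)))))"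
          using int1 int2 by (intro integrable_mult_right Bochner_Integration.integrable_add)
        fix \<omega>
        have "\<bar>A \<omega> - accept n \<omega>\<bar> = A \<omega> * (1 - min 1 (exp (\<Delta> \<omega> + R 0 n \<omega>)))"
          using A[of \<omega>] min_1_exp_bounds[of "\<Delta> \<omega> + R 0 n \<omega>"]
          by (simp only: acc right_diff_distrib mult_1_right abs_of_nonneg mult_left_le diff_ge_0_iff_ge)
        also have "\<dots> \<le> exp (- L) * (min 1 \<bar>\<Delta> \<omega>\<bar> + (1 - min 1 (exp (R 0 n \<omega>))))"
        proof (rule mult_mono)
          show "1 - min 1 (exp (\<Delta> \<omega> + R 0 n \<omega>)) \<le> min 1 \<bar>\<Delta> \<omega>\<bar> + (1 - min 1 (exp (R 0 n \<omega>)))"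
          proof -
            have "1 - x \<le> z + (1 - y)" if "\<bar>x - y\<bar> \<le> z" for x y z :: real
              using that by linarith
            from this[OF min_1_exp_lipschitz[of "\<Delta> \<omega> + R 0 n \<omega>" "R 0 n \<omega>", simplified add_diff_cancel_right']]
            show ?thesis .
          qed
        qed (use A in auto)
        finally show "\<bar>A \<omega> - accept n \<omega>\<bar> \<le> exp (- L) * (min 1 \<bar>\<Delta> \<omega>\<bar> + (1 - min 1 (exp (R 0 n \<omega>))))" .
      qed
      also have "\<dots> = exp (- L) * (\<Omega>.expectation (\<lambda>\<omega>. min 1 \<bar>\<Delta> \<omega>\<bar>)
          + \<Omega>.expectation (\<lambda>\<omega>. 1 - min 1 (exp (R 0 n \<omega>))))"
        using int1 int2 by (simp only: integral_mult_right_zero Bochner_Integration.integral_add)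
      finally show ?case by (simp add: \<Delta>_def)
    qed
    show "(\<lambda>n. exp (- L) * (\<Omega>.expectation (\<lambda>\<omega>. min 1 \<bar>\<phi> n (xv n n \<omega>) - \<phi> n (yv n \<omega>)\<bar>)
        + \<Omega>.expectation (\<lambda>\<omega>. 1 - min 1 (exp (R 0 n \<omega>))))) \<longlonglongrightarrow> 0"
      using tendsto_add[OF min_phi_proposal_tendsto one_minus_min_exp_R_tendsto[OF assms]]
      by (intro tendsto_mult_right_zero) simp
  qed
  from tendsto_diff[OF tendsto_const[of 1] this] show ?thesis by simp
qed

text \<open>
  \<open>\<phi> n x\<close> is determined up to a vanishing error by the first \<open>m n\<close> coordinates, while these do not
  contribute to the limit of \<open>R 0 n\<close>. Splitting at \<open>m n\<close> makes the change of measure and the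
  log-ratio asymptotically independent.
\<close>

lemma accept_critical:
  assumes \<gamma>: "\<gamma> = 0"
  shows "(\<lambda>n. \<Omega>.expectation (accept n))
    \<longlonglongrightarrow> 2 * std_normal_cdf (- (l ^ k / 2) * sqrt (K / (1 + 2 * \<kappa> * real k)))" (is "_ \<longlonglongrightarrow> ?T")
proof -
  \<comment> \<open>A cut-off of order \<open>\<epsilon> powr (- 1 / 2)\<close> for the largest step
    \<open>\<epsilon>\<close>: it tends to infinity, yet
    \<open>m n * \<epsilon> ^ j \<le> sqrt \<epsilon>\<close> for all \<open>j \<ge> 1\<close>. This
    is applied with \<open>j = 2 * k\<close> to the omitted variance and with \<open>j = k\<close>
    to the omitted first moments.\<close>
  define m where "m n = min n (nat \<lfloor>1 / sqrt (eps n n)\<rfloor>)" for n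
  have m_le: "m n \<le> n" for n by (simp add: m_def)
  have m_top: "filterlim m at_top sequentially"
    unfolding filterlim_at_top
  proof
    fix Z :: nat
    have "\<forall>\<^sub>F n in sequentially. eps n n < (1 / (real Z + 1))\<^sup>2"
      by (rule eventually_eps_diag_less) simp
    then show "\<forall>\<^sub>F n in sequentially. Z \<le> m n"
      using eventually_ge_at_top[of Z] eventually_ge_at_top[of 1]
    proof eventually_elim
      case (elim n)
      have pos: "sqrt (eps n n) > 0" using elim eps_pos[of n n] by simp
      have "sqrt (eps n n) \<le> sqrt ((1 / (real Z + 1))\<^sup>2)" using elim by (intro real_sqrt_le_mono) simp
      then have "sqrt (eps n n) \<le> 1 / (real Z + 1)" by simp
      then have "real Z + 1 \<le> 1 / sqrt (eps n n)" using pos by (simp add: field_simps)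
      then have "Z \<le> nat \<lfloor>1 / sqrt (eps n n)\<rfloor>" by (intro le_nat_floor) simp
      then show ?case using elim by (simp add: m_def)
    qed
  qed
  have m_small: "(\<lambda>n. real (m n) * eps n n ^ j) \<longlonglongrightarrow> 0" if j: "j \<ge> 1" for j
  proof (rule Lim_null_comparison)
    show "\<forall>\<^sub>F n in sequentially. norm (real (m n) * eps n n ^ j) \<le> sqrt (eps n n)"
      using eventually_eps_diag_less[of 1, simplified] eventually_ge_at_top[of 1]
    proof eventually_elim
      case (elim n)
      then have e: "0 < eps n n" "eps n n < 1" using eps_pos[of n n] by auto
      have "real (m n) \<le> real (nat \<lfloor>1 / sqrt (eps n n)\<rfloor>)" by (simp add: m_def)
      also have "\<dots> \<le> 1 / sqrt (eps n n)" using e by (intro of_nat_floor) simp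
      finally have "real (m n) * eps n n ^ j \<le> (1 / sqrt (eps n n)) * eps n n ^ 1"
        using e j by (intro mult_mono power_decreasing) auto
      also have "\<dots> = sqrt (eps n n)" using e by (simp add: field_simps)
      finally show ?case using e by simp
    qed
    show "(\<lambda>n. sqrt (eps n n)) \<longlonglongrightarrow> 0"
      using tendsto_real_sqrt[OF eps_diag_tendsto] by simp
  qed
  define A where "A m n \<omega> = exp (- \<phi> n (xv m n \<omega>))" for m n \<omega>
  define E1 where "E1 n = \<Omega>.expectation (\<lambda>\<omega>. \<bar>A n n \<omega> - A (m n) n \<omega>\<bar>)" for n
  define E2 where "E2 n = \<Omega>.expectation (\<lambda>\<omega>. min 1 \<bar>\<phi> n (xv n n \<omega>) - \<phi> n (yv n \<omega>)\<bar>)" for n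
  \<comment> \<open>The decoupled expectation: the weight sees only coordinates up to
    \<open>m n\<close>, the log-ratio only those beyond.\<close>
  define Y where "Y n = \<Omega>.expectation (\<lambda>\<omega>. A (m n) n \<omega> * min 1 (exp (R (m n) n \<omega>)))" for n
  have E1_lim: "E1 \<longlonglongrightarrow> 0"
    unfolding E1_def
  proof (rule \<Omega>.bounded_convergence[where c = "2 * exp (- L)"])
    show "\<forall>\<^sub>F n in sequentially. (\<lambda>\<omega>. \<bar>A n n \<omega> - A (m n) n \<omega>\<bar>) \<in> borel_measurable \<Omega>"
      using eventually_ge_at_top[of 1] unfolding A_def by eventually_elim measurable
    show "\<forall>\<^sub>F n in sequentially. \<forall>\<omega>\<in>space \<Omega>. \<bar>\<bar>A n n \<omega> - A (m n) n \<omega>\<bar>\<bar> \<le> 2 * exp (- L)"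
      using exp_phi_bounds
    proof eventually_elim
      case (elim n)
      have "0 \<le> A j n \<omega>" "A j n \<omega> \<le> exp (- L)" for j \<omega> using elim by (auto simp: A_def)
      then show ?case by (smt (verit))
    qed
    show "AE \<omega> in \<Omega>. (\<lambda>n. \<bar>A n n \<omega> - A (m n) n \<omega>\<bar>) \<longlonglongrightarrow> 0"
      using AE_phi_truncation_tendsto[OF m_top m_le]
    proof eventually_elim
      case (elim \<omega>)
      show ?case
      proof (rule Lim_null_comparison)
        show "\<forall>\<^sub>F n in sequentially. norm \<bar>A n n \<omega> - A (m n) n \<omega>\<bar>
            \<le> exp (- L) * \<bar>1 - exp (\<phi> n (xv n n \<omega>) - \<phi> n (xv (m n) n \<omega>))\<bar>"
          using exp_phi_bounds
        proof eventually_elim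
          case (elim n)
          have "A n n \<omega> - A (m n) n \<omega> = A n n \<omega> * (1 - exp (\<phi> n (xv n n \<omega>) - \<phi> n (xv (m n) n \<omega>)))"
            by (simp add: A_def right_diff_distrib flip: exp_add)
          then show ?case using elim by (simp add: abs_mult A_def mult_right_mono)
        qed
        have "(\<lambda>n. exp (- L) * \<bar>1 - exp (\<phi> n (xv n n \<omega>) - \<phi> n (xv (m n) n \<omega>))\<bar>)
            \<longlonglongrightarrow> exp (- L) * \<bar>1 - exp 0\<bar>"
          by (intro tendsto_intros elim)
        then show "(\<lambda>n. exp (- L) * \<bar>1 - exp (\<phi> n (xv n n \<omega>) - \<phi> n (xv (m n) n \<omega>))\<bar>) \<longlonglongrightarrow> 0"
          by simp
      qed
    qed
  qed
  have E2_lim: "E2 \<longlonglongrightarrow> 0" unfolding E2_def by (rule min_phi_proposal_tendsto)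
  \<comment> \<open>Only the full weight is normalized exactly; the truncated one inherits the limit
    1 through the mean truncation error.\<close>
  have expA: "\<forall>\<^sub>F n in sequentially. \<bar>\<Omega>.expectation (A (m n) n) - 1\<bar> \<le> E1 n"
    using exp_phi_bounds eventually_ge_at_top[of 1]
  proof eventually_elim
    case (elim n)
    have int: "integrable \<Omega> (A j n)" for j
      unfolding A_def using elim by (rule_tac integrable_exp_phi)
    have "1 - \<Omega>.expectation (A (m n) n) = \<Omega>.expectation (\<lambda>\<omega>. A n n \<omega> - A (m n) n \<omega>)"
    proof -
      have "\<Omega>.expectation (A n n) = 1" unfolding A_def[abs_def] by (rule phi_norm[OF elim(2)])
      then show ?thesis using int[of n] int[of "m n"] by simp
    qed
    also have "\<bar>\<dots>\<bar> \<le> E1 n" unfolding E1_def by (rule integral_abs_bound)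
    finally show ?case by (simp add: abs_minus_commute)
  qed
  have expA_lim: "(\<lambda>n. \<Omega>.expectation (A (m n) n)) \<longlonglongrightarrow> 1"
    using Lim_null_comparison[of "\<lambda>n. \<Omega>.expectation (A (m n) n) - 1" E1] expA E1_lim
    by (simp add: LIM_zero_iff)
  have Y_lim: "Y \<longlonglongrightarrow> ?T"
  proof (rule Lim_transform_eventually)
    show "(\<lambda>n. \<Omega>.expectation (A (m n) n) * \<Omega>.expectation (\<lambda>\<omega>. min 1 (exp (R (m n) n \<omega>)))) \<longlonglongrightarrow> ?T"
      using tendsto_mult[OF expA_lim expectation_min_exp_R_tendsto[OF \<gamma> m_le m_small]] k_pos by simp
    show "\<forall>\<^sub>F n in sequentially. \<Omega>.expectation (A (m n) n) * \<Omega>.expectation (\<lambda>\<omega>. min 1 (exp (R (m n) n \<omega>))) = Y n"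
      using exp_phi_bounds eventually_ge_at_top[of 1]
    proof eventually_elim
      case (elim n)
      let ?B = "borel :: (real \<times> real) measure"
      \<comment> \<open>Disjoint blocks of independent coordinates are independent as vectors, and
        each factor is a measurable function of its own block.\<close>
      have "\<Omega>.indep_var (PiM {0<..m n} (\<lambda>_. ?B)) (\<lambda>\<omega>. restrict (\<lambda>i. \<omega> i) {0<..m n})
          (PiM {m n<..n} (\<lambda>_. ?B)) (\<lambda>\<omega>. restrict (\<lambda>i. \<omega> i) {m n<..n})"
        by (rule \<Omega>.indep_var_restrict[OF indep_coord]) auto
      moreover have "(\<lambda>\<omega>. exp (- \<phi> n (xv (m n) n \<omega>))) \<in> borel_measurable (PiM {0<..m n} (\<lambda>_. ?B))"
        using measurable_compose[OF xv_measurable_block phi_meas[OF elim(2)]] by measurable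
      moreover have "(\<lambda>\<omega>. min 1 (exp (R (m n) n \<omega>))) \<in> borel_measurable (PiM {m n<..n} (\<lambda>_. ?B))"
      proof -
        have "R (m n) n \<in> borel_measurable (PiM {m n<..n} (\<lambda>_. ?B))"
          unfolding R_def
        proof (rule borel_measurable_sum)
          fix i assume "i \<in> {m n<..n}"
          then show "(\<lambda>\<omega>. r (eps n i) (\<omega> i)) \<in> borel_measurable (PiM {m n<..n} (\<lambda>_. ?B))"
            by (intro measurable_compose[OF _ r_meas] measurable_component_singleton)
        qed
        then show ?thesis by simp
      qed
      ultimately have ind: "\<Omega>.indep_var borel ((\<lambda>\<omega>. exp (- \<phi> n (xv (m n) n \<omega>))) \<circ> (\<lambda>\<omega>. restrict (\<lambda>i. \<omega> i) {0<..m n}))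
          borel ((\<lambda>\<omega>. min 1 (exp (R (m n) n \<omega>))) \<circ> (\<lambda>\<omega>. restrict (\<lambda>i. \<omega> i) {m n<..n}))"
        by (rule \<Omega>.indep_var_compose)
      have xv_restrict: "xv (m n) n (restrict (\<lambda>i. \<omega> i) {0<..m n}) = xv (m n) n \<omega>" for \<omega>
        by (auto simp: xv_def restrict_def fun_eq_iff)
      have R_restrict: "R (m n) n (restrict (\<lambda>i. \<omega> i) {m n<..n}) = R (m n) n \<omega>" for \<omega>
        unfolding R_def by (intro sum.cong) auto
      have ind': "\<Omega>.indep_var borel (A (m n) n) borel (\<lambda>\<omega>. min 1 (exp (R (m n) n \<omega>)))"
        using ind by (simp only: comp_def xv_restrict R_restrict A_def[abs_def])
      have "integrable \<Omega> (A (m n) n)"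
        unfolding A_def using elim by (rule_tac integrable_exp_phi)
      moreover have "integrable \<Omega> (\<lambda>\<omega>. min 1 (exp (R (m n) n \<omega>)))"
        by (intro \<Omega>.integrable_const_bound[where B = 1]) auto
      ultimately show ?case
        unfolding Y_def using \<Omega>.indep_var_lebesgue_integral[OF ind'] by simp
    qed
  qed
  have "(\<lambda>n. \<Omega>.expectation (accept n) - Y n) \<longlonglongrightarrow> 0"
  proof (rule Lim_null_comparison)
    show "\<forall>\<^sub>F n in sequentially. norm (\<Omega>.expectation (accept n) - Y n)
        \<le> E1 n + exp (- L) * (E2 n + 2 * B * (real (m n) * eps n n ^ k))"
      using exp_phi_bounds eventually_ge_at_top[of 1] eventually_eps_diag_less[of 1, simplified]
    proof eventually_elim
      case (elim n)
      note [measurable] = phi_measurable_comp[OF elim(2)]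
      define \<Delta> where "\<Delta> \<omega> = \<phi> n (xv n n \<omega>) - \<phi> n (yv n \<omega>)" for \<omega>
      define Q where "Q \<omega> = (\<Sum>i\<in>{0<..m n}. \<bar>r (eps n i) (\<omega> i)\<bar>)" for \<omega>
      have [measurable]: "A j n \<in> borel_measurable \<Omega>" "\<Delta> \<in> borel_measurable \<Omega>" for j
        unfolding A_def \<Delta>_def by measurable
      have A: "0 \<le> A j n \<omega>" "A j n \<omega> \<le> exp (- L)" for j \<omega> using elim by (auto simp: A_def)
      have intA: "integrable \<Omega> (A j n)" for j unfolding A_def using elim by (rule_tac integrable_exp_phi)
      have eps_i: "0 < eps n i" "eps n i \<le> 1" "eps n i \<le> eps n n" if "i \<in> {0<..m n}" for i
      proof -
        have "1 \<le> i" "i \<le> n" using that m_le[of n] by auto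
        then show "0 < eps n i" "eps n i \<le> 1" "eps n i \<le> eps n n"
          using elim eps_pos[of i n] eps_le[of i n] by auto
      qed
      have int_r: "integrable \<Omega> (\<lambda>\<omega>. \<bar>r (eps n i) (\<omega> i)\<bar>)" if "i \<in> {0<..m n}" for i
        using integrable_r_abs_power[OF eps_i(1,2)[OF that], of 1]
        by (intro integrable_coord[where h = "\<lambda>u. \<bar>r (eps n i) u\<bar>"]) simp
      have intQ: "integrable \<Omega> Q" unfolding Q_def by (rule Bochner_Integration.integrable_sum) (rule int_r)
      have expQ: "\<Omega>.expectation Q \<le> 2 * B * (real (m n) * eps n n ^ k)"
      proof -
        have "\<Omega>.expectation Q = (\<Sum>i\<in>{0<..m n}. \<Omega>.expectation (\<lambda>\<omega>. \<bar>r (eps n i) (\<omega> i)\<bar>))"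
          unfolding Q_def by (rule Bochner_Integration.integral_sum) (rule int_r)
        also have "\<dots> \<le> (\<Sum>i\<in>{0<..m n}. 2 * B * eps n n ^ k)"
        proof (rule sum_mono)
          fix i assume i: "i \<in> {0<..m n}"
          have "\<Omega>.expectation (\<lambda>\<omega>. \<bar>r (eps n i) (\<omega> i)\<bar>) = expectation (\<lambda>u. \<bar>r (eps n i) u\<bar>)"
            by (rule expectation_coord[where h = "\<lambda>u. \<bar>r (eps n i) u\<bar>"]) measurable
          also have "\<dots> \<le> 2 * B * eps n i ^ k" using eps_i[OF i] by (intro r_first_abs_moment)
          also have "\<dots> \<le> 2 * B * eps n n ^ k"
            using eps_i[OF i] B_nonneg by (intro mult_left_mono power_mono) auto
          finally show "\<Omega>.expectation (\<lambda>\<omega>. \<bar>r (eps n i) (\<omega> i)\<bar>) \<le> 2 * B * eps n n ^ k" .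
        qed
        finally show ?thesis by (simp add: mult_ac)
      qed
      have RQ: "\<bar>R 0 n \<omega> - R (m n) n \<omega>\<bar> \<le> Q \<omega>" for \<omega>
      proof -
        have "{0<..n} = {0<..m n} \<union> {m n<..n}" using m_le[of n] by auto
        then have "R 0 n \<omega> = (\<Sum>i\<in>{0<..m n}. r (eps n i) (\<omega> i)) + R (m n) n \<omega>"
          unfolding R_def by (simp add: sum.union_disjoint ivl_disj_int)
        then show ?thesis unfolding Q_def using sum_abs[of "\<lambda>i. r (eps n i) (\<omega> i)" "{0<..m n}"] by simp
      qed
      have acc: "accept n \<omega> = A n n \<omega> * min 1 (exp (\<Delta> \<omega> + R 0 n \<omega>))" for \<omega>
        by (simp add: accept_def A_def \<Delta>_def)
      have int_acc: "integrable \<Omega> (accept n)"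
        unfolding acc using A min_1_exp_bounds
        by (intro Bochner_Integration.integrable_bound[OF intA[of n]]) (auto simp: abs_mult intro!: mult_left_le)
      have int_Y: "integrable \<Omega> (\<lambda>\<omega>. A (m n) n \<omega> * min 1 (exp (R (m n) n \<omega>)))"
        using A min_1_exp_bounds
        by (intro Bochner_Integration.integrable_bound[OF intA[of "m n"]]) (auto simp: abs_mult intro!: mult_left_le)
      have int1: "integrable \<Omega> (\<lambda>\<omega>. min 1 \<bar>\<Delta> \<omega>\<bar>)"
        by (intro \<Omega>.integrable_const_bound[where B = 1]) auto
      have intD: "integrable \<Omega> (\<lambda>\<omega>. \<bar>A n n \<omega> - A (m n) n \<omega>\<bar>)"
        by (rule integrable_abs[OF Bochner_Integration.integrable_diff[OF intA intA]])
      have intS: "integrable \<Omega> (\<lambda>\<omega>. exp (- L) * (min 1 \<bar>\<Delta> \<omega>\<bar> + Q \<omega>))"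
        by (rule integrable_mult_right[OF Bochner_Integration.integrable_add[OF int1 intQ]])
      have "\<Omega>.expectation (accept n) - Y n
          = \<Omega>.expectation (\<lambda>\<omega>. accept n \<omega> - A (m n) n \<omega> * min 1 (exp (R (m n) n \<omega>)))"
        unfolding Y_def using int_acc int_Y by (rule Bochner_Integration.integral_diff[symmetric])
      then have "\<bar>\<Omega>.expectation (accept n) - Y n\<bar> \<le> \<Omega>.expectation (\<lambda>\<omega>. \<bar>accept n \<omega> - A (m n) n \<omega> * min 1 (exp (R (m n) n \<omega>))\<bar>)"
        by (simp only: integral_abs_bound)
      also have "\<dots> \<le> \<Omega>.expectation (\<lambda>\<omega>. \<bar>A n n \<omega> - A (m n) n \<omega>\<bar> + exp (- L) * (min 1 \<bar>\<Delta> \<omega>\<bar> + Q \<omega>))"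
      proof (rule integral_mono)
        show "integrable \<Omega> (\<lambda>\<omega>. \<bar>accept n \<omega> - A (m n) n \<omega> * min 1 (exp (R (m n) n \<omega>))\<bar>)"
          by (rule integrable_abs[OF Bochner_Integration.integrable_diff[OF int_acc int_Y]])
        show "integrable \<Omega> (\<lambda>\<omega>. \<bar>A n n \<omega> - A (m n) n \<omega>\<bar> + exp (- L) * (min 1 \<bar>\<Delta> \<omega>\<bar> + Q \<omega>))"
          by (rule Bochner_Integration.integrable_add[OF intD intS])
        fix \<omega>
        let ?h = "\<lambda>x. min 1 (exp x) :: real"
        \<comment> \<open>The weight and the log-ratio are exchanged one after the other, so that
          every error is multiplied by a bounded factor.\<close>
        have "accept n \<omega> - A (m n) n \<omega> * ?h (R (m n) n \<omega>) =
            (A n n \<omega> - A (m n) n \<omega>) * ?h (\<Delta> \<omega> + R 0 n \<omega>)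
            + A (m n) n \<omega> * (?h (\<Delta> \<omega> + R 0 n \<omega>) - ?h (R (m n) n \<omega>))"
        proof -
          have "x * h - y * h' = (x - y) * h + y * (h - h')" for x y h h' :: real
            by (simp add: algebra_simps)
          then show ?thesis unfolding acc .
        qed
        also have "\<bar>\<dots>\<bar> \<le> \<bar>A n n \<omega> - A (m n) n \<omega>\<bar> * 1 + exp (- L) * (min 1 \<bar>\<Delta> \<omega>\<bar> + Q \<omega>)"
        proof (rule order_trans[OF abs_triangle_ineq add_mono])
          show "\<bar>(A n n \<omega> - A (m n) n \<omega>) * ?h (\<Delta> \<omega> + R 0 n \<omega>)\<bar> \<le> \<bar>A n n \<omega> - A (m n) n \<omega>\<bar> * 1"
            unfolding abs_mult using min_1_exp_bounds by (intro mult_left_mono) auto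
          have "\<bar>?h (\<Delta> \<omega> + R 0 n \<omega>) - ?h (R (m n) n \<omega>)\<bar>
              \<le> \<bar>?h (\<Delta> \<omega> + R 0 n \<omega>) - ?h (R 0 n \<omega>)\<bar> + \<bar>?h (R 0 n \<omega>) - ?h (R (m n) n \<omega>)\<bar>"
            by (rule dist_triangle[of "?h (\<Delta> \<omega> + R 0 n \<omega>)" "?h (R (m n) n \<omega>)" "?h (R 0 n \<omega>)", unfolded dist_real_def])
          also have "\<dots> \<le> min 1 \<bar>\<Delta> \<omega>\<bar> + Q \<omega>"
          proof (rule add_mono)
            show "\<bar>?h (\<Delta> \<omega> + R 0 n \<omega>) - ?h (R 0 n \<omega>)\<bar> \<le> min 1 \<bar>\<Delta> \<omega>\<bar>"
              using min_1_exp_lipschitz[of "\<Delta> \<omega> + R 0 n \<omega>" "R 0 n \<omega>", simplified add_diff_cancel_right'] .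
            show "\<bar>?h (R 0 n \<omega>) - ?h (R (m n) n \<omega>)\<bar> \<le> Q \<omega>"
              by (rule order_trans[OF min_1_exp_lipschitz min.coboundedI2[OF RQ]])
          qed
          finally show "\<bar>A (m n) n \<omega> * (?h (\<Delta> \<omega> + R 0 n \<omega>) - ?h (R (m n) n \<omega>))\<bar>
              \<le> exp (- L) * (min 1 \<bar>\<Delta> \<omega>\<bar> + Q \<omega>)"
            unfolding abs_mult using A by (intro mult_mono) auto
        qed
        finally show "\<bar>accept n \<omega> - A (m n) n \<omega> * ?h (R (m n) n \<omega>)\<bar>
            \<le> \<bar>A n n \<omega> - A (m n) n \<omega>\<bar> + exp (- L) * (min 1 \<bar>\<Delta> \<omega>\<bar> + Q \<omega>)" by simp
      qed
      also have "\<dots> = E1 n + exp (- L) * (E2 n + \<Omega>.expectation Q)"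
        unfolding E1_def E2_def \<Delta>_def[symmetric] using intD intS int1 intQ
        by (simp only: integral_mult_right_zero Bochner_Integration.integral_add)
      also have "\<dots> \<le> E1 n + exp (- L) * (E2 n + 2 * B * (real (m n) * eps n n ^ k))"
        using expQ by (intro add_left_mono mult_left_mono) auto
      finally show ?case by simp
    qed
    have "(\<lambda>n. E1 n + exp (- L) * (E2 n + 2 * B * (real (m n) * eps n n ^ k)))
        \<longlonglongrightarrow> 0 + exp (- L) * (0 + 2 * B * 0)"
      using k_pos by (intro tendsto_intros E1_lim E2_lim m_small)
    then show "(\<lambda>n. E1 n + exp (- L) * (E2 n + 2 * B * (real (m n) * eps n n ^ k))) \<longlonglongrightarrow> 0" by simp
  qed
  from tendsto_add[OF this Y_lim] show ?thesis by simp
qed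

text \<open>Jensen with the summable weights \<open>i powr (2 * a - 2 * \<kappa>)\<close> makes the
  bound independent of \<open>n\<close>. It supplies moments of any even order for the squared norm,
  hence tails below any power of \<open>n\<close>.\<close>

lemma expectation_sum_q_power_le:
  assumes a: "a < \<kappa> - 1 / 2" and j: "even j" "j > 0"
  obtains b where "b \<ge> 0" "\<And>n. integrable \<Omega> (\<lambda>\<omega>. (\<Sum>i=1..n. q a \<omega> i) ^ j)"
    "\<And>n. \<Omega>.expectation (\<lambda>\<omega>. (\<Sum>i=1..n. q a \<omega> i) ^ j) \<le> b"
proof -
  define c where "c i = real i powr (2 * a - 2 * \<kappa>)" for i :: nat
  define w where "w = expectation (\<lambda>u. W u ^ (2 * j))"
  have c: "c i \<ge> 0" for i by (simp add: c_def)
  have w: "w \<ge> 0" unfolding w_def by simp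
  have sum: "summable c" unfolding c_def using a by (subst summable_real_powr_iff) auto
  have Z: "suminf c \<ge> 0" using sum c by (rule suminf_nonneg)
  have intW: "integrable \<Omega> (\<lambda>\<omega>. W (\<omega> i) ^ (2 * j))" for i
    by (rule integrable_coord[where h = "\<lambda>u. W u ^ (2 * j)"]) (rule W_moment)
  have intS: "integrable \<Omega> (\<lambda>\<omega>. \<Sum>i=1..n. c i * W (\<omega> i) ^ (2 * j))" for n
    by (intro Bochner_Integration.integrable_sum integrable_mult_right intW)
  have le: "(\<Sum>i=1..n. q a \<omega> i) ^ j \<le> suminf c ^ (j - 1) * (\<Sum>i=1..n. c i * W (\<omega> i) ^ (2 * j))" for n \<omega>
  proof -
    have "(\<Sum>i=1..n. c i * (W (\<omega> i))\<^sup>2) ^ j \<le> (\<Sum>i=1..n. c i) ^ (j - 1) * (\<Sum>i=1..n. c i * ((W (\<omega> i))\<^sup>2) ^ j)"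
      by (rule power_weighted_sum_le) (use c j in auto)
    also have "\<dots> \<le> suminf c ^ (j - 1) * (\<Sum>i=1..n. c i * ((W (\<omega> i))\<^sup>2) ^ j)"
      using sum c by (intro mult_right_mono power_mono sum_le_suminf sum_nonneg mult_nonneg_nonneg) auto
    finally show ?thesis by (simp add: q_def c_def power_mult)
  qed
  show ?thesis
  proof
    show "0 \<le> suminf c ^ j * w" using Z w by simp
    fix n
    show int: "integrable \<Omega> (\<lambda>\<omega>. (\<Sum>i=1..n. q a \<omega> i) ^ j)"
    proof (rule Bochner_Integration.integrable_bound)
      show "integrable \<Omega> (\<lambda>\<omega>. suminf c ^ (j - 1) * (\<Sum>i=1..n. c i * W (\<omega> i) ^ (2 * j)))"
        by (rule integrable_mult_right) (rule intS)
      have "0 \<le> (\<Sum>i=1..n. q a \<omega> i) ^ j" for \<omega> by (intro zero_le_power sum_nonneg q_nonneg)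
      then show "AE \<omega> in \<Omega>. norm ((\<Sum>i=1..n. q a \<omega> i) ^ j)
          \<le> norm (suminf c ^ (j - 1) * (\<Sum>i=1..n. c i * W (\<omega> i) ^ (2 * j)))"
        using le[of _ n] by (intro AE_I2) (smt (verit) real_norm_def)
    qed measurable
    have "\<Omega>.expectation (\<lambda>\<omega>. (\<Sum>i=1..n. q a \<omega> i) ^ j)
        \<le> \<Omega>.expectation (\<lambda>\<omega>. suminf c ^ (j - 1) * (\<Sum>i=1..n. c i * W (\<omega> i) ^ (2 * j)))"
      using int intS[of n] le by (intro integral_mono integrable_mult_right)
    also have "\<dots> = suminf c ^ (j - 1) * (\<Sum>i=1..n. c i * \<Omega>.expectation (\<lambda>\<omega>. W (\<omega> i) ^ (2 * j)))"
      using intW by (simp add: Bochner_Integration.integral_sum)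
    also have "\<dots> = suminf c ^ (j - 1) * ((\<Sum>i=1..n. c i) * w)"
      unfolding w_def by (subst expectation_coord[where h = "\<lambda>u. W u ^ (2 * j)"]) (simp_all add: sum_distrib_right)
    also have "\<dots> \<le> suminf c ^ (j - 1) * (suminf c * w)"
      using sum c Z w by (intro mult_left_mono mult_right_mono sum_le_suminf) auto
    also have "\<dots> = suminf c ^ j * w"
      using power_minus_mult[OF j(2), of "suminf c"] by (simp only: mult.assoc[symmetric])
    finally show "\<Omega>.expectation (\<lambda>\<omega>. (\<Sum>i=1..n. q a \<omega> i) ^ j) \<le> suminf c ^ j * w" .
  qed
qed

text \<open>The effect of the perturbation must be quantified here. Where the state has moderate
  norm it adds \<open>O(n powr (\<gamma> / 2))\<close> to the exponent, which the affinity decay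
  \<open>exp (- c * n powr \<gamma>)\<close> absorbs; large norms are handled by a Markov bound of
  high order.\<close>

lemma accept_supercritical:
  assumes \<gamma>: "\<gamma> > 0"
  shows "(\<lambda>n. real n powr a * \<Omega>.expectation (accept n)) \<longlonglongrightarrow> 0"
proof -
  \<comment> \<open>With this choice a squared norm of at most \<open>n powr \<beta>\<close> means
    that the \<open>p\<close>-th power of the norm is at most
    \<open>n powr (\<gamma> / 2)\<close>.\<close>
  define \<beta> where "\<beta> = \<gamma> / p"
  have \<beta>: "\<beta> > 0" using \<gamma> p_pos by (simp add: \<beta>_def)
  \<comment> \<open>Even, as Jensen's inequality needs, and large enough for
    \<open>n powr (\<beta> * j)\<close> to dominate the factor \<open>n powr a\<close>.\<close>
  define j where "j = 2 * (nat \<lceil>a / \<beta>\<rceil> + 1)"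
  have j: "even j" "j > 0" by (auto simp: j_def)
  have j_large: "a - \<beta> * real j < 0"
  proof -
    have "a / \<beta> \<le> real (nat \<lceil>a / \<beta>\<rceil>)" by linarith
    then have "a / \<beta> < real j" by (simp add: j_def)
    then show ?thesis using \<beta> by (simp add: field_simps)
  qed
  obtain b where b: "b \<ge> 0" "\<And>n. integrable \<Omega> (\<lambda>\<omega>. (\<Sum>i=1..n. q s'' \<omega> i) ^ j)"
    "\<And>n. \<Omega>.expectation (\<lambda>\<omega>. (\<Sum>i=1..n. q s'' \<omega> i) ^ j) \<le> b"
    using expectation_sum_q_power_le[OF exponents(3) j] by metis
  obtain c where c: "c > 0" and decay: "\<forall>\<^sub>F n in sequentially.
      \<Omega>.expectation (\<lambda>\<omega>. exp (R 0 n \<omega> / 2)) \<le> exp (- c * real n powr \<gamma>)"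
    by (rule expectation_exp_half_R_decay)
  \<comment> \<open>Half of the largest possible value of \<open>\<phi> n x - \<phi> n y\<close> at
    a state of moderate norm: growth bound at the state, lower bound \<open>L\<close> at the
    proposal.\<close>
  define G where "G n = (D * (1 + real n powr (\<gamma> / 2)) - L) / 2" for n :: nat
  define U where "U n = real n powr a * (exp (- L) * (exp (G n) * exp (- c * real n powr \<gamma>) + b / real n powr (\<beta> * real j)))" for n
  have "\<forall>\<^sub>F n in sequentially. norm (real n powr a * \<Omega>.expectation (accept n)) \<le> U n"
    using decay phi_lower phi_growth eventually_ge_at_top[of 1]
  proof eventually_elim
    case (elim n)
    note [measurable] = phi_measurable_comp[OF elim(4)]
    define A where "A \<omega> = exp (- \<phi> n (xv n n \<omega>))" for \<omega>
    define \<Delta> where "\<Delta> \<omega> = \<phi> n (xv n n \<omega>) - \<phi> n (yv n \<omega>)" for \<omega>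
    define Q where "Q \<omega> = (\<Sum>i=1..n. q s'' \<omega> i)" for \<omega>
    have [measurable]: "A \<in> borel_measurable \<Omega>" "\<Delta> \<in> borel_measurable \<Omega>"
      unfolding A_def \<Delta>_def by measurable
    have A: "0 \<le> A \<omega>" "A \<omega> \<le> exp (- L)" for \<omega> using elim by (auto simp: A_def)
    have acc: "accept n \<omega> = A \<omega> * min 1 (exp (\<Delta> \<omega> + R 0 n \<omega>))" for \<omega>
      by (simp add: accept_def A_def \<Delta>_def)
    have Q0: "Q \<omega> \<ge> 0" for \<omega> unfolding Q_def by (intro sum_nonneg q_nonneg)
    have npos: "real n > 0" using elim by simp
    \<comment> \<open>The first term comes from \<open>min 1 (exp u) \<le> exp (u / 2)\<close> and
      is effective for moderate norm; the second exceeds 1 otherwise and has the form of a Markov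
      bound.\<close>
    have le: "min 1 (exp (\<Delta> \<omega> + R 0 n \<omega>)) \<le> exp (G n) * exp (R 0 n \<omega> / 2) + Q \<omega> ^ j / real n powr (\<beta> * real j)" for \<omega>
    proof (cases "Q \<omega> \<le> real n powr \<beta>")
      case True
      have "wnorm n s'' (xv n n \<omega>) \<le> 1 * sqrt (\<Sum>i\<in>{1..n}. q s'' \<omega> i)"
        by (rule wnorm_le[OF order_refl]) (rule zero_le_one, erule xv_le, simp)
      then have "wnorm n s'' (xv n n \<omega>) powr p \<le> sqrt (Q \<omega>) powr p"
        using wnorm_nonneg p_pos by (intro powr_mono2) (auto simp: Q_def)
      also have "\<dots> \<le> sqrt (real n powr \<beta>) powr p"
        using True Q0 p_pos by (intro powr_mono2) auto
      also have "\<dots> = real n powr (\<gamma> / 2)"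
        using npos p_pos by (simp add: \<beta>_def powr_half_sqrt[symmetric] powr_powr)
      finally have "D * (1 + wnorm n s'' (xv n n \<omega>) powr p) \<le> D * (1 + real n powr (\<gamma> / 2))"
        using D_pos by (intro mult_left_mono) auto
      moreover have "\<bar>\<phi> n (xv n n \<omega>)\<bar> \<le> D * (1 + wnorm n s'' (xv n n \<omega>) powr p)" "L \<le> \<phi> n (yv n \<omega>)"
        using elim by auto
      ultimately have "\<Delta> \<omega> \<le> 2 * G n" unfolding \<Delta>_def G_def by simp
      then have "exp ((\<Delta> \<omega> + R 0 n \<omega>) / 2) \<le> exp (G n + R 0 n \<omega> / 2)" by simp
      moreover have "min 1 (exp x) \<le> exp (x / 2)" for x :: real
        by (cases "x \<ge> 0") auto
      moreover have "0 \<le> Q \<omega> ^ j / real n powr (\<beta> * real j)" using Q0 by simp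
      ultimately show ?thesis unfolding exp_add[symmetric] by (smt (verit))
    next
      case False
      then have "(real n powr \<beta>) ^ j \<le> Q \<omega> ^ j" by (intro power_mono) auto
      moreover have "(real n powr \<beta>) ^ j = real n powr (\<beta> * real j)"
        using npos by (simp add: powr_powr flip: powr_realpow)
      ultimately have "1 \<le> Q \<omega> ^ j / real n powr (\<beta> * real j)" using npos by (simp add: field_simps)
      moreover have "0 \<le> exp (G n) * exp (R 0 n \<omega> / 2)" by simp
      ultimately show ?thesis by linarith
    qed
    have intR: "integrable \<Omega> (\<lambda>\<omega>. exp (R 0 n \<omega> / 2))" by (rule expectation_exp_half_R)
    have intQ: "integrable \<Omega> (\<lambda>\<omega>. Q \<omega> ^ j)" unfolding Q_def by (rule b)
    have int_acc: "integrable \<Omega> (accept n)"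
      unfolding acc using A
      by (intro \<Omega>.integrable_const_bound[where B = "exp (- L)"]) (auto simp: abs_mult intro!: AE_I2 order_trans[OF mult_left_le])
    have "\<Omega>.expectation (accept n) \<le> \<Omega>.expectation (\<lambda>\<omega>. exp (- L) * (exp (G n) * exp (R 0 n \<omega> / 2) + Q \<omega> ^ j / real n powr (\<beta> * real j)))"
    proof (rule integral_mono[OF int_acc])
      show "integrable \<Omega> (\<lambda>\<omega>. exp (- L) * (exp (G n) * exp (R 0 n \<omega> / 2) + Q \<omega> ^ j / real n powr (\<beta> * real j)))"
        using intR intQ by (intro integrable_mult_right Bochner_Integration.integrable_add integrable_divide)
      show "accept n \<omega> \<le> exp (- L) * (exp (G n) * exp (R 0 n \<omega> / 2) + Q \<omega> ^ j / real n powr (\<beta> * real j))" for \<omega>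
        unfolding acc using le A by (intro mult_mono) auto
    qed
    also have "\<dots> = exp (- L) * (exp (G n) * \<Omega>.expectation (\<lambda>\<omega>. exp (R 0 n \<omega> / 2)) + \<Omega>.expectation (\<lambda>\<omega>. Q \<omega> ^ j) / real n powr (\<beta> * real j))"
      using intR intQ by simp
    also have "\<dots> \<le> exp (- L) * (exp (G n) * exp (- c * real n powr \<gamma>) + b / real n powr (\<beta> * real j))"
      using elim(1) b(3)[of n] by (intro mult_left_mono add_mono divide_right_mono) (auto simp: Q_def)
    finally have "real n powr a * \<Omega>.expectation (accept n) \<le> U n"
      unfolding U_def by (intro mult_left_mono) auto
    moreover have "0 \<le> \<Omega>.expectation (accept n)"
      unfolding acc using A by (intro integral_nonneg_AE AE_I2) auto
    ultimately show ?case by simp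
  qed
  moreover have "U \<longlonglongrightarrow> 0"
  proof -
    have "filterlim (\<lambda>n. real n powr (\<gamma> / 2)) at_top sequentially"
    proof (subst filterlim_cong[OF refl refl])
      show "\<forall>\<^sub>F n in sequentially. real n powr (\<gamma> / 2) = exp (\<gamma> / 2 * ln (real n))"
        using eventually_ge_at_top[of 1] by eventually_elim (simp add: powr_def)
      show "filterlim (\<lambda>n. exp (\<gamma> / 2 * ln (real n))) at_top sequentially"
        using \<gamma> by (intro filterlim_compose[OF exp_at_top] filterlim_tendsto_pos_mult_at_top[OF tendsto_const]
            filterlim_compose[OF ln_at_top filterlim_real_sequentially]) simp
    qed
    \<comment> \<open>Substitution \<open>t = n powr (\<gamma> / 2)\<close>: then
      \<open>n powr a = t powr (2 * a / \<gamma>)\<close>,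
      \<open>n powr \<gamma> = t\<^sup>2\<close>, and \<open>G n\<close> is affine in
      \<open>t\<close>.\<close>
    from filterlim_compose[OF powr_times_exp_quadratic_tendsto[OF c, of "2 * a / \<gamma>" "D / 2" "(D - L) / 2"] this]
    have 1: "(\<lambda>n. (real n powr (\<gamma> / 2)) powr (2 * a / \<gamma>) *
        exp (D / 2 * real n powr (\<gamma> / 2) + (D - L) / 2 - c * (real n powr (\<gamma> / 2))\<^sup>2)) \<longlonglongrightarrow> 0" .
    have 2: "(\<lambda>n. real n powr (a - \<beta> * real j)) \<longlonglongrightarrow> 0"
      using j_large by (intro tendsto_neg_powr filterlim_real_sequentially)
    have "(\<lambda>n. exp (- L) * ((real n powr (\<gamma> / 2)) powr (2 * a / \<gamma>) *
        exp (D / 2 * real n powr (\<gamma> / 2) + (D - L) / 2 - c * (real n powr (\<gamma> / 2))\<^sup>2)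
        + b * real n powr (a - \<beta> * real j))) \<longlonglongrightarrow> exp (- L) * (0 + b * 0)"
      by (intro tendsto_intros 1 2)
    moreover have "\<forall>\<^sub>F n in sequentially. exp (- L) * ((real n powr (\<gamma> / 2)) powr (2 * a / \<gamma>) *
        exp (D / 2 * real n powr (\<gamma> / 2) + (D - L) / 2 - c * (real n powr (\<gamma> / 2))\<^sup>2)
        + b * real n powr (a - \<beta> * real j)) = U n"
      using eventually_ge_at_top[of 1]
    proof eventually_elim
      case (elim n)
      have "(real n powr (\<gamma> / 2)) powr (2 * a / \<gamma>) = real n powr a" using \<gamma> by (simp add: powr_powr)
      moreover have "exp (D / 2 * real n powr (\<gamma> / 2) + (D - L) / 2 - c * (real n powr (\<gamma> / 2))\<^sup>2) = exp (G n) * exp (- c * real n powr \<gamma>)"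
      proof -
        have sq: "(real n powr (\<gamma> / 2))\<^sup>2 = real n powr \<gamma>" by (simp add: power2_eq_square flip: powr_add)
        show ?thesis unfolding exp_add[symmetric] sq by (simp add: G_def algebra_simps add_divide_distrib diff_divide_distrib)
      qed
      moreover have "b * real n powr (a - \<beta> * real j) = real n powr a * (b / real n powr (\<beta> * real j))"
        using elim by (simp add: powr_diff)
      ultimately show ?case unfolding U_def by (simp only: distrib_left mult_ac)
    qed
    ultimately have "U \<longlonglongrightarrow> exp (- L) * (0 + b * 0)" by (rule Lim_transform_eventually)
    then show ?thesis by simp
  qed
  ultimately show ?thesis by (rule Lim_null_comparison)
qed

end

section \<open>Smooth densities\<close>

text \<open>No pointwise decay of \<open>h\<close> is presupposed. The integral is the limit of
  \<open>h t - h (- t)\<close>; were it nonzero,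
  \<open>\<bar>h x\<bar> + \<bar>h (- x)\<bar>\<close> would stay away from 0 for large
  \<open>x\<close>, against integrability.\<close>

lemma integral_derivative_eq_0:
  fixes h h' :: "real \<Rightarrow> real"
  assumes deriv: "\<And>x. (h has_real_derivative h' x) (at x)"
    and cont: "continuous_on UNIV h'"
    and h: "integrable lborel h" and h': "integrable lborel h'"
  shows "(\<integral>x. h' x \<partial>lborel) = 0"
proof (rule ccontr)
  define I where "I = (\<integral>x. h' x \<partial>lborel)"
  assume "(\<integral>x. h' x \<partial>lborel) \<noteq> 0"
  then have I: "\<bar>I\<bar> > 0" by (simp add: I_def)
  have "((\<lambda>t. \<integral>x. indicator {- t..t} x * h' x \<partial>lborel) \<longlongrightarrow> I) at_top"
    unfolding I_def
  proof (rule integral_dominated_convergence_at_top[where w = "\<lambda>x. \<bar>h' x\<bar>"])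
    show "AE x in lborel. ((\<lambda>t. indicator {- t..t} x * h' x) \<longlongrightarrow> h' x) at_top"
    proof (intro AE_I2 tendsto_eventually)
      fix x :: real
      show "\<forall>\<^sub>F t in at_top. indicator {- t..t} x * h' x = h' x"
        using eventually_ge_at_top[of "\<bar>x\<bar>"] by eventually_elim (auto simp: indicator_def)
    qed
    show "\<forall>\<^sub>F t in at_top. AE x in lborel. norm (indicator {- t..t} x * h' x) \<le> \<bar>h' x\<bar>"
      by (intro always_eventually allI AE_I2) (auto simp: indicator_def)
  qed (use h' in auto)
  moreover have "\<forall>\<^sub>F t in at_top. (\<integral>x. indicator {- t..t} x * h' x \<partial>lborel) = h t - h (- t)"
    using eventually_ge_at_top[of 0]
  proof eventually_elim
    case (elim t)
    have "(\<integral>x. indicator {- t..t} x *\<^sub>R h' x \<partial>lborel) = h t - h (- t)"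
    proof (rule integral_FTC_atLeastAtMost)
      show "(h has_vector_derivative h' x) (at x within {- t..t})" for x
        using deriv[of x] by (simp add: has_real_derivative_iff_has_vector_derivative has_vector_derivative_at_within)
      show "continuous_on {- t..t} h'" using cont continuous_on_subset by blast
    qed (use elim in simp)
    then show ?case by simp
  qed
  ultimately have "((\<lambda>t. h t - h (- t)) \<longlongrightarrow> I) at_top"
    by (rule Lim_transform_eventually)
  then have "((\<lambda>t. \<bar>h t - h (- t)\<bar>) \<longlongrightarrow> \<bar>I\<bar>) at_top" by (rule tendsto_rabs)
  then have "\<forall>\<^sub>F t in at_top. \<bar>I\<bar> / 2 < \<bar>h t - h (- t)\<bar>"
    by (rule order_tendstoD) (use I in simp)
  then obtain t0 where t0: "\<And>t. t \<ge> t0 \<Longrightarrow> \<bar>I\<bar> / 2 < \<bar>h t - h (- t)\<bar>"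
    by (auto simp: eventually_at_top_linorder)
  define J where "J = (\<integral>x. \<bar>h x\<bar> + \<bar>h (- x)\<bar> \<partial>lborel)"
  have "integrable lborel (\<lambda>x. h (0 + - 1 * x))"
    by (rule lborel_integrable_real_affine[OF h]) simp
  then have int: "integrable lborel (\<lambda>x. \<bar>h x\<bar> + \<bar>h (- x)\<bar>)" using h by simp
  have J: "J \<ge> 0" unfolding J_def by simp
  \<comment> \<open>An interval of this length contributes
    \<open>\<bar>I\<bar> / 2 * T = J + 1\<close>, more than the total integral
    \<open>J\<close>.\<close>
  define T where "T = 2 * (J + 1) / \<bar>I\<bar>"
  have T: "T \<ge> 0" using J I by (simp add: T_def)
  have "(\<integral>x. \<bar>I\<bar> / 2 * indicator {t0..t0 + T} x \<partial>lborel) \<le> J"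
    unfolding J_def
  proof (rule integral_mono[OF _ int])
    show "integrable lborel (\<lambda>x. \<bar>I\<bar> / 2 * indicator {t0..t0 + T} x)"
      by (intro integrable_mult_right integrable_real_indicator) (auto simp: emeasure_lborel_Icc_eq)
    fix x
    show "\<bar>I\<bar> / 2 * indicator {t0..t0 + T} x \<le> \<bar>h x\<bar> + \<bar>h (- x)\<bar>"
    proof (cases "x \<in> {t0..t0 + T}")
      case True
      then have "\<bar>I\<bar> / 2 < \<bar>h x - h (- x)\<bar>" by (intro t0) simp
      also have "\<dots> \<le> \<bar>h x\<bar> + \<bar>h (- x)\<bar>" by (rule abs_triangle_ineq4)
      finally show ?thesis using True by simp
    qed simp
  qed
  then have "\<bar>I\<bar> / 2 * T \<le> J" using T by simp
  then show False using I by (simp add: T_def)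
qed

section \<open>Functions of polynomial growth\<close>

definition poly_growth :: "(real \<Rightarrow> real) \<Rightarrow> bool" where
  "poly_growth h \<longleftrightarrow> (\<exists>A N. \<forall>x. \<bar>h x\<bar> \<le> A * (1 + \<bar>x\<bar>) ^ N)"

lemma poly_growthI: "(\<And>x. \<bar>h x\<bar> \<le> A * (1 + \<bar>x\<bar>) ^ N) \<Longrightarrow> poly_growth h"
  by (auto simp: poly_growth_def)

lemma poly_growth_nonneg_const:
  assumes "poly_growth h"
  obtains A N where "A \<ge> 0" "\<And>x. \<bar>h x\<bar> \<le> A * (1 + \<bar>x\<bar>) ^ N"
proof -
  obtain A N where A: "\<And>x. \<bar>h x\<bar> \<le> A * (1 + \<bar>x\<bar>) ^ N" using assms by (auto simp: poly_growth_def)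
  have "0 \<le> A" using A[of 0] by simp
  then show ?thesis using A that by blast
qed

lemma poly_growth_const: "poly_growth (\<lambda>_. c)"
  by (rule poly_growthI[where A = "\<bar>c\<bar>" and N = 0]) simp

lemma poly_growth_ident: "poly_growth (\<lambda>x. x)"
  by (rule poly_growthI[where A = 1 and N = 1]) simp

lemma poly_growth_mult:
  assumes "poly_growth h1" "poly_growth h2"
  shows "poly_growth (\<lambda>x. h1 x * h2 x)"
proof -
  obtain A1 N1 where 1: "A1 \<ge> 0" "\<And>x. \<bar>h1 x\<bar> \<le> A1 * (1 + \<bar>x\<bar>) ^ N1"
    using poly_growth_nonneg_const[OF assms(1)] by blast
  obtain A2 N2 where 2: "A2 \<ge> 0" "\<And>x. \<bar>h2 x\<bar> \<le> A2 * (1 + \<bar>x\<bar>) ^ N2"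
    using poly_growth_nonneg_const[OF assms(2)] by blast
  show ?thesis
  proof (rule poly_growthI[where A = "A1 * A2" and N = "N1 + N2"])
    fix x
    have "\<bar>h1 x * h2 x\<bar> \<le> (A1 * (1 + \<bar>x\<bar>) ^ N1) * (A2 * (1 + \<bar>x\<bar>) ^ N2)"
      unfolding abs_mult using 1 2 by (intro mult_mono) auto
    then show "\<bar>h1 x * h2 x\<bar> \<le> A1 * A2 * (1 + \<bar>x\<bar>) ^ (N1 + N2)" by (simp add: power_add mult_ac)
  qed
qed

lemma poly_growth_add:
  assumes "poly_growth h1" "poly_growth h2"
  shows "poly_growth (\<lambda>x. h1 x + h2 x)"
proof -
  obtain A1 N1 where 1: "A1 \<ge> 0" "\<And>x. \<bar>h1 x\<bar> \<le> A1 * (1 + \<bar>x\<bar>) ^ N1"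
    using poly_growth_nonneg_const[OF assms(1)] by blast
  obtain A2 N2 where 2: "A2 \<ge> 0" "\<And>x. \<bar>h2 x\<bar> \<le> A2 * (1 + \<bar>x\<bar>) ^ N2"
    using poly_growth_nonneg_const[OF assms(2)] by blast
  show ?thesis
  proof (rule poly_growthI[where A = "A1 + A2" and N = "N1 + N2"])
    fix x :: real
    have "A1 * (1 + \<bar>x\<bar>) ^ N1 \<le> A1 * (1 + \<bar>x\<bar>) ^ (N1 + N2)"
      using 1 by (intro mult_left_mono power_increasing) auto
    moreover have "A2 * (1 + \<bar>x\<bar>) ^ N2 \<le> A2 * (1 + \<bar>x\<bar>) ^ (N1 + N2)"
      using 2 by (intro mult_left_mono power_increasing) auto
    ultimately show "\<bar>h1 x + h2 x\<bar> \<le> (A1 + A2) * (1 + \<bar>x\<bar>) ^ (N1 + N2)"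
      unfolding distrib_right using 1(2)[of x] 2(2)[of x] by linarith
  qed
qed

lemma poly_growth_power: "poly_growth h \<Longrightarrow> poly_growth (\<lambda>x. h x ^ n)"
  by (induction n) (auto intro: poly_growth_const poly_growth_mult)

lemma poly_growth_poly: "poly_growth (poly P)"
  by (induction P) (auto intro!: poly_growth_const poly_growth_add poly_growth_mult poly_growth_ident)

text \<open>The moment hypothesis concerns \<open>x ^ k\<close> without absolute values, so
  \<open>1 + \<bar>x\<bar>\<close> is dominated by the genuine polynomial
  \<open>2 + x\<^sup>2\<close>.\<close>

lemma integrable_one_plus_abs_power:
  fixes M :: "real measure"
  assumes [measurable_cong]: "sets M = sets borel" and mom: "\<And>k::nat. integrable M (\<lambda>x. x ^ k)"
  shows "integrable M (\<lambda>x. (1 + \<bar>x\<bar>) ^ N)"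
proof (rule Bochner_Integration.integrable_bound)
  show "integrable M (poly ([:2, 0, 1:] ^ N))"
    unfolding poly_altdef[abs_def] using mom by (intro Bochner_Integration.integrable_sum integrable_mult_right)
  have "1 + \<bar>x\<bar> \<le> poly [:2, 0, 1:] x" for x :: real
  proof -
    have "0 \<le> (\<bar>x\<bar> - 1)\<^sup>2" by simp
    then have "2 * \<bar>x\<bar> \<le> x\<^sup>2 + 1" by (simp add: power2_diff)
    then show ?thesis by (simp add: power2_eq_square)
  qed
  then show "AE x in M. norm ((1 + \<bar>x\<bar>) ^ N) \<le> norm (poly ([:2, 0, 1:] ^ N) x)"
    by (intro AE_I2) (simp only: poly_power real_norm_def power_abs, intro power_mono, auto intro: order_trans abs_ge_self)
qed measurable

lemma integrable_poly_growth:
  fixes M :: "real measure"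
  assumes M: "sets M = sets borel" "\<And>k::nat. integrable M (\<lambda>x. x ^ k)"
    and h: "h \<in> borel_measurable borel" "poly_growth h"
  shows "integrable M h"
proof -
  obtain A N where A: "A \<ge> 0" "\<And>x. \<bar>h x\<bar> \<le> A * (1 + \<bar>x\<bar>) ^ N"
    using poly_growth_nonneg_const[OF h(2)] by blast
  show ?thesis
  proof (rule Bochner_Integration.integrable_bound)
    show "integrable M (\<lambda>x. A * (1 + \<bar>x\<bar>) ^ N)"
      by (intro integrable_mult_right integrable_one_plus_abs_power M)
    show "AE x in M. norm (h x) \<le> norm (A * (1 + \<bar>x\<bar>) ^ N)" using A by auto
    show "h \<in> borel_measurable M" using h(1) by (simp add: measurable_cong_sets[OF M(1) refl])
  qed
qed

lemma (in pair_sigma_finite) integrable_product_mult: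
  fixes a :: "'a \<Rightarrow> real" and b :: "'b \<Rightarrow> real"
  assumes a: "integrable M1 a" and b: "integrable M2 b"
  shows "integrable (M1 \<Otimes>\<^sub>M M2) (\<lambda>u. a (fst u) * b (snd u))"
    and "(\<integral>u. a (fst u) * b (snd u) \<partial>(M1 \<Otimes>\<^sub>M M2)) = (\<integral>x. a x \<partial>M1) * (\<integral>z. b z \<partial>M2)"
proof -
  have [measurable]: "a \<in> borel_measurable M1" "b \<in> borel_measurable M2" using a b by auto
  show int: "integrable (M1 \<Otimes>\<^sub>M M2) (\<lambda>u. a (fst u) * b (snd u))"
    by (rule Fubini_integrable) (use a b in \<open>auto simp: abs_mult\<close>)
  show "(\<integral>u. a (fst u) * b (snd u) \<partial>(M1 \<Otimes>\<^sub>M M2)) = (\<integral>x. a x \<partial>M1) * (\<integral>z. b z \<partial>M2)"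
    unfolding integral_fst'[OF int, symmetric] using a b by simp
qed

section \<open>Integration by parts against the density\<close>

locale smooth_density =
  fixes f g :: "real \<Rightarrow> real"
  assumes f_def: "\<And>x. f x = exp (- g x)"
    and f_prob: "prob_space (density lborel (\<lambda>x. ennreal (f x)))"
    and g_smooth: "\<And>k x. (deriv ^^ k) g differentiable (at x)"
    and g_poly: "\<And>k. \<exists>P :: real poly. \<forall>x. \<bar>(deriv ^^ k) g x\<bar> \<le> poly P x"
    and f_moments: "\<And>k::nat. integrable (density lborel (\<lambda>x. ennreal (f x))) (\<lambda>x. x ^ k)"
begin

definition F :: "real measure" where "F = density lborel (\<lambda>x. ennreal (f x))"

definition d :: "nat \<Rightarrow> real \<Rightarrow> real" where "d k = (deriv ^^ k) g"

lemma d_0: "d 0 = g" by (simp add: d_def)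

lemma d_deriv [derivative_intros]: "(d k has_real_derivative d (Suc k) x) (at x)"
  using g_smooth[of k x] by (simp add: d_def DERIV_deriv_iff_real_differentiable)

lemma d_continuous: "continuous_on S (d k)"
  using d_deriv by (intro continuous_at_imp_continuous_on ballI DERIV_isCont)

lemma d_measurable [measurable]: "d k \<in> borel_measurable borel"
  by (intro borel_measurable_continuous_onI d_continuous)

lemma g_measurable [measurable]: "g \<in> borel_measurable borel"
  using d_measurable[of 0] by (simp add: d_0)

lemma f_measurable [measurable]: "f \<in> borel_measurable borel"
  unfolding f_def[abs_def] by measurable

lemma f_pos: "f x > 0" by (simp add: f_def)

lemma d_poly_growth: "poly_growth (d k)"
proof -
  obtain P :: "real poly" where P: "\<And>x. \<bar>d k x\<bar> \<le> poly P x" using g_poly[of k] by (auto simp: d_def)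
  obtain A N where "\<And>x. \<bar>poly P x\<bar> \<le> A * (1 + \<bar>x\<bar>) ^ N"
    using poly_growth_poly[of P] by (auto simp: poly_growth_def)
  then show ?thesis using P by (intro poly_growthI[of _ A N]) (meson abs_ge_self order_trans)
qed

sublocale F: prob_space F
  unfolding F_def by (rule f_prob)

lemma sets_F [measurable_cong]: "sets F = sets borel"
  by (simp add: F_def)

lemma integrable_F:
  assumes "h \<in> borel_measurable borel" "poly_growth h"
  shows "integrable F h"
  by (rule integrable_poly_growth[OF sets_F _ assms]) (simp add: F_def f_moments)

text \<open>Stein's identity for \<open>exp (- g)\<close>: the derivative of \<open>f * h\<close> is
  \<open>f * h' - f * h * g'\<close>, and its integral vanishes.\<close>

lemma integration_by_parts:
  assumes deriv: "\<And>x. (h has_real_derivative h' x) (at x)" and cont: "continuous_on UNIV h'"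
    and growth: "poly_growth h" "poly_growth h'"
  shows "(\<integral>x. h x * d 1 x \<partial>F) = (\<integral>x. h' x \<partial>F)"
proof -
  have "continuous_on UNIV h" using deriv by (intro continuous_at_imp_continuous_on ballI DERIV_isCont)
  then have [measurable]: "h \<in> borel_measurable borel" "h' \<in> borel_measurable borel"
    using cont by (auto intro: borel_measurable_continuous_onI)
  have int: "integrable lborel (\<lambda>x. f x * u x)" if [measurable]: "u \<in> borel_measurable borel" and "poly_growth u" for u
    using integrable_F[OF that] less_imp_le[OF f_pos] by (simp add: F_def integrable_density)
  have lint: "(\<integral>x. u x \<partial>F) = (\<integral>x. f x * u x \<partial>lborel)" if [measurable]: "u \<in> borel_measurable borel" for u
    using less_imp_le[OF f_pos] by (simp add: F_def integral_density)
  have g': "(g has_real_derivative d 1 x) (at x)" for x using d_deriv[of 0 x] by (simp add: d_0)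
  have i1: "integrable lborel (\<lambda>x. f x * h' x)" and i2: "integrable lborel (\<lambda>x. f x * (h x * d 1 x))"
    by (rule int; (measurable; fail)?; intro growth poly_growth_mult d_poly_growth)+
  have "(\<integral>x. f x * h' x - f x * (h x * d 1 x) \<partial>lborel) = 0"
  proof (rule integral_derivative_eq_0[where h = "\<lambda>x. f x * h x"])
    show "((\<lambda>x. f x * h x) has_real_derivative f x * h' x - f x * (h x * d 1 x)) (at x)" for x
      unfolding f_def[abs_def] by (auto intro!: derivative_eq_intros g' deriv simp: algebra_simps)
    show "continuous_on UNIV (\<lambda>x. f x * h' x - f x * (h x * d 1 x))"
      unfolding f_def[abs_def] using d_continuous[of UNIV 0] \<open>continuous_on UNIV h\<close>
      by (intro continuous_intros cont d_continuous) (auto simp: d_0)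
    show "integrable lborel (\<lambda>x. f x * h x)" by (rule int) (use growth in auto)
    show "integrable lborel (\<lambda>x. f x * h' x - f x * (h x * d 1 x))" using i1 i2 by (rule Bochner_Integration.integrable_diff)
  qed
  then show ?thesis using i1 i2 by (simp add: lint)
qed

text \<open>Stein's identity with \<open>h x = x\<close>. It shows that \<open>g'\<close> is not
  almost surely 0, from which the positivity of \<open>K_RWM\<close> follows.\<close>

lemma expectation_ident_g': "(\<integral>x. x * d 1 x \<partial>F) = 1"
proof -
  have "(\<integral>x. x * d 1 x \<partial>F) = (\<integral>x. 1 \<partial>F)"
    by (rule integration_by_parts) (auto intro!: poly_growth_ident poly_growth_const)
  then show ?thesis by (simp add: F.prob_space)
qed

lemma not_AE_g'_eq_0: "\<not> (AE x in F. d 1 x = 0)"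
proof
  assume "AE x in F. d 1 x = 0"
  then have "(\<integral>x. x * d 1 x \<partial>F) = (\<integral>x. 0 \<partial>F)" by (intro integral_cong_AE) auto
  then show False using expectation_ident_g' by simp
qed

lemma expectation_g'_square_pos: "(\<integral>x. (d 1 x)\<^sup>2 \<partial>F) > 0"
proof -
  have int: "integrable F (\<lambda>x. (d 1 x)\<^sup>2)"
    by (intro integrable_F poly_growth_power d_poly_growth) measurable
  have "(\<integral>x. (d 1 x)\<^sup>2 \<partial>F) \<noteq> 0"
    using not_AE_g'_eq_0 integral_nonneg_eq_0_iff_AE[OF int] by auto
  moreover have "(\<integral>x. (d 1 x)\<^sup>2 \<partial>F) \<ge> 0" by simp
  ultimately show ?thesis by (metis order_le_less)
qed

text \<open>Stein's identity with \<open>h = g' * g''\<^sup>2\<close>. It is the origin of the cube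
  of \<open>g''\<close> in \<open>K_SLA\<close>.\<close>

lemma expectation_g'_g''_square:
  "(\<integral>x. (d 1 x * d 2 x)\<^sup>2 \<partial>F) = (\<integral>x. d 2 x ^ 3 + 2 * (d 1 x * d 2 x * d 3 x) \<partial>F)"
proof -
  have "(\<integral>x. (d 1 x * (d 2 x)\<^sup>2) * d 1 x \<partial>F) = (\<integral>x. d 2 x ^ 3 + 2 * (d 1 x * d 2 x * d 3 x) \<partial>F)"
  proof (rule integration_by_parts)
    show "((\<lambda>x. d 1 x * (d 2 x)\<^sup>2) has_real_derivative d 2 x ^ 3 + 2 * (d 1 x * d 2 x * d 3 x)) (at x)" for x
      using d_deriv[of 1 x] d_deriv[of 2 x]
      by (auto intro!: derivative_eq_intros simp: power2_eq_square power3_eq_cube eval_nat_numeral algebra_simps)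
    show "continuous_on UNIV (\<lambda>x. d 2 x ^ 3 + 2 * (d 1 x * d 2 x * d 3 x))"
      by (intro continuous_intros d_continuous)
  qed (intro poly_growth_mult poly_growth_add poly_growth_power poly_growth_const d_poly_growth)+
  then show ?thesis by (simp add: power2_eq_square algebra_simps)
qed

text \<open>Stein's identity with \<open>h = g' ^ 3\<close> equates the fourth moment of
  \<open>g'\<close> with three times the expectation of \<open>g'\<^sup>2 * g''\<close>; if
  \<open>g' * g''\<close> vanished almost surely, so would \<open>g'\<close>.\<close>

lemma not_AE_g'_g''_eq_0: "\<not> (AE x in F. d 1 x * d 2 x = 0)"
proof
  assume AE: "AE x in F. d 1 x * d 2 x = 0"
  have "(\<integral>x. d 1 x ^ 3 * d 1 x \<partial>F) = (\<integral>x. 3 * (d 1 x)\<^sup>2 * d 2 x \<partial>F)"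
  proof (rule integration_by_parts)
    show "((\<lambda>x. d 1 x ^ 3) has_real_derivative 3 * (d 1 x)\<^sup>2 * d 2 x) (at x)" for x
      using d_deriv[of 1 x] by (auto intro!: derivative_eq_intros simp: eval_nat_numeral)
    show "continuous_on UNIV (\<lambda>x. 3 * (d 1 x)\<^sup>2 * d 2 x)" by (intro continuous_intros d_continuous)
  qed (intro poly_growth_mult poly_growth_add poly_growth_power poly_growth_const d_poly_growth)+
  also have "\<dots> = (\<integral>x. 0 \<partial>F)"
    using AE by (intro integral_cong_AE) (auto simp: power2_eq_square)
  finally have "(\<integral>x. d 1 x ^ 4 \<partial>F) = 0" by (simp add: eval_nat_numeral mult_ac)
  moreover have int: "integrable F (\<lambda>x. d 1 x ^ 4)"
    by (intro integrable_F poly_growth_power d_poly_growth) measurable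
  ultimately have "AE x in F. d 1 x ^ 4 = 0"
    using integral_nonneg_eq_0_iff_AE[OF int] by auto
  then show False using not_AE_g'_eq_0 by simp
qed

section \<open>The one-dimensional proposal and its detailed balance\<close>

definition P :: "(real \<times> real) measure" where "P = F \<Otimes>\<^sub>M std_normal_distribution"

lemma prob_space_N: "prob_space std_normal_distribution"
  by (rule prob_space_normal_density) simp

lemma pair_F_N: "pair_prob_space F std_normal_distribution"
  by (intro pair_prob_space.intro pair_sigma_finite.intro prob_space_imp_sigma_finite F.prob_space_axioms prob_space_N)

sublocale P: pair_prob_space F std_normal_distribution
  by (rule pair_F_N)

lemma sets_P [measurable_cong]: "sets P = sets (borel \<Otimes>\<^sub>M borel)"
  unfolding P_def by (intro sets_pair_measure_cong sets_F) simp

lemma expectation_P_mult: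
  fixes a b :: "real \<Rightarrow> real"
  assumes a: "a \<in> borel_measurable borel" "poly_growth a" and b: "b \<in> borel_measurable borel" "poly_growth b"
  shows "integrable P (\<lambda>u. a (fst u) * b (snd u))"
    and "(\<integral>u. a (fst u) * b (snd u) \<partial>P) = (\<integral>x. a x \<partial>F) * (\<integral>z. b z \<partial>std_normal_distribution)"
proof -
  have "integrable std_normal_distribution b"
    by (rule integrable_poly_growth[OF _ integrable_std_normal_distribution_moment b]) simp
  then show "integrable P (\<lambda>u. a (fst u) * b (snd u))"
    "(\<integral>u. a (fst u) * b (snd u) \<partial>P) = (\<integral>x. a x \<partial>F) * (\<integral>z. b z \<partial>std_normal_distribution)"
    unfolding P_def using integrable_F[OF a] by (rule_tac P.integrable_product_mult; simp)+
qed

text \<open>Proposal in the rescaled coordinate with drift function \<open>b\<close>: zero for RWM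
  and \<open>- g' / 2\<close> for SLA, so that one development serves both.\<close>

definition step :: "(real \<Rightarrow> real) \<Rightarrow> real \<Rightarrow> real \<times> real \<Rightarrow> real" where
  "step b \<epsilon> u = fst u + \<epsilon>\<^sup>2 * b (fst u) + \<epsilon> * snd u"

text \<open>Logarithm of density times backward proposal over density times forward proposal; the
  Gaussian normalizing constants cancel.\<close>

definition log_ratio :: "(real \<Rightarrow> real) \<Rightarrow> real \<Rightarrow> real \<Rightarrow> real \<Rightarrow> real" where
  "log_ratio b \<epsilon> x y = g x - g y + ((y - x - \<epsilon>\<^sup>2 * b x)\<^sup>2 - (x - y - \<epsilon>\<^sup>2 * b y)\<^sup>2) / (2 * \<epsilon>\<^sup>2)"

lemma step_measurable [measurable]:
  assumes [measurable]: "b \<in> borel_measurable borel"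
  shows "step b \<epsilon> \<in> borel_measurable (borel \<Otimes>\<^sub>M borel)"
  unfolding step_def by measurable

lemma log_ratio_measurable [measurable]:
  assumes [measurable]: "b \<in> borel_measurable borel" "u \<in> borel_measurable M" "v \<in> borel_measurable M"
  shows "(\<lambda>w. log_ratio b \<epsilon> (u w) (v w)) \<in> borel_measurable M"
  unfolding log_ratio_def by measurable

lemma log_ratio_swap: "log_ratio b \<epsilon> y x = - log_ratio b \<epsilon> x y"
  by (simp add: log_ratio_def minus_divide_left)

lemma exp_log_ratio:
  assumes "\<epsilon> > 0"
  shows "f x * normal_density (x + \<epsilon>\<^sup>2 * b x) \<epsilon> y * exp (log_ratio b \<epsilon> x y)
    = f y * normal_density (y + \<epsilon>\<^sup>2 * b y) \<epsilon> x"
proof -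
  have "exp (- g x) * exp (- (y - (x + \<epsilon>\<^sup>2 * b x))\<^sup>2 / (2 * \<epsilon>\<^sup>2)) * exp (log_ratio b \<epsilon> x y)
      = exp (- g y) * exp (- (x - (y + \<epsilon>\<^sup>2 * b y))\<^sup>2 / (2 * \<epsilon>\<^sup>2))"
    unfolding exp_add[symmetric] log_ratio_def
    by (simp add: diff_diff_eq diff_divide_distrib add_divide_distrib)
  then show ?thesis by (simp add: normal_density_def f_def mult_ac)
qed

text \<open>Against Lebesgue measure in both variables the state and the proposed point play
  symmetric roles and can be interchanged.\<close>

lemma nn_integral_step:
  fixes G :: "real \<Rightarrow> real \<Rightarrow> ennreal"
  assumes \<epsilon>: "\<epsilon> > 0" and [measurable]: "b \<in> borel_measurable borel"
    and G [measurable]: "case_prod G \<in> borel_measurable (borel \<Otimes>\<^sub>M borel)"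
  shows "(\<integral>\<^sup>+u. G (fst u) (step b \<epsilon> u) \<partial>P)
    = (\<integral>\<^sup>+x. \<integral>\<^sup>+y. ennreal (f x * normal_density (x + \<epsilon>\<^sup>2 * b x) \<epsilon> y) * G x y \<partial>lborel \<partial>lborel)"
proof -
  have "(\<lambda>u. G (fst u) (step b \<epsilon> u)) \<in> borel_measurable (F \<Otimes>\<^sub>M std_normal_distribution)"
    unfolding step_def by measurable
  then have "(\<integral>\<^sup>+u. G (fst u) (step b \<epsilon> u) \<partial>P)
      = (\<integral>\<^sup>+x. \<integral>\<^sup>+z. G x (x + \<epsilon>\<^sup>2 * b x + \<epsilon> * z) \<partial>std_normal_distribution \<partial>F)"
    unfolding P_def by (subst P.M2.nn_integral_fst[symmetric]) (auto simp: step_def)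
  also have "\<dots> = (\<integral>\<^sup>+x. \<integral>\<^sup>+y. ennreal (normal_density (x + \<epsilon>\<^sup>2 * b x) \<epsilon> y) * G x y \<partial>lborel \<partial>F)"
  proof (rule nn_integral_cong)
    fix x
    have "(\<integral>\<^sup>+z. G x (x + \<epsilon>\<^sup>2 * b x + \<epsilon> * z) \<partial>std_normal_distribution)
        = (\<integral>\<^sup>+y. G x y \<partial>distr std_normal_distribution lborel (\<lambda>z. x + \<epsilon>\<^sup>2 * b x + \<epsilon> * z))"
      by (subst nn_integral_distr) auto
    also have "\<dots> = (\<integral>\<^sup>+y. ennreal (normal_density (x + \<epsilon>\<^sup>2 * b x) \<epsilon> y) * G x y \<partial>lborel)"
      using \<epsilon> by (simp add: distr_affine_std_normal nn_integral_density)
    finally show "(\<integral>\<^sup>+z. G x (x + \<epsilon>\<^sup>2 * b x + \<epsilon> * z) \<partial>std_normal_distribution)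
        = (\<integral>\<^sup>+y. ennreal (normal_density (x + \<epsilon>\<^sup>2 * b x) \<epsilon> y) * G x y \<partial>lborel)" .
  qed
  also have "\<dots> = (\<integral>\<^sup>+x. ennreal (f x) * (\<integral>\<^sup>+y. ennreal (normal_density (x + \<epsilon>\<^sup>2 * b x) \<epsilon> y) * G x y \<partial>lborel) \<partial>lborel)"
    unfolding F_def normal_density_def by (subst nn_integral_density) auto
  also have "\<dots> = (\<integral>\<^sup>+x. \<integral>\<^sup>+y. ennreal (f x * normal_density (x + \<epsilon>\<^sup>2 * b x) \<epsilon> y) * G x y \<partial>lborel \<partial>lborel)"
  proof (rule nn_integral_cong)
    fix x
    have "ennreal (f x) * (\<integral>\<^sup>+y. ennreal (normal_density (x + \<epsilon>\<^sup>2 * b x) \<epsilon> y) * G x y \<partial>lborel)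
        = (\<integral>\<^sup>+y. ennreal (f x) * (ennreal (normal_density (x + \<epsilon>\<^sup>2 * b x) \<epsilon> y) * G x y) \<partial>lborel)"
      by (rule nn_integral_cmult[symmetric]) measurable
    also have "\<dots> = (\<integral>\<^sup>+y. ennreal (f x * normal_density (x + \<epsilon>\<^sup>2 * b x) \<epsilon> y) * G x y \<partial>lborel)"
      using less_imp_le[OF f_pos] by (simp add: ennreal_mult' mult.assoc)
    finally show "ennreal (f x) * (\<integral>\<^sup>+y. ennreal (normal_density (x + \<epsilon>\<^sup>2 * b x) \<epsilon> y) * G x y \<partial>lborel)
        = (\<integral>\<^sup>+y. ennreal (f x * normal_density (x + \<epsilon>\<^sup>2 * b x) \<epsilon> y) * G x y \<partial>lborel)" .
  qed
  finally show ?thesis .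
qed

text \<open>Tonelli's theorem exchanges the two points. The log-ratio is antisymmetric, and
  exchanging the points in the joint density multiplies it by \<open>exp\<close> of the
  log-ratio.\<close>

lemma step_balance:
  fixes c :: "real \<Rightarrow> ennreal"
  assumes \<epsilon>: "\<epsilon> > 0" and b [measurable]: "b \<in> borel_measurable borel" and [measurable]: "c \<in> borel_measurable borel"
  shows "(\<integral>\<^sup>+u. c (- log_ratio b \<epsilon> (fst u) (step b \<epsilon> u)) \<partial>P)
    = (\<integral>\<^sup>+u. c (log_ratio b \<epsilon> (fst u) (step b \<epsilon> u)) * ennreal (exp (log_ratio b \<epsilon> (fst u) (step b \<epsilon> u))) \<partial>P)"
proof -
  let ?q = "\<lambda>x y. f x * normal_density (x + \<epsilon>\<^sup>2 * b x) \<epsilon> y"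
  have "(\<integral>\<^sup>+u. c (- log_ratio b \<epsilon> (fst u) (step b \<epsilon> u)) \<partial>P)
      = (\<integral>\<^sup>+x. \<integral>\<^sup>+y. ennreal (?q x y) * c (- log_ratio b \<epsilon> x y) \<partial>lborel \<partial>lborel)"
    by (rule nn_integral_step[OF \<epsilon> b, where G = "\<lambda>x y. c (- log_ratio b \<epsilon> x y)"]) measurable
  also have "\<dots> = (\<integral>\<^sup>+y. \<integral>\<^sup>+x. ennreal (?q x y) * c (- log_ratio b \<epsilon> x y) \<partial>lborel \<partial>lborel)"
    unfolding normal_density_def by (rule lborel_pair.Fubini') measurable
  also have "\<dots> = (\<integral>\<^sup>+x. \<integral>\<^sup>+y. ennreal (?q x y) * (c (log_ratio b \<epsilon> x y) * ennreal (exp (log_ratio b \<epsilon> x y))) \<partial>lborel \<partial>lborel)"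
  proof (intro nn_integral_cong)
    fix x y
    have "ennreal (?q y x) = ennreal (?q x y) * ennreal (exp (log_ratio b \<epsilon> x y))"
      using exp_log_ratio[OF \<epsilon>, of x b y] less_imp_le[OF f_pos[of x]] by (simp flip: ennreal_mult)
    moreover have "- log_ratio b \<epsilon> y x = log_ratio b \<epsilon> x y" by (simp add: log_ratio_swap[of b \<epsilon> y x])
    ultimately show "ennreal (?q y x) * c (- log_ratio b \<epsilon> y x)
        = ennreal (?q x y) * (c (log_ratio b \<epsilon> x y) * ennreal (exp (log_ratio b \<epsilon> x y)))"
      by (simp only: mult_ac)
  qed
  also have "\<dots> = (\<integral>\<^sup>+u. c (log_ratio b \<epsilon> (fst u) (step b \<epsilon> u)) * ennreal (exp (log_ratio b \<epsilon> (fst u) (step b \<epsilon> u))) \<partial>P)"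
    by (rule nn_integral_step[OF \<epsilon> b, symmetric, where G = "\<lambda>x y. c (log_ratio b \<epsilon> x y) * ennreal (exp (log_ratio b \<epsilon> x y))"]) measurable
  finally show ?thesis .
qed

section \<open>Taylor expansion and an envelope with all moments\<close>

lemma d_Taylor:
  obtains t where "\<bar>t\<bar> \<le> \<bar>h\<bar>"
    "d j (x + h) = (\<Sum>m<n. d (j + m) x / fact m * h ^ m) + d (j + n) (x + t) / fact n * h ^ n"
proof -
  have "((\<lambda>y. d (j + m) (x + y)) has_real_derivative d (j + Suc m) (x + y)) (at y)" for m y
  proof -
    have shift: "((\<lambda>y. x + y) has_real_derivative 1) (at y)" by (auto intro!: derivative_eq_intros)
    show ?thesis
      using DERIV_chain2[where f = "d (j + m)" and g = "\<lambda>y. x + y", OF d_deriv shift] by simp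
  qed
  then have "\<exists>t. \<bar>t\<bar> \<le> \<bar>h\<bar> \<and> d j (x + h) = (\<Sum>m<n. d (j + m) (x + 0) / fact m * h ^ m) + d (j + n) (x + t) / fact n * h ^ n"
    using Maclaurin_all_le[of "\<lambda>m y. d (j + m) (x + y)" "\<lambda>y. d j (x + y)" h n] by simp
  then show ?thesis using that by auto
qed

text \<open>The last property covers every intermediate point of a Taylor remainder: for
  \<open>\<epsilon> \<le> 1\<close> both algorithms move by at most
  \<open>\<bar>z\<bar> + \<bar>g' x\<bar>\<close>. Order 4 is what the SLA expansion to third order
  consumes.\<close>

lemma d_envelope:
  obtains V :: "real \<times> real \<Rightarrow> real" where "V \<in> borel_measurable borel" "\<And>j. integrable P (\<lambda>u. V u ^ j)"
    "\<And>u. V u \<ge> 1" "\<And>u. \<bar>fst u\<bar> \<le> V u" "\<And>u. \<bar>snd u\<bar> + \<bar>d 1 (fst u)\<bar> \<le> V u"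
    "\<And>j u t. j \<le> 4 \<Longrightarrow> \<bar>t\<bar> \<le> \<bar>snd u\<bar> + \<bar>d 1 (fst u)\<bar> \<Longrightarrow> \<bar>d j (fst u + t)\<bar> \<le> V u"
proof -
  have "\<forall>j. \<exists>A N. \<forall>x. \<bar>d j x\<bar> \<le> A * (1 + \<bar>x\<bar>) ^ N"
    using d_poly_growth by (auto simp: poly_growth_def)
  then obtain A' N' where A': "\<And>j x. \<bar>d j x\<bar> \<le> A' j * (1 + \<bar>x\<bar>) ^ N' j" by metis
  define A where "A = 1 + (\<Sum>j\<le>4. \<bar>A' j\<bar>)"
  define N where "N = (\<Sum>j\<le>4. N' j)"
  have A1: "A \<ge> 1" unfolding A_def by (simp add: sum_nonneg)
  have dA: "\<bar>d j x\<bar> \<le> A * (1 + \<bar>x\<bar>) ^ N" if j: "j \<le> 4" for j x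
  proof -
    have "\<bar>A' j\<bar> \<le> (\<Sum>j\<le>4. \<bar>A' j\<bar>)" using j by (intro member_le_sum) auto
    then have "A' j \<le> A" unfolding A_def by linarith
    moreover have "N' j \<le> N" unfolding N_def using j by (intro member_le_sum) auto
    ultimately have "A' j * (1 + \<bar>x\<bar>) ^ N' j \<le> A * (1 + \<bar>x\<bar>) ^ N"
      using A1 by (intro mult_mono power_increasing) auto
    then show ?thesis using A'[of j x] by linarith
  qed
  \<comment> \<open>The product form of \<open>v\<close> lets moments factor over state and noise.
    \<open>Q\<close> dominates both \<open>A\<close> and \<open>1\<close> plus the distance from 0
    that a step can reach, so \<open>V = Q ^ (N + 1)\<close> dominates \<open>A\<close> times the
    \<open>N\<close>-th power of the latter. The exponent \<open>N + 1\<close> keeps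
    \<open>v\<close> below its own power when \<open>N = 0\<close>.\<close>
  define v :: "real \<times> real \<Rightarrow> real" where "v u = (1 + \<bar>fst u\<bar>) * (1 + \<bar>snd u\<bar>)" for u
  define Q where "Q u = 3 * A * v u ^ (N + 1)" for u
  define V where "V u = Q u ^ (N + 1)" for u
  have v1: "1 + \<bar>fst u\<bar> \<le> v u" "1 + \<bar>fst u\<bar> + \<bar>snd u\<bar> \<le> v u" for u
    unfolding v_def by (simp_all add: algebra_simps)
  have vpow: "v u \<le> v u ^ (N + 1)" "v u ^ N \<le> v u ^ (N + 1)" "1 \<le> v u" for u
  proof -
    show "1 \<le> v u" using v1(1)[of u] by linarith
    then show "v u \<le> v u ^ (N + 1)" "v u ^ N \<le> v u ^ (N + 1)"
      using power_increasing[of 1 "N + 1" "v u"] by (auto intro!: power_increasing)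
  qed
  have Q: "1 + \<bar>fst u\<bar> + (\<bar>snd u\<bar> + \<bar>d 1 (fst u)\<bar>) \<le> Q u" for u
  proof -
    have "\<bar>d 1 (fst u)\<bar> \<le> A * (1 + \<bar>fst u\<bar>) ^ N" by (rule dA) simp
    also have "\<dots> \<le> A * v u ^ N" using A1 v1(1)[of u] by (intro mult_left_mono power_mono) auto
    also have "\<dots> \<le> A * v u ^ (N + 1)" using A1 vpow[of u] by (intro mult_left_mono) auto
    finally have "\<bar>d 1 (fst u)\<bar> \<le> A * v u ^ (N + 1)" .
    moreover have "v u ^ (N + 1) \<le> A * v u ^ (N + 1)" using A1 vpow[of u] mult_right_mono[of 1 A "v u ^ (N + 1)"] by simp
    moreover have "1 + \<bar>fst u\<bar> + \<bar>snd u\<bar> \<le> v u ^ (N + 1)" using v1(2)[of u] vpow(1)[of u] by linarith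
    moreover have "0 \<le> A * v u ^ (N + 1)" using A1 vpow(3)[of u] by simp
    ultimately show ?thesis unfolding Q_def by linarith
  qed
  have Q1: "1 \<le> Q u" for u using Q[of u] by linarith
  have AQ: "A \<le> Q u" for u
  proof -
    have "A * 1 \<le> A * v u ^ (N + 1)" using A1 vpow(3)[of u] by (intro mult_left_mono one_le_power) auto
    then show ?thesis using A1 unfolding Q_def by linarith
  qed
  have QV: "Q u \<le> V u" for u
    unfolding V_def using power_increasing[of 1 "N + 1" "Q u"] Q1[of u] by simp
  show ?thesis
  proof
    show "V \<in> borel_measurable borel"
      unfolding V_def Q_def v_def borel_prod[symmetric] by measurable
    show "integrable P (\<lambda>u. V u ^ j)" for j
    proof -
      define M where "M = (N + 1) * ((N + 1) * j)"
      have "V u ^ j = (3 * A) ^ ((N + 1) * j) * ((1 + \<bar>fst u\<bar>) ^ M * (1 + \<bar>snd u\<bar>) ^ M)" for u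
        unfolding V_def Q_def M_def v_def
        by (simp only: power_mult[symmetric] power_mult_distrib mult.assoc)
      moreover have "integrable P (\<lambda>u. (1 + \<bar>fst u\<bar>) ^ M * (1 + \<bar>snd u\<bar>) ^ M)"
        by (rule expectation_P_mult(1)[where a = "\<lambda>x. (1 + \<bar>x\<bar>) ^ M" and b = "\<lambda>x. (1 + \<bar>x\<bar>) ^ M"])
          (auto intro!: poly_growthI[where A = 1 and N = M])
      ultimately show ?thesis by (simp add: integrable_mult_right)
    qed
    show "V u \<ge> 1" for u using Q1[of u] QV[of u] by linarith
    show "\<bar>fst u\<bar> \<le> V u" "\<bar>snd u\<bar> + \<bar>d 1 (fst u)\<bar> \<le> V u" for u
      using Q[of u] QV[of u] by linarith+
    show "\<bar>d j (fst u + t)\<bar> \<le> V u" if "j \<le> 4" "\<bar>t\<bar> \<le> \<bar>snd u\<bar> + \<bar>d 1 (fst u)\<bar>" for j u t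
    proof -
      have "\<bar>d j (fst u + t)\<bar> \<le> A * (1 + \<bar>fst u + t\<bar>) ^ N" by (rule dA) fact
      also have "\<dots> \<le> Q u * Q u ^ N"
        using that Q[of u] A1 AQ[of u] by (intro mult_mono power_mono) auto
      finally show ?thesis by (simp add: V_def)
    qed
  qed
qed

end

section \<open>Expansion of the log-ratio for RWM and SLA\<close>

text \<open>The SLA expansion as pure algebra: \<open>a1\<close>, \<open>a2\<close>,
  \<open>a3\<close> stand for derivatives of \<open>g\<close> at the state and \<open>t2\<close>,
  \<open>t3\<close>, \<open>t4\<close>, \<open>t4'\<close> for derivatives at intermediate points.
  The trapezoidal error yields \<open>z ^ 3 * a3 / 12\<close>, and the difference of squares,
  linearized in \<open>h\<close>, yields \<open>- z * a1 * a2 / 4\<close>.\<close>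

lemma sla_remainder:
  fixes \<epsilon> z a1 a2 a3 t2 t3 t4 t4' V h g0 gy a1y :: real
  assumes \<epsilon>: "0 < \<epsilon>" "\<epsilon> \<le> 1" and V: "V \<ge> 1" and z: "\<bar>z\<bar> + \<bar>a1\<bar> \<le> V"
    and a: "\<bar>a2\<bar> \<le> V" "\<bar>a3\<bar> \<le> V" "\<bar>t2\<bar> \<le> V" "\<bar>t3\<bar> \<le> V" "\<bar>t4\<bar> \<le> V" "\<bar>t4'\<bar> \<le> V"
    and h: "h = \<epsilon> * z - \<epsilon>\<^sup>2 / 2 * a1"
    and gy: "gy = g0 + h * a1 + h\<^sup>2 / 2 * a2 + h ^ 3 / 6 * a3 + h ^ 4 / 24 * t4"
    and a1y: "a1y = a1 + h * a2 + h\<^sup>2 / 2 * a3 + h ^ 3 / 6 * t4'"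
      "a1y = a1 + h * t2" "a1y = a1 + h * a2 + h\<^sup>2 / 2 * t3"
  shows "\<bar>(g0 - gy + h * (a1 + a1y) / 2 + \<epsilon>\<^sup>2 / 8 * (a1\<^sup>2 - a1y\<^sup>2)) - \<epsilon> ^ 3 * (z ^ 3 * a3 / 12 - z * a1 * a2 / 4)\<bar>
    \<le> \<epsilon> ^ 4 * V ^ 5"
proof -
  \<comment> \<open>The drift part of the displacement, of order \<open>\<epsilon>\<^sup>2\<close>;
    replacing \<open>h\<close> by \<open>\<epsilon> * z\<close> in the leading terms costs one
    order.\<close>
  define e where "e = h - \<epsilon> * z"
  have V0: "V \<ge> 0" using V by simp
  have a1: "\<bar>a1\<bar> \<le> V" and zV: "\<bar>z\<bar> \<le> V" using z by linarith+
  have ez: "\<bar>\<epsilon> * z\<bar> \<le> \<epsilon> * V" using \<epsilon> zV by (simp add: abs_mult)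
  have e: "\<bar>e\<bar> \<le> \<epsilon>\<^sup>2 * V / 2"
    unfolding e_def h using a1 by (simp add: abs_mult mult_left_mono)
  have hV: "\<bar>h\<bar> \<le> \<epsilon> * V"
  proof -
    have "\<epsilon>\<^sup>2 * \<bar>a1\<bar> \<le> \<epsilon> * \<bar>a1\<bar>"
      using \<epsilon> by (intro mult_right_mono) (auto simp: power2_eq_square mult_left_le)
    moreover have "0 \<le> \<epsilon>\<^sup>2 * \<bar>a1\<bar>" by simp
    moreover have "\<bar>h\<bar> \<le> \<epsilon> * \<bar>z\<bar> + \<epsilon>\<^sup>2 * \<bar>a1\<bar> / 2"
      unfolding h using \<epsilon> abs_triangle_ineq4[of "\<epsilon> * z" "\<epsilon>\<^sup>2 / 2 * a1"] by (simp add: abs_mult)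
    ultimately have "\<bar>h\<bar> \<le> \<epsilon> * \<bar>z\<bar> + \<epsilon> * \<bar>a1\<bar>" by linarith
    also have "\<dots> \<le> \<epsilon> * V" unfolding distrib_left[symmetric] using \<epsilon> z by (intro mult_left_mono) auto
    finally show ?thesis .
  qed
  have h2: "h\<^sup>2 \<le> \<epsilon>\<^sup>2 * V\<^sup>2" using power_mono[OF hV, of 2] by (simp add: power_mult_distrib)
  have h4: "h ^ 4 \<le> \<epsilon> ^ 4 * V ^ 4" using power_mono[OF hV, of 4] by (simp add: power_mult_distrib)
  have sq: "a1y\<^sup>2 - a1\<^sup>2 = 2 * a1 * (h * a2 + h\<^sup>2 / 2 * t3) + (h * t2)\<^sup>2"
  proof -
    have "a1y\<^sup>2 - a1\<^sup>2 = 2 * a1 * (a1y - a1) + (a1y - a1)\<^sup>2" by (simp add: power2_eq_square algebra_simps)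
    moreover have "a1y - a1 = h * a2 + h\<^sup>2 / 2 * t3" "a1y - a1 = h * t2" using a1y by simp_all
    ultimately show ?thesis by metis
  qed
  \<comment> \<open>The terms in \<open>h\<close> and \<open>h\<^sup>2\<close> cancel, and
    \<open>1 / 4 - 1 / 6\<close> gives the classical \<open>1 / 12\<close>.\<close>
  have trap: "g0 - gy + h * (a1 + a1y) / 2 = h ^ 3 * a3 / 12 + h ^ 4 * (t4' / 12 - t4 / 24)"
    unfolding gy a1y(1) by (simp add: field_simps power2_eq_square power3_eq_cube eval_nat_numeral)
  have decomp: "(g0 - gy + h * (a1 + a1y) / 2 + \<epsilon>\<^sup>2 / 8 * (a1\<^sup>2 - a1y\<^sup>2)) - \<epsilon> ^ 3 * (z ^ 3 * a3 / 12 - z * a1 * a2 / 4)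
      = (h ^ 3 - (\<epsilon> * z) ^ 3) * a3 / 12 + h ^ 4 * (t4' / 12 - t4 / 24)
        - \<epsilon>\<^sup>2 / 8 * (2 * a1 * a2 * e + h\<^sup>2 * (a1 * t3 + t2\<^sup>2))"
  proof -
    have "a1\<^sup>2 - a1y\<^sup>2 = - (2 * a1 * (h * a2 + h\<^sup>2 / 2 * t3) + (h * t2)\<^sup>2)" using sq by linarith
    note sq' = this
    show ?thesis
      unfolding trap sq' e_def by (simp add: field_simps power2_eq_square power3_eq_cube)
  qed
  have 1: "\<bar>(h ^ 3 - (\<epsilon> * z) ^ 3) * a3 / 12\<bar> \<le> \<epsilon> ^ 4 * V ^ 5 / 8"
  proof -
    have "h ^ 3 - (\<epsilon> * z) ^ 3 = e * (h\<^sup>2 + h * (\<epsilon> * z) + (\<epsilon> * z)\<^sup>2)"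
      unfolding e_def by (simp add: power2_eq_square power3_eq_cube algebra_simps)
    also have "\<bar>\<dots>\<bar> \<le> (\<epsilon>\<^sup>2 * V / 2) * (3 * (\<epsilon>\<^sup>2 * V\<^sup>2))"
      unfolding abs_mult
    proof (intro mult_mono e)
      have "\<bar>h * (\<epsilon> * z)\<bar> \<le> (\<epsilon> * V) * (\<epsilon> * V)"
        unfolding abs_mult[of h] using hV ez \<epsilon> V0 by (intro mult_mono) auto
      moreover have "(\<epsilon> * z)\<^sup>2 \<le> \<epsilon>\<^sup>2 * V\<^sup>2" using power_mono[OF ez, of 2] by (simp add: power_mult_distrib)
      moreover have "(\<epsilon> * V) * (\<epsilon> * V) = \<epsilon>\<^sup>2 * V\<^sup>2" by (simp add: power2_eq_square)
      moreover have "0 \<le> h\<^sup>2" "0 \<le> (\<epsilon> * z)\<^sup>2" by simp_all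
      ultimately show "\<bar>h\<^sup>2 + h * (\<epsilon> * z) + (\<epsilon> * z)\<^sup>2\<bar> \<le> 3 * (\<epsilon>\<^sup>2 * V\<^sup>2)" using h2 by linarith
    qed (use V0 in auto)
    finally have "\<bar>h ^ 3 - (\<epsilon> * z) ^ 3\<bar> * \<bar>a3\<bar> \<le> ((\<epsilon>\<^sup>2 * V / 2) * (3 * (\<epsilon>\<^sup>2 * V\<^sup>2))) * V"
      using a V0 by (intro mult_mono) auto
    also have "\<dots> = 3 / 2 * (\<epsilon> ^ 4 * V ^ 4)" by (simp add: eval_nat_numeral)
    also have "\<dots> \<le> 3 / 2 * (\<epsilon> ^ 4 * V ^ 5)" using V by (intro mult_left_mono power_increasing) auto
    finally show ?thesis by (simp add: abs_mult mult_ac)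
  qed
  have 2: "\<bar>h ^ 4 * (t4' / 12 - t4 / 24)\<bar> \<le> \<epsilon> ^ 4 * V ^ 5 / 8"
  proof -
    have "\<bar>t4' / 12 - t4 / 24\<bar> \<le> V / 8" using a by linarith
    then have "\<bar>h ^ 4\<bar> * \<bar>t4' / 12 - t4 / 24\<bar> \<le> (\<epsilon> ^ 4 * V ^ 4) * (V / 8)"
      using h4 V0 by (intro mult_mono) auto
    then show ?thesis by (simp add: abs_mult eval_nat_numeral)
  qed
  have 3: "\<bar>\<epsilon>\<^sup>2 / 8 * (2 * a1 * a2 * e + h\<^sup>2 * (a1 * t3 + t2\<^sup>2))\<bar> \<le> 3 / 8 * (\<epsilon> ^ 4 * V ^ 5)"
  proof -
    have "\<bar>2 * a1 * a2 * e\<bar> \<le> 2 * V * V * (\<epsilon>\<^sup>2 * V / 2)"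
    proof -
      have "\<bar>a1\<bar> * \<bar>a2\<bar> \<le> V * V" by (rule mult_mono[OF a1 a(1) V0]) simp
      from mult_mono[OF this e] have "\<bar>a1\<bar> * \<bar>a2\<bar> * \<bar>e\<bar> \<le> V * V * (\<epsilon>\<^sup>2 * V / 2)" using V0 by simp
      then show ?thesis by (simp add: abs_mult)
    qed
    moreover have "\<bar>h\<^sup>2 * (a1 * t3 + t2\<^sup>2)\<bar> \<le> (\<epsilon>\<^sup>2 * V\<^sup>2) * (2 * V\<^sup>2)"
    proof -
      have "\<bar>a1 * t3\<bar> \<le> V * V" unfolding abs_mult using a1 a V0 by (intro mult_mono) auto
      moreover have "t2\<^sup>2 \<le> V\<^sup>2" using power_mono[OF a(3), of 2] by simp
      moreover have "0 \<le> t2\<^sup>2" by simp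
      ultimately have "\<bar>a1 * t3 + t2\<^sup>2\<bar> \<le> 2 * V\<^sup>2" unfolding power2_eq_square[of V] by linarith
      then show ?thesis unfolding abs_mult using h2 by (intro mult_mono) auto
    qed
    ultimately have "\<bar>2 * a1 * a2 * e + h\<^sup>2 * (a1 * t3 + t2\<^sup>2)\<bar> \<le> \<epsilon>\<^sup>2 * V ^ 3 + 2 * (\<epsilon>\<^sup>2 * V ^ 4)"
      by (simp add: eval_nat_numeral mult_ac)
    also have "\<dots> \<le> \<epsilon>\<^sup>2 * V ^ 5 + 2 * (\<epsilon>\<^sup>2 * V ^ 5)"
      using V by (intro add_mono mult_left_mono power_increasing) auto
    finally have "\<epsilon>\<^sup>2 / 8 * \<bar>2 * a1 * a2 * e + h\<^sup>2 * (a1 * t3 + t2\<^sup>2)\<bar> \<le> \<epsilon>\<^sup>2 / 8 * (3 * (\<epsilon>\<^sup>2 * V ^ 5))"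
      by (intro mult_left_mono) auto
    then show ?thesis by (simp add: abs_mult power2_eq_square eval_nat_numeral)
  qed
  have "0 \<le> \<epsilon> ^ 4 * V ^ 5" using \<epsilon> V0 by simp
  \<comment> \<open>The three parts contribute \<open>1 / 8\<close>, \<open>1 / 8\<close> and
    \<open>3 / 8\<close>.\<close>
  then show ?thesis unfolding decomp using 1 2 3 by linarith
qed

context smooth_density
begin

lemma rwm_expectation:
  "(\<integral>u. (- snd u * d 1 (fst u))\<^sup>2 \<partial>P) = K_RWM f g"
proof -
  have "(\<integral>u. (- snd u * d 1 (fst u))\<^sup>2 \<partial>P) = (\<integral>u. (d 1 (fst u))\<^sup>2 * (snd u)\<^sup>2 \<partial>P)"
    by (simp add: power_mult_distrib mult.commute)
  also have "\<dots> = (\<integral>x. (d 1 x)\<^sup>2 \<partial>F) * (\<integral>z. z\<^sup>2 \<partial>std_normal_distribution)"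
    by (rule expectation_P_mult(2)[where a = "\<lambda>x. (d 1 x)\<^sup>2" and b = "\<lambda>z. z\<^sup>2"])
      (auto intro!: poly_growth_power poly_growth_ident d_poly_growth)
  also have "(\<integral>z. z\<^sup>2 \<partial>std_normal_distribution) = 1"
    using std_normal_distribution_even_moments(1)[of 1] by simp
  finally show ?thesis by (simp add: K_RWM_def dens_expectation_def F_def d_def)
qed

text \<open>Expanding the square gives a quadratic form in \<open>g'''\<close> and
  \<open>g' * g''\<close>. Integration by parts trades part of it for the cube of
  \<open>g''\<close>, which produces the formula for \<open>K_SLA\<close>; positivity is visible
  only in the original form, since that cube has no sign.\<close>

lemma sla_expectation:
  fixes C :: "real \<times> real \<Rightarrow> real"
  defines "C \<equiv> \<lambda>u. snd u ^ 3 * d 3 (fst u) / 12 - snd u * d 1 (fst u) * d 2 (fst u) / 4"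
  shows "(\<integral>u. (C u)\<^sup>2 \<partial>P) = K_SLA f g" and "(\<integral>u. (C u)\<^sup>2 \<partial>P) > 0"
proof -
  let ?N = std_normal_distribution
  have pg: "poly_growth (\<lambda>x. (d 3 x)\<^sup>2)" "poly_growth (\<lambda>x. d 1 x * d 2 x * d 3 x)"
    "poly_growth (\<lambda>x. (d 1 x * d 2 x)\<^sup>2)" "poly_growth (\<lambda>x. d 2 x ^ 3)"
    by (intro poly_growth_mult poly_growth_power d_poly_growth)+
  have int: "integrable F (\<lambda>x. (d 3 x)\<^sup>2)" "integrable F (\<lambda>x. d 1 x * d 2 x * d 3 x)"
    "integrable F (\<lambda>x. (d 1 x * d 2 x)\<^sup>2)" "integrable F (\<lambda>x. d 2 x ^ 3)"
    by (rule integrable_F[OF _ pg(1)] integrable_F[OF _ pg(2)] integrable_F[OF _ pg(3)] integrable_F[OF _ pg(4)], measurable)+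
  have zpow: "(\<lambda>z::real. z ^ j) \<in> borel_measurable borel" "poly_growth (\<lambda>z. z ^ j)" for j
    by (auto intro: poly_growth_power poly_growth_ident)
  have m2: "(\<integral>z. z ^ 2 \<partial>?N) = 1" and m4: "(\<integral>z. z ^ 4 \<partial>?N) = 3" and m6: "(\<integral>z. z ^ 6 \<partial>?N) = 15"
    using std_normal_distribution_even_moments(1)[of 1] std_normal_distribution_even_moments(1)[of 2]
      std_normal_distribution_even_moments(1)[of 3] by (simp_all add: fact_numeral)
  have meas: "(\<lambda>x. (d 3 x)\<^sup>2) \<in> borel_measurable borel" "(\<lambda>x. d 1 x * d 2 x * d 3 x) \<in> borel_measurable borel"
    "(\<lambda>x. (d 1 x * d 2 x)\<^sup>2) \<in> borel_measurable borel" by measurable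
  note t6 = expectation_P_mult[OF meas(1) pg(1) zpow[of 6]]
  note t4 = expectation_P_mult[OF meas(2) pg(2) zpow[of 4]]
  note t2 = expectation_P_mult[OF meas(3) pg(3) zpow[of 2]]
  have "(\<integral>u. (C u)\<^sup>2 \<partial>P) = (\<integral>u. 1 / 144 * ((d 3 (fst u))\<^sup>2 * snd u ^ 6)
      + (- (1 / 24) * ((d 1 (fst u) * d 2 (fst u) * d 3 (fst u)) * snd u ^ 4)
      + 1 / 16 * ((d 1 (fst u) * d 2 (fst u))\<^sup>2 * snd u ^ 2)) \<partial>P)"
    by (rule Bochner_Integration.integral_cong) (auto simp: C_def field_simps eval_nat_numeral)
  also have "\<dots> = 1 / 144 * (\<integral>u. (d 3 (fst u))\<^sup>2 * snd u ^ 6 \<partial>P)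
      + (- (1 / 24) * (\<integral>u. (d 1 (fst u) * d 2 (fst u) * d 3 (fst u)) * snd u ^ 4 \<partial>P)
      + 1 / 16 * (\<integral>u. (d 1 (fst u) * d 2 (fst u))\<^sup>2 * snd u ^ 2 \<partial>P))"
    using t6(1) t4(1) t2(1) by (subst Bochner_Integration.integral_add; simp)+
  \<comment> \<open>The Gaussian moments 15, 3 and 1 of orders 6, 4 and 2 turn the coefficients
    \<open>1 / 144\<close>, \<open>- 1 / 24\<close>, \<open>1 / 16\<close> into these.\<close>
  also have "\<dots> = 5 / 48 * (\<integral>x. (d 3 x)\<^sup>2 \<partial>F) - 1 / 8 * (\<integral>x. d 1 x * d 2 x * d 3 x \<partial>F)
      + 1 / 16 * (\<integral>x. (d 1 x * d 2 x)\<^sup>2 \<partial>F)"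
    unfolding t6(2) t4(2) t2(2) m2 m4 m6 by simp
  finally have EC: "(\<integral>u. (C u)\<^sup>2 \<partial>P) = 5 / 48 * (\<integral>x. (d 3 x)\<^sup>2 \<partial>F) - 1 / 8 * (\<integral>x. d 1 x * d 2 x * d 3 x \<partial>F)
      + 1 / 16 * (\<integral>x. (d 1 x * d 2 x)\<^sup>2 \<partial>F)" .
  have "(\<integral>x. (d 1 x * d 2 x)\<^sup>2 \<partial>F) = (\<integral>x. d 2 x ^ 3 \<partial>F) + 2 * (\<integral>x. d 1 x * d 2 x * d 3 x \<partial>F)"
    unfolding expectation_g'_g''_square using int by simp
  then have "(\<integral>u. (C u)\<^sup>2 \<partial>P) = 1 / 48 * (3 * (\<integral>x. d 2 x ^ 3 \<partial>F) + 5 * (\<integral>x. (d 3 x)\<^sup>2 \<partial>F))"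
  proof -
    have "5 / 48 * B - 1 / 8 * C + 1 / 16 * D = 1 / 48 * (3 * A + 5 * B)" if "D = A + 2 * C" for A B C D :: real
      using that by (simp add: field_simps)
    from this[OF \<open>(\<integral>x. (d 1 x * d 2 x)\<^sup>2 \<partial>F) = _\<close>] show ?thesis unfolding EC .
  qed
  also have "\<dots> = 1 / 48 * (\<integral>x. 3 * d 2 x ^ 3 + 5 * (d 3 x)\<^sup>2 \<partial>F)" using int by simp
  finally show "(\<integral>u. (C u)\<^sup>2 \<partial>P) = K_SLA f g"
    unfolding K_SLA_def dens_expectation_def F_def d_def .
  have "(\<integral>x. (d 1 x * d 2 x)\<^sup>2 \<partial>F) \<noteq> 0"
  proof
    assume "(\<integral>x. (d 1 x * d 2 x)\<^sup>2 \<partial>F) = 0"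
    then have "AE x in F. (d 1 x * d 2 x)\<^sup>2 = 0" using integral_nonneg_eq_0_iff_AE[OF int(3)] by simp
    then have "AE x in F. d 1 x * d 2 x = 0" by eventually_elim simp
    then show False using not_AE_g'_g''_eq_0 by blast
  qed
  moreover have "(\<integral>x. (d 1 x * d 2 x)\<^sup>2 \<partial>F) \<ge> 0" by simp
  ultimately have pos: "(\<integral>x. (d 1 x * d 2 x)\<^sup>2 \<partial>F) > 0" by (metis order_le_less)
  \<comment> \<open>Completing the square in \<open>g'''\<close> leaves
    \<open>1 / 16 - 3 / 80 = 1 / 40\<close> as coefficient of
    \<open>(g' * g'')\<^sup>2\<close>.\<close>
  have "1 / 40 * (\<integral>x. (d 1 x * d 2 x)\<^sup>2 \<partial>F) = (\<integral>x. 1 / 40 * (d 1 x * d 2 x)\<^sup>2 \<partial>F)" by simp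
  also have "\<dots> \<le> (\<integral>x. 5 / 48 * (d 3 x)\<^sup>2 - 1 / 8 * (d 1 x * d 2 x * d 3 x) + 1 / 16 * (d 1 x * d 2 x)\<^sup>2 \<partial>F)"
  proof (rule integral_mono)
    fix x
    have "0 \<le> 5 / 48 * (d 3 x - 3 / 5 * (d 1 x * d 2 x))\<^sup>2" by simp
    then show "1 / 40 * (d 1 x * d 2 x)\<^sup>2 \<le> 5 / 48 * (d 3 x)\<^sup>2 - 1 / 8 * (d 1 x * d 2 x * d 3 x) + 1 / 16 * (d 1 x * d 2 x)\<^sup>2"
      by (simp add: power2_eq_square algebra_simps)
  qed (use int in auto)
  also have "\<dots> = (\<integral>u. (C u)\<^sup>2 \<partial>P)" unfolding EC using int by simp
  finally show "(\<integral>u. (C u)\<^sup>2 \<partial>P) > 0" using pos by linarith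
qed

text \<open>The fifth power is the highest that the SLA remainder produces; since
  \<open>V \<ge> 1\<close>, it dominates the lower powers as well, so one envelope suits both
  algorithms.\<close>

lemma balanced_stepI:
  fixes b :: "real \<Rightarrow> real" and C V :: "real \<times> real \<Rightarrow> real"
  assumes [measurable]: "b \<in> borel_measurable borel" "C \<in> borel_measurable borel" "V \<in> borel_measurable borel"
    and "\<And>j. integrable P (\<lambda>u. V u ^ j)" "\<And>u. V u \<ge> 1" "\<And>u. \<bar>fst u\<bar> \<le> V u" "\<And>u. \<bar>C u\<bar> \<le> V u ^ 5"
    and "\<And>\<epsilon> u. 0 < \<epsilon> \<Longrightarrow> \<epsilon> \<le> 1 \<Longrightarrow> \<bar>step b \<epsilon> u - fst u\<bar> \<le> \<epsilon> * V u ^ 5"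
    and "\<And>\<epsilon> u. 0 < \<epsilon> \<Longrightarrow> \<epsilon> \<le> 1 \<Longrightarrow>
      \<bar>log_ratio b \<epsilon> (fst u) (step b \<epsilon> u) - \<epsilon> ^ k * C u\<bar> \<le> \<epsilon> ^ (k + 1) * V u ^ 5"
    and "k \<ge> 1" "(\<integral>u. (C u)\<^sup>2 \<partial>P) > 0"
  shows "balanced_step P (\<lambda>\<epsilon> u. log_ratio b \<epsilon> (fst u) (step b \<epsilon> u)) (step b) C (\<lambda>u. V u ^ 5) k"
proof -
  have prod: "prob_space P" unfolding P_def by (rule P.prob_space_axioms)
  have ge1: "V u ^ 5 \<ge> V u" for u using power_increasing[of 1 5 "V u"] assms(5)[of u] by simp
  show ?thesis
  proof (intro balanced_step.intro prod balanced_step_axioms.intro)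
    show "sets P = sets borel" unfolding borel_prod[symmetric] by (rule sets_P)
    show "(\<lambda>u. log_ratio b \<epsilon> (fst u) (step b \<epsilon> u)) \<in> borel_measurable borel" "step b \<epsilon> \<in> borel_measurable borel" for \<epsilon>
      unfolding borel_prod[symmetric] by measurable
    show "integrable P (\<lambda>u. (V u ^ 5) ^ j)" for j using assms(4)[of "5 * j"] by (simp add: power_mult)
    show "V u ^ 5 \<ge> 1" for u using assms(5)[of u] by simp
    show "\<bar>fst u\<bar> \<le> V u ^ 5" for u using ge1[of u] assms(6)[of u] by linarith
  qed (use assms step_balance in auto)
qed

lemma rwm_balanced_step:
  obtains W where "balanced_step P (\<lambda>\<epsilon> u. log_ratio (\<lambda>_. 0) \<epsilon> (fst u) (step (\<lambda>_. 0) \<epsilon> u)) (step (\<lambda>_. 0))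
    (\<lambda>u. - snd u * d 1 (fst u)) W 1"
proof -
  obtain V where V [measurable]: "V \<in> borel_measurable borel" and "\<And>j. integrable P (\<lambda>u. V u ^ j)"
    and V1: "\<And>u. V u \<ge> 1" and "\<And>u. \<bar>fst u\<bar> \<le> V u" and zV: "\<And>u. \<bar>snd u\<bar> + \<bar>d 1 (fst u)\<bar> \<le> V u"
    and dV: "\<And>j u t. j \<le> 4 \<Longrightarrow> \<bar>t\<bar> \<le> \<bar>snd u\<bar> + \<bar>d 1 (fst u)\<bar> \<Longrightarrow> \<bar>d j (fst u + t)\<bar> \<le> V u"
    using d_envelope by blast
  have z: "\<bar>snd u\<bar> \<le> V u" "\<bar>d 1 (fst u)\<bar> \<le> V u" for u using zV[of u] by linarith+
  have pow: "V u ^ i \<le> V u ^ 5" if "i \<le> 5" for u i using that V1[of u] by (intro power_increasing)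
  have V0: "V u \<ge> 0" for u using V1[of u] by linarith
  show ?thesis
  proof (rule that, rule balanced_stepI[where V = V])
    show "(\<lambda>u. - snd u * d 1 (fst u)) \<in> borel_measurable borel"
      unfolding borel_prod[symmetric] by measurable
    show "\<bar>- snd u * d 1 (fst u)\<bar> \<le> V u ^ 5" for u
    proof -
      have "\<bar>- snd u * d 1 (fst u)\<bar> \<le> V u * V u"
        unfolding abs_mult abs_minus using z[of u] V0[of u] by (intro mult_mono) auto
      then show ?thesis using pow[of 2 u] by (simp add: power2_eq_square)
    qed
    fix \<epsilon> :: real and u :: "real \<times> real"
    assume \<epsilon>: "0 < \<epsilon>" "\<epsilon> \<le> 1"
    show "\<bar>step (\<lambda>_. 0) \<epsilon> u - fst u\<bar> \<le> \<epsilon> * V u ^ 5"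
      using \<epsilon> z[of u] pow[of 1 u] by (simp add: step_def abs_mult)
    have "\<bar>\<epsilon> * snd u\<bar> \<le> \<bar>snd u\<bar>" using \<epsilon> by (simp add: abs_mult mult_left_le_one_le)
    obtain t where t: "\<bar>t\<bar> \<le> \<bar>\<epsilon> * snd u\<bar>"
      and taylor: "d 0 (fst u + \<epsilon> * snd u) = (\<Sum>m<2. d (0 + m) (fst u) / fact m * (\<epsilon> * snd u) ^ m)
        + d (0 + 2) (fst u + t) / fact 2 * (\<epsilon> * snd u) ^ 2"
      by (rule d_Taylor[where x = "fst u" and h = "\<epsilon> * snd u" and j = 0 and n = 2])
    have "log_ratio (\<lambda>_. 0) \<epsilon> (fst u) (step (\<lambda>_. 0) \<epsilon> u) = g (fst u) - g (fst u + \<epsilon> * snd u)"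
      by (simp add: log_ratio_def step_def)
    also have "\<dots> = - (\<epsilon> * snd u * d 1 (fst u)) - d 2 (fst u + t) / 2 * (\<epsilon> * snd u)\<^sup>2"
      using taylor by (simp add: d_0 numeral_2_eq_2)
    finally have "log_ratio (\<lambda>_. 0) \<epsilon> (fst u) (step (\<lambda>_. 0) \<epsilon> u) - \<epsilon> ^ 1 * (- snd u * d 1 (fst u))
        = - (d 2 (fst u + t) / 2 * (\<epsilon> * snd u)\<^sup>2)" by simp
    also have "\<bar>\<dots>\<bar> = \<epsilon>\<^sup>2 * (\<bar>d 2 (fst u + t)\<bar> / 2 * \<bar>snd u\<bar>\<^sup>2)"
      by (simp add: abs_mult power_mult_distrib)
    also have "\<dots> \<le> \<epsilon>\<^sup>2 * (V u * V u ^ 2)"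
    proof (intro mult_left_mono mult_mono power_mono)
      have "\<bar>d 2 (fst u + t)\<bar> \<le> V u" using t \<open>\<bar>\<epsilon> * snd u\<bar> \<le> \<bar>snd u\<bar>\<close> by (intro dV) auto
      then show "\<bar>d 2 (fst u + t)\<bar> / 2 \<le> V u" using V0[of u] by linarith
    qed (use z V0 in auto)
    also have "\<dots> \<le> \<epsilon>\<^sup>2 * V u ^ 5"
      using pow[of 3 u] by (intro mult_left_mono) (auto simp: eval_nat_numeral)
    finally show "\<bar>log_ratio (\<lambda>_. 0) \<epsilon> (fst u) (step (\<lambda>_. 0) \<epsilon> u) - \<epsilon> ^ 1 * (- snd u * d 1 (fst u))\<bar>
        \<le> \<epsilon> ^ (1 + 1) * V u ^ 5" by (simp add: power2_eq_square)
  next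
    show "0 < (\<integral>u. (- snd u * d 1 (fst u))\<^sup>2 \<partial>P)"
      using expectation_g'_square_pos unfolding rwm_expectation
      by (simp add: K_RWM_def dens_expectation_def F_def d_def)
  qed (fact | simp)+
qed

lemma sla_balanced_step:
  obtains W where "balanced_step P
    (\<lambda>\<epsilon> u. log_ratio (\<lambda>x. - d 1 x / 2) \<epsilon> (fst u) (step (\<lambda>x. - d 1 x / 2) \<epsilon> u)) (step (\<lambda>x. - d 1 x / 2))
    (\<lambda>u. snd u ^ 3 * d 3 (fst u) / 12 - snd u * d 1 (fst u) * d 2 (fst u) / 4) W 3"
proof -
  obtain V where V [measurable]: "V \<in> borel_measurable borel" and "\<And>j. integrable P (\<lambda>u. V u ^ j)"
    and V1: "\<And>u. V u \<ge> 1" and "\<And>u. \<bar>fst u\<bar> \<le> V u" and zV: "\<And>u. \<bar>snd u\<bar> + \<bar>d 1 (fst u)\<bar> \<le> V u"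
    and dV: "\<And>j u t. j \<le> 4 \<Longrightarrow> \<bar>t\<bar> \<le> \<bar>snd u\<bar> + \<bar>d 1 (fst u)\<bar> \<Longrightarrow> \<bar>d j (fst u + t)\<bar> \<le> V u"
    using d_envelope by blast
  have z: "\<bar>snd u\<bar> \<le> V u" "\<bar>d 1 (fst u)\<bar> \<le> V u" for u using zV[of u] by linarith+
  have dV0: "\<bar>d j (fst u)\<bar> \<le> V u" if "j \<le> 4" for j u using dV[OF that, of 0 u] by simp
  have pow: "V u ^ i \<le> V u ^ 5" if "i \<le> 5" for u i using that V1[of u] by (intro power_increasing)
  have V0: "V u \<ge> 0" for u using V1[of u] by linarith
  let ?b = "\<lambda>x. - d 1 x / 2"
  show ?thesis
  proof (rule that, rule balanced_stepI[where V = V])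
    show "(\<lambda>u. snd u ^ 3 * d 3 (fst u) / 12 - snd u * d 1 (fst u) * d 2 (fst u) / 4) \<in> borel_measurable borel"
      unfolding borel_prod[symmetric] by measurable
    show "\<bar>snd u ^ 3 * d 3 (fst u) / 12 - snd u * d 1 (fst u) * d 2 (fst u) / 4\<bar> \<le> V u ^ 5" for u
    proof -
      have "\<bar>snd u ^ 3 * d 3 (fst u)\<bar> \<le> V u ^ 3 * V u"
        unfolding abs_mult power_abs using z[of u] V0[of u] dV0[of 3 u] by (intro mult_mono power_mono) auto
      moreover have "\<bar>snd u * d 1 (fst u) * d 2 (fst u)\<bar> \<le> V u * V u * V u"
        unfolding abs_mult using z[of u] V0[of u] dV0[of 2 u] by (intro mult_mono) auto
      moreover have "V u ^ 3 * V u \<le> V u ^ 5" "V u * V u * V u \<le> V u ^ 5"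
        using pow[of 4 u] pow[of 3 u] by (simp_all add: eval_nat_numeral mult_ac)
      moreover have "0 \<le> V u ^ 5" using V0 by simp
      ultimately show ?thesis by linarith
    qed
    fix \<epsilon> :: real and u :: "real \<times> real"
    assume \<epsilon>: "0 < \<epsilon>" "\<epsilon> \<le> 1"
    define x where "x = fst u"
    define h where "h = \<epsilon> * snd u - \<epsilon>\<^sup>2 / 2 * d 1 x"
    have step: "step ?b \<epsilon> u = x + h" by (simp add: step_def h_def x_def)
    have \<epsilon>2: "\<epsilon>\<^sup>2 \<le> \<epsilon>" "\<epsilon>\<^sup>2 \<le> 1" using \<epsilon> by (auto simp: power2_eq_square mult_left_le mult_le_one)
    have h_le: "\<bar>h\<bar> \<le> \<epsilon> * (\<bar>snd u\<bar> + \<bar>d 1 x\<bar>)"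
    proof -
      have "\<epsilon>\<^sup>2 / 2 * \<bar>d 1 x\<bar> \<le> \<epsilon> * \<bar>d 1 x\<bar>" using \<epsilon> \<epsilon>2 by (intro mult_right_mono) auto
      then show ?thesis
        unfolding h_def using \<epsilon> abs_triangle_ineq4[of "\<epsilon> * snd u" "\<epsilon>\<^sup>2 / 2 * d 1 x"]
        by (simp add: abs_mult distrib_left)
    qed
    also have "\<dots> \<le> \<epsilon> * V u" using \<epsilon> zV[of u] by (intro mult_left_mono) (auto simp: x_def)
    also have "\<dots> \<le> \<epsilon> * V u ^ 5" using \<epsilon> pow[of 1 u] by (intro mult_left_mono) auto
    finally show "\<bar>step ?b \<epsilon> u - fst u\<bar> \<le> \<epsilon> * V u ^ 5" unfolding step by (simp add: x_def)
    have h_le': "\<bar>h\<bar> \<le> \<bar>snd u\<bar> + \<bar>d 1 x\<bar>"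
      using h_le mult_right_mono[OF \<epsilon>(2), of "\<bar>snd u\<bar> + \<bar>d 1 x\<bar>"] by simp
    have dt: "\<bar>d j (x + t)\<bar> \<le> V u" if "j \<le> 4" "\<bar>t\<bar> \<le> \<bar>h\<bar>" for j t
      unfolding x_def using that h_le' by (intro dV) (auto simp: x_def)
    \<comment> \<open>\<open>g\<close> is expanded to order 4, \<open>g'\<close> to orders 3, 1 and
      2: the first two for the trapezoidal error, the others for the square of the increment of
      \<open>g'\<close> and for the increment itself.\<close>
    obtain s1 where s1: "\<bar>s1\<bar> \<le> \<bar>h\<bar>" "d 0 (x + h) = (\<Sum>m<4. d (0 + m) x / fact m * h ^ m) + d (0 + 4) (x + s1) / fact 4 * h ^ 4"
      by (rule d_Taylor)
    obtain s2 where s2: "\<bar>s2\<bar> \<le> \<bar>h\<bar>" "d 1 (x + h) = (\<Sum>m<3. d (1 + m) x / fact m * h ^ m) + d (1 + 3) (x + s2) / fact 3 * h ^ 3"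
      by (rule d_Taylor)
    obtain s3 where s3: "\<bar>s3\<bar> \<le> \<bar>h\<bar>" "d 1 (x + h) = (\<Sum>m<1. d (1 + m) x / fact m * h ^ m) + d (1 + 1) (x + s3) / fact 1 * h ^ 1"
      by (rule d_Taylor)
    obtain s4 where s4: "\<bar>s4\<bar> \<le> \<bar>h\<bar>" "d 1 (x + h) = (\<Sum>m<2. d (1 + m) x / fact m * h ^ m) + d (1 + 2) (x + s4) / fact 2 * h ^ 2"
      by (rule d_Taylor)
    have "log_ratio ?b \<epsilon> x (x + h) = g x - g (x + h) + h * (d 1 x + d 1 (x + h)) / 2
        + \<epsilon>\<^sup>2 / 8 * ((d 1 x)\<^sup>2 - (d 1 (x + h))\<^sup>2)"
      using \<epsilon> by (simp add: log_ratio_def field_simps power2_eq_square)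
    moreover have "\<bar>(g x - g (x + h) + h * (d 1 x + d 1 (x + h)) / 2 + \<epsilon>\<^sup>2 / 8 * ((d 1 x)\<^sup>2 - (d 1 (x + h))\<^sup>2))
        - \<epsilon> ^ 3 * (snd u ^ 3 * d 3 x / 12 - snd u * d 1 x * d 2 x / 4)\<bar> \<le> \<epsilon> ^ 4 * V u ^ 5"
    proof (rule sla_remainder[where h = h and ?t2.0 = "d 2 (x + s3)" and ?t3.0 = "d 3 (x + s4)"
          and ?t4.0 = "d 4 (x + s1)" and t4' = "d 4 (x + s2)"])
      show "\<bar>snd u\<bar> + \<bar>d 1 x\<bar> \<le> V u" using zV[of u] by (simp add: x_def)
      show "\<bar>d 2 x\<bar> \<le> V u" "\<bar>d 3 x\<bar> \<le> V u" using dV0 by (auto simp: x_def)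
      show "\<bar>d 2 (x + s3)\<bar> \<le> V u" "\<bar>d 3 (x + s4)\<bar> \<le> V u" "\<bar>d 4 (x + s1)\<bar> \<le> V u" "\<bar>d 4 (x + s2)\<bar> \<le> V u"
        using s1 s2 s3 s4 by (auto intro!: dt)
      show "g (x + h) = g x + h * d 1 x + h\<^sup>2 / 2 * d 2 x + h ^ 3 / 6 * d 3 x + h ^ 4 / 24 * d 4 (x + s1)"
        using s1(2) by (simp add: d_0 eval_nat_numeral fact_numeral mult_ac)
      show "d 1 (x + h) = d 1 x + h * d 2 x + h\<^sup>2 / 2 * d 3 x + h ^ 3 / 6 * d 4 (x + s2)"
        using s2(2) by (simp add: eval_nat_numeral fact_numeral mult_ac)
      show "d 1 (x + h) = d 1 x + h * d 2 (x + s3)"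
        using s3(2) by (simp add: numeral_2_eq_2 mult_ac)
      show "d 1 (x + h) = d 1 x + h * d 2 x + h\<^sup>2 / 2 * d 3 (x + s4)"
        using s4(2) by (simp add: eval_nat_numeral fact_numeral mult_ac)
    qed (use \<epsilon> V1 h_def in auto)
    ultimately show "\<bar>log_ratio ?b \<epsilon> (fst u) (step ?b \<epsilon> u)
        - \<epsilon> ^ 3 * (snd u ^ 3 * d 3 (fst u) / 12 - snd u * d 1 (fst u) * d 2 (fst u) / 4)\<bar> \<le> \<epsilon> ^ (3 + 1) * V u ^ 5"
      unfolding step x_def by simp
  next
    show "0 < (\<integral>u. (snd u ^ 3 * d 3 (fst u) / 12 - snd u * d 1 (fst u) * d 2 (fst u) / 4)\<^sup>2 \<partial>P)"
      by (rule sla_expectation(2))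
    show "?b \<in> borel_measurable borel" by measurable
  qed (fact | simp)+
qed

end

section \<open>The expected acceptance probability on the product space\<close>

text \<open>A pair of independent product vectors is a vector of independent pairs. The sets
  \<open>E i\<close> need not be rectangles, so the value on a box is computed by Tonelli, first
  over all second components and then over all first ones.\<close>

lemma distr_zip_PiM:
  fixes I :: "'i set" and A :: "'a measure" and B :: "'b measure"
  assumes I: "finite I" and A: "prob_space A" and B: "prob_space B"
  shows "distr (PiM I (\<lambda>_. A) \<Otimes>\<^sub>M PiM I (\<lambda>_. B)) (PiM I (\<lambda>_. A \<Otimes>\<^sub>M B)) (\<lambda>(x, z). \<lambda>i\<in>I. (x i, z i))
    = PiM I (\<lambda>_. A \<Otimes>\<^sub>M B)"
proof -
  interpret AB: pair_prob_space A B
    using A B by (intro pair_prob_space.intro pair_sigma_finite.intro prob_space_imp_sigma_finite)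
  interpret A: product_prob_space "\<lambda>_. A" I by (intro product_prob_spaceI A)
  interpret B: product_prob_space "\<lambda>_. B" I by (intro product_prob_spaceI B)
  interpret P: product_prob_space "\<lambda>_. A \<Otimes>\<^sub>M B" I by (intro product_prob_spaceI AB.prob_space_axioms)
  let ?Z = "\<lambda>(x, z). \<lambda>i\<in>I. (x i, z i)"
  have Z [measurable]: "?Z \<in> PiM I (\<lambda>_. A) \<Otimes>\<^sub>M PiM I (\<lambda>_. B) \<rightarrow>\<^sub>M PiM I (\<lambda>_. A \<Otimes>\<^sub>M B)"
    by measurable
  show ?thesis
  proof (rule P.PiM_eqI)
    show "finite I" by fact
    show "sets (distr (PiM I (\<lambda>_. A) \<Otimes>\<^sub>M PiM I (\<lambda>_. B)) (PiM I (\<lambda>_. A \<Otimes>\<^sub>M B)) ?Z) = sets (PiM I (\<lambda>_. A \<Otimes>\<^sub>M B))"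
      by simp
    fix E assume E [measurable]: "\<And>i. i \<in> I \<Longrightarrow> E i \<in> sets (A \<Otimes>\<^sub>M B)"
    have E_PiE [measurable]: "Pi\<^sub>E I E \<in> sets (PiM I (\<lambda>_. A \<Otimes>\<^sub>M B))"
      using E I by (intro sets_PiM_I_finite) auto
    let ?G = "\<lambda>x z. \<Prod>i\<in>I. indicator (E i) (x i, z i) :: ennreal"
    have G_meas: "(\<lambda>(x, z). ?G x z) \<in> borel_measurable (PiM I (\<lambda>_. A) \<Otimes>\<^sub>M PiM I (\<lambda>_. B))"
      by measurable
    have "emeasure (distr (PiM I (\<lambda>_. A) \<Otimes>\<^sub>M PiM I (\<lambda>_. B)) (PiM I (\<lambda>_. A \<Otimes>\<^sub>M B)) ?Z) (Pi\<^sub>E I E)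
        = (\<integral>\<^sup>+u. indicator (Pi\<^sub>E I E) (?Z u) \<partial>(PiM I (\<lambda>_. A) \<Otimes>\<^sub>M PiM I (\<lambda>_. B)))"
      by (simp add: nn_integral_distr flip: nn_integral_indicator)
    also have "\<dots> = (\<integral>\<^sup>+u. (case u of (x, z) \<Rightarrow> ?G x z) \<partial>(PiM I (\<lambda>_. A) \<Otimes>\<^sub>M PiM I (\<lambda>_. B)))"
    proof (rule nn_integral_cong)
      fix u :: "('i \<Rightarrow> 'a) \<times> ('i \<Rightarrow> 'b)"
      obtain x z where u: "u = (x, z)" by (cases u)
      have "indicator (Pi\<^sub>E I E) (\<lambda>i\<in>I. (x i, z i)) = ?G x z"
        using I by (auto simp: indicator_def PiE_iff prod_zero_iff)
      then show "indicator (Pi\<^sub>E I E) (?Z u) = (case u of (x, z) \<Rightarrow> ?G x z)" by (simp add: u)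
    qed
    also have "\<dots> = (\<integral>\<^sup>+x. \<integral>\<^sup>+z. ?G x z \<partial>PiM I (\<lambda>_. B) \<partial>PiM I (\<lambda>_. A))"
      by (subst B.P.nn_integral_fst[symmetric, OF G_meas]) simp
    also have "\<dots> = (\<integral>\<^sup>+x. (\<Prod>i\<in>I. \<integral>\<^sup>+z. indicator (E i) (x i, z) \<partial>B) \<partial>PiM I (\<lambda>_. A))"
    proof (rule nn_integral_cong)
      fix x assume x: "x \<in> space (PiM I (\<lambda>_. A))"
      show "(\<integral>\<^sup>+z. ?G x z \<partial>PiM I (\<lambda>_. B)) = (\<Prod>i\<in>I. \<integral>\<^sup>+z. indicator (E i) (x i, z) \<partial>B)"
      proof (rule B.product_nn_integral_prod[OF I])
        fix i assume i: "i \<in> I"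
        then have "x i \<in> space A" using x by (auto simp: space_PiM)
        then show "(\<lambda>z. indicator (E i) (x i, z) :: ennreal) \<in> borel_measurable B"
          using E[OF i] by measurable
      qed
    qed
    also have "\<dots> = (\<Prod>i\<in>I. \<integral>\<^sup>+x. \<integral>\<^sup>+z. indicator (E i) (x, z) \<partial>B \<partial>A)"
      using I E by (intro A.product_nn_integral_prod) (auto intro!: AB.M2.borel_measurable_nn_integral_fst)
    also have "\<dots> = (\<Prod>i\<in>I. emeasure (A \<Otimes>\<^sub>M B) (E i))"
      using E by (intro prod.cong refl) (simp add: AB.M2.nn_integral_fst)
    finally show "emeasure (distr (PiM I (\<lambda>_. A) \<Otimes>\<^sub>M PiM I (\<lambda>_. B)) (PiM I (\<lambda>_. A \<Otimes>\<^sub>M B)) ?Z) (Pi\<^sub>E I E)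
        = (\<Prod>i\<in>I. emeasure (A \<Otimes>\<^sub>M B) (E i))" .
  qed
qed

lemma normal_density_scale:
  assumes "c > 0"
  shows "normal_density (c * m) (c * s) (c * y) = normal_density m s y / c"
proof -
  have "(c * y - c * m)\<^sup>2 / (2 * (c * s)\<^sup>2) = (y - m)\<^sup>2 / (2 * s\<^sup>2)"
    using assms by (simp add: power_mult_distrib flip: right_diff_distrib)
  then have "exp (- (c * y - c * m)\<^sup>2 / (2 * (c * s)\<^sup>2)) = exp (- (y - m)\<^sup>2 / (2 * s\<^sup>2))" by simp
  moreover have "sqrt (2 * pi * (c * s)\<^sup>2) = c * sqrt (2 * pi * s\<^sup>2)"
    using assms by (simp add: power_mult_distrib real_sqrt_mult)
  ultimately show ?thesis by (simp add: normal_density_def)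
qed

section \<open>Transport of the target problem to the product space\<close>

context smooth_density
begin

lemma distr_F_scale:
  assumes c: "c > 0"
  shows "distr F lborel (\<lambda>x. c * x) = density lborel (\<lambda>x. ennreal (inverse c * f (x / c)))"
proof (rule measure_eqI)
  fix A assume "A \<in> sets (distr F lborel (\<lambda>x. c * x))"
  then have [measurable]: "A \<in> sets borel" by simp
  have "emeasure (density lborel (\<lambda>x. ennreal (inverse c * f (x / c)))) A
      = (\<integral>\<^sup>+x. ennreal (inverse c * f (x / c)) * indicator A x \<partial>lborel)"
    by (subst emeasure_density) auto
  also have "\<dots> = \<bar>c\<bar> * (\<integral>\<^sup>+x. ennreal (inverse c * f ((0 + c * x) / c)) * indicator A (0 + c * x) \<partial>lborel)"
    by (rule nn_integral_real_affine) (use c in auto)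
  also have "\<dots> = (\<integral>\<^sup>+x. ennreal c * (ennreal (inverse c * f x) * indicator A (c * x)) \<partial>lborel)"
    using c by (subst nn_integral_cmult) auto
  also have "\<dots> = (\<integral>\<^sup>+x. ennreal (f x) * indicator A (c * x) \<partial>lborel)"
    using c less_imp_le[OF f_pos] by (intro nn_integral_cong) (simp flip: mult.assoc ennreal_mult)
  also have "\<dots> = (\<integral>\<^sup>+x. indicator A (c * x) \<partial>F)"
    unfolding F_def by (subst nn_integral_density) auto
  also have "\<dots> = emeasure (distr F lborel (\<lambda>x. c * x)) A"
    by (simp add: nn_integral_distr flip: nn_integral_indicator)
  finally show "emeasure (distr F lborel (\<lambda>x. c * x)) A = emeasure (density lborel (\<lambda>x. ennreal (inverse c * f (x / c)))) A"
    by simp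
qed simp

lemma ref_measure_eq_distr:
  "ref_measure n \<kappa> f = distr (PiM {1..n} (\<lambda>_. F)) (Rn n) (\<lambda>x. \<lambda>i\<in>{1..n}. coord_scale \<kappa> i * x i)"
proof -
  \<comment> \<open>The componentwise lemmas ask for a probability density at every index, while
    \<open>coord_scale \<kappa> 0 = 0\<close>; index 0 lies outside \<open>{1..n}\<close> and may
    receive any positive scale.\<close>
  define c where "c i = (if i = 0 then 1 else coord_scale \<kappa> i)" for i
  have c: "c i > 0" for i by (simp add: c_def coord_scale_def)
  define h where "h i y = inverse (c i) * f (y / c i)" for i y
  have h_distr: "distr F lborel (\<lambda>x. c i * x) = density lborel (\<lambda>y. ennreal (h i y))" for i
    unfolding h_def by (rule distr_F_scale[OF c])
  have "distr (PiM {1..n} (\<lambda>_. F)) (PiM {1..n} (\<lambda>_. lborel)) (\<lambda>x. \<lambda>i\<in>{1..n}. c i * x i)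
      = PiM {1..n} (\<lambda>i. distr F lborel (\<lambda>x. c i * x))"
    by (rule distr_PiM_componentwise) (auto intro: F.prob_space_axioms)
  also have "\<dots> = density (PiM {1..n} (\<lambda>_. lborel)) (\<lambda>y. ennreal (\<Prod>i\<in>{1..n}. h i (y i)))"
    unfolding h_distr
  proof (rule PiM_density_lborel)
    show "h i \<in> borel_measurable lborel" for i unfolding h_def by measurable
    show "prob_space (density lborel (\<lambda>y. ennreal (h i y)))" for i
      unfolding h_distr[symmetric] by (rule F.prob_space_distr) simp
    show "0 \<le> h i y" for i y using c[of i] f_pos[of "y / c i"] by (simp add: h_def)
  qed simp
  also have "\<dots> = ref_measure n \<kappa> f"
    unfolding ref_measure_def Rn_def ref_density_def h_def c_def
    by (intro density_cong AE_I2 arg_cong[where f = ennreal] prod.cong) auto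
  finally show ?thesis
    unfolding Rn_def c_def by (simp cong: restrict_cong)
qed

lemma sets_std_gauss [measurable_cong]: "sets (std_gauss n) = sets (PiM {1..n} (\<lambda>_. borel))"
  unfolding std_gauss_def by (intro sets_PiM_cong) auto

lemma sets_Rn [measurable_cong]: "sets (Rn n) = sets (PiM {1..n} (\<lambda>_. borel))"
  unfolding Rn_def by (intro sets_PiM_cong) auto

lemma prob_space_std_gauss: "prob_space (std_gauss n)"
  unfolding std_gauss_def by (rule prob_space_PiM) (rule prob_space_N)

text \<open>Rescaling brings the reference measure to a power of \<open>F\<close>, zipping merges
  state and noise into pairs, and a finite power is the image of the infinite one under
  restriction.\<close>

lemma nn_integral_ref_measure:
  fixes T :: "(nat \<Rightarrow> real) \<times> (nat \<Rightarrow> real) \<Rightarrow> ennreal"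
  assumes T [measurable]: "T \<in> borel_measurable (Rn n \<Otimes>\<^sub>M std_gauss n)"
  shows "(\<integral>\<^sup>+x. \<integral>\<^sup>+z. T (x, z) \<partial>std_gauss n \<partial>ref_measure n \<kappa> f)
    = (\<integral>\<^sup>+\<omega>. T (\<lambda>i\<in>{1..n}. coord_scale \<kappa> i * fst (\<omega> i), \<lambda>i\<in>{1..n}. snd (\<omega> i)) \<partial>PiM UNIV (\<lambda>_. P))"
proof -
  interpret G: prob_space "std_gauss n" by (rule prob_space_std_gauss)
  interpret O: product_prob_space "\<lambda>_. P" UNIV
    by (intro product_prob_spaceI) (simp add: P_def P.prob_space_axioms)
  let ?I = "{1..n}"
  let ?s = "\<lambda>x. \<lambda>i\<in>?I. coord_scale \<kappa> i * x i"
  let ?T = "\<lambda>w. T (\<lambda>i\<in>?I. coord_scale \<kappa> i * fst (w i), \<lambda>i\<in>?I. snd (w i))"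
  have s [measurable]: "?s \<in> PiM ?I (\<lambda>_. F) \<rightarrow>\<^sub>M Rn n" unfolding Rn_def by measurable
  have fsts: "(\<lambda>w. \<lambda>i\<in>?I. coord_scale \<kappa> i * fst (w i)) \<in> PiM ?I (\<lambda>_. P) \<rightarrow>\<^sub>M Rn n"
    unfolding Rn_def by (rule measurable_restrict) measurable
  have snds: "(\<lambda>w. \<lambda>i\<in>?I. snd (w i)) \<in> PiM ?I (\<lambda>_. P) \<rightarrow>\<^sub>M std_gauss n"
    unfolding std_gauss_def by (rule measurable_restrict) measurable
  have T_meas: "?T \<in> borel_measurable (PiM ?I (\<lambda>_. P))"
    by (rule measurable_compose[OF measurable_Pair[OF fsts snds] T])
  have "(\<integral>\<^sup>+x. \<integral>\<^sup>+z. T (x, z) \<partial>std_gauss n \<partial>ref_measure n \<kappa> f)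
      = (\<integral>\<^sup>+x. \<integral>\<^sup>+z. T (?s x, z) \<partial>std_gauss n \<partial>PiM ?I (\<lambda>_. F))"
    unfolding ref_measure_eq_distr
    by (rule nn_integral_distr[OF s]) (use G.borel_measurable_nn_integral_fst[OF T] in simp)
  also have "\<dots> = (\<integral>\<^sup>+u. T (?s (fst u), snd u) \<partial>(PiM ?I (\<lambda>_. F) \<Otimes>\<^sub>M std_gauss n))"
  proof -
    have "(\<lambda>u. T (?s (fst u), snd u)) \<in> borel_measurable (PiM ?I (\<lambda>_. F) \<Otimes>\<^sub>M std_gauss n)"
      by (rule measurable_compose[OF measurable_Pair[OF measurable_compose[OF measurable_fst s] measurable_snd] T])
    then show ?thesis by (subst G.nn_integral_fst[symmetric]) auto
  qed
  also have "\<dots> = (\<integral>\<^sup>+u. ?T ((\<lambda>(x, z). \<lambda>i\<in>?I. (x i, z i)) u) \<partial>(PiM ?I (\<lambda>_. F) \<Otimes>\<^sub>M std_gauss n))"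
  proof (rule nn_integral_cong)
    \<comment> \<open>Noise vectors are extensional, so unzipping restores them exactly and not
      merely on \<open>{1..n}\<close>.\<close>
    fix u assume "u \<in> space (PiM ?I (\<lambda>_. F) \<Otimes>\<^sub>M std_gauss n)"
    then obtain x z where u: "u = (x, z)" and z: "z \<in> extensional ?I"
      by (auto simp: space_pair_measure std_gauss_def space_PiM PiE_def)
    have "(\<lambda>i\<in>?I. snd ((\<lambda>i\<in>?I. (x i, z i)) i)) = z" using z by (auto simp: extensional_def fun_eq_iff)
    moreover have "(\<lambda>i\<in>?I. coord_scale \<kappa> i * fst ((\<lambda>i\<in>?I. (x i, z i)) i)) = ?s x" by auto
    ultimately show "T (?s (fst u), snd u) = ?T ((\<lambda>(x, z). \<lambda>i\<in>?I. (x i, z i)) u)"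
      by (simp only: u fst_conv snd_conv prod.case)
  qed
  also have "\<dots> = (\<integral>\<^sup>+w. ?T w \<partial>distr (PiM ?I (\<lambda>_. F) \<Otimes>\<^sub>M std_gauss n) (PiM ?I (\<lambda>_. P)) (\<lambda>(x, z). \<lambda>i\<in>?I. (x i, z i)))"
  proof (rule nn_integral_distr[symmetric])
    show "(\<lambda>(x, z). \<lambda>i\<in>?I. (x i, z i)) \<in> PiM ?I (\<lambda>_. F) \<Otimes>\<^sub>M std_gauss n \<rightarrow>\<^sub>M PiM ?I (\<lambda>_. P)"
      unfolding std_gauss_def P_def by measurable
  qed (use T_meas in simp)
  also have "distr (PiM ?I (\<lambda>_. F) \<Otimes>\<^sub>M std_gauss n) (PiM ?I (\<lambda>_. P)) (\<lambda>(x, z). \<lambda>i\<in>?I. (x i, z i)) = PiM ?I (\<lambda>_. P)"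
    unfolding std_gauss_def P_def by (rule distr_zip_PiM) (auto intro: F.prob_space_axioms prob_space_N)
  also have "\<dots> = distr (PiM UNIV (\<lambda>_. P)) (PiM ?I (\<lambda>_. P)) (\<lambda>\<omega>. restrict \<omega> ?I)"
    by (rule O.distr_PiM_restrict_finite[symmetric]) auto
  also have "(\<integral>\<^sup>+w. ?T w \<partial>\<dots>) = (\<integral>\<^sup>+\<omega>. ?T (restrict \<omega> ?I) \<partial>PiM UNIV (\<lambda>_. P))"
    by (rule nn_integral_distr) (use T_meas in \<open>auto intro: measurable_restrict_subset\<close>)
  also have "\<dots> = (\<integral>\<^sup>+\<omega>. ?T \<omega> \<partial>PiM UNIV (\<lambda>_. P))"
    by (intro nn_integral_cong arg_cong[where f = T]) auto
  finally show ?thesis .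
qed

text \<open>In coordinate \<open>i\<close> division by the scale turns step size
  \<open>\<sigma>\<close> into \<open>\<sigma> * i powr \<kappa>\<close>; the Jacobians occur in
  numerator and denominator and cancel. All densities are strictly positive, so the default value 0
  of \<open>accept_prob\<close> never occurs.\<close>

lemma accept_prob_eq:
  assumes \<sigma>: "\<sigma> > 0"
    and mean: "\<And>x i. i \<in> {1..n} \<Longrightarrow> m x i = x i + \<sigma>\<^sup>2 / coord_scale \<kappa> i * b (x i / coord_scale \<kappa> i)"
  defines "y \<equiv> \<lambda>x z. \<lambda>i\<in>{1..n}. coord_scale \<kappa> i * step b (\<sigma> * real i powr \<kappa>) (x i / coord_scale \<kappa> i, z i)"
  shows "accept_prob (target_density n \<kappa> f \<phi>) (proposal_density n \<sigma> m) x (proposal n \<sigma> m x z)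
    = min 1 (exp (\<phi> x - \<phi> (y x z) + (\<Sum>i\<in>{0<..n}. log_ratio b (\<sigma> * real i powr \<kappa>)
        (x i / coord_scale \<kappa> i) (step b (\<sigma> * real i powr \<kappa>) (x i / coord_scale \<kappa> i, z i)))))"
proof -
  let ?c = "coord_scale \<kappa>" and ?e = "\<lambda>i. \<sigma> * real i powr \<kappa>"
  have c: "?c i > 0" "?e i > 0" "\<sigma> = ?c i * ?e i" if "i \<in> {1..n}" for i
    using that \<sigma> by (auto simp: coord_scale_def mult.left_commute simp flip: powr_add)
  have mean': "m x i = ?c i * (x i / ?c i + (?e i)\<^sup>2 * b (x i / ?c i))" if i: "i \<in> {1..n}" for x i
  proof -
    have "s\<^sup>2 / a = a * e\<^sup>2" if "a > 0" "s = a * e" for s a e :: real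
      using that by (simp add: power2_eq_square)
    from this[OF c(1)[OF i] c(3)[OF i]] show ?thesis unfolding mean[OF i] using c(1)[OF i] by (simp add: distrib_left)
  qed
  have proposal_eq: "proposal n \<sigma> m x z = y x z"
    unfolding proposal_def y_def
  proof (rule restrict_ext)
    fix i assume i: "i \<in> {1..n}"
    have "\<sigma> * z i = (?c i * ?e i) * z i" by (rule arg_cong[OF c(3)[OF i]])
    also have "\<dots> = ?c i * (?e i * z i)" by (rule mult.assoc)
    finally show "m x i + \<sigma> * z i = ?c i * step b (?e i) (x i / ?c i, z i)"
      unfolding mean'[OF i] by (simp add: step_def distrib_left)
  qed
  define p where "p x i = inverse (?c i) * f (x i / ?c i)" for x :: "nat \<Rightarrow> real" and i
  define q where "q x y i = normal_density (m x i) \<sigma> (y i)" for x y :: "nat \<Rightarrow> real" and i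
  have p_pos: "p x i > 0" and q_pos: "q x y i > 0" if "i \<in> {1..n}" for x y i
    using c[OF that] \<sigma> f_pos by (auto simp: p_def q_def intro!: normal_density_pos)
  have ratio: "p x i * q x y i * exp (log_ratio b (?e i) (x i / ?c i) (y i / ?c i)) = p y i * q y x i"
    if i: "i \<in> {1..n}" for x y :: "nat \<Rightarrow> real" and i
  proof -
    have q_scale: "q x y i = normal_density (x i / ?c i + (?e i)\<^sup>2 * b (x i / ?c i)) (?e i) (y i / ?c i) / ?c i" for x y
    proof -
      have "q x y i = normal_density (?c i * (x i / ?c i + (?e i)\<^sup>2 * b (x i / ?c i))) (?c i * ?e i) (?c i * (y i / ?c i))"
        unfolding q_def mean'[OF i] using c[OF i] by (simp flip: c(3)[OF i])
      then show ?thesis unfolding normal_density_scale[OF c(1)[OF i]] .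
    qed
    show ?thesis
      unfolding q_scale p_def using exp_log_ratio[OF c(2)[OF i], of "x i / ?c i" b "y i / ?c i"]
      by (simp add: field_simps)
  qed
  have target: "target_density n \<kappa> f \<phi> x * proposal_density n \<sigma> m x y = exp (- \<phi> x) * (\<Prod>i=1..n. p x i * q x y i)" for x y
    by (simp add: target_density_def ref_density_def proposal_density_def p_def q_def prod.distrib)
  have pos: "target_density n \<kappa> f \<phi> x * proposal_density n \<sigma> m x y > 0" for x y
    unfolding target using p_pos q_pos by (intro mult_pos_pos prod_pos) auto
  have "(target_density n \<kappa> f \<phi> y * proposal_density n \<sigma> m y x) / (target_density n \<kappa> f \<phi> x * proposal_density n \<sigma> m x y)
      = exp (\<phi> x - \<phi> y + (\<Sum>i\<in>{1..n}. log_ratio b (?e i) (x i / ?c i) (y i / ?c i)))" for x y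
  proof -
    have "(\<Prod>i=1..n. p y i * q y x i)
        = (\<Prod>i=1..n. p x i * q x y i) * exp (\<Sum>i\<in>{1..n}. log_ratio b (?e i) (x i / ?c i) (y i / ?c i))"
      by (simp add: exp_sum ratio flip: prod.distrib)
    then have "target_density n \<kappa> f \<phi> y * proposal_density n \<sigma> m y x
        = (target_density n \<kappa> f \<phi> x * proposal_density n \<sigma> m x y)
          * exp (\<phi> x - \<phi> y + (\<Sum>i\<in>{1..n}. log_ratio b (?e i) (x i / ?c i) (y i / ?c i)))"
      unfolding target by (simp add: exp_add exp_diff exp_minus field_simps)
    moreover have "u / v = w" if "u = v * w" "v > 0" for u v w :: real using that by simp
    ultimately show ?thesis using pos[of x y] by blast
  qed
  then have "accept_prob (target_density n \<kappa> f \<phi>) (proposal_density n \<sigma> m) x (y x z)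
      = min 1 (exp (\<phi> x - \<phi> (y x z) + (\<Sum>i\<in>{1..n}. log_ratio b (?e i) (x i / ?c i) (y x z i / ?c i))))"
    unfolding accept_prob_def using pos[of x "y x z"] by simp
  also have "(\<Sum>i\<in>{1..n}. log_ratio b (?e i) (x i / ?c i) (y x z i / ?c i))
      = (\<Sum>i\<in>{0<..n}. log_ratio b (?e i) (x i / ?c i) (step b (?e i) (x i / ?c i, z i)))"
  proof (rule sum.cong)
    show "{1..n} = {0<..n}" by auto
    fix i assume "i \<in> {0<..n}"
    then have i: "i \<in> {1..n}" by auto
    then show "log_ratio b (?e i) (x i / ?c i) (y x z i / ?c i) = log_ratio b (?e i) (x i / ?c i) (step b (?e i) (x i / ?c i, z i))"
      using c(1)[OF i] by (simp add: y_def)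
  qed
  finally show ?thesis unfolding proposal_eq .
qed

text \<open>The density of the target becomes a factor under the integral, and the remaining
  integral over reference measure and noise is moved to the infinite product.\<close>

lemma expected_acceptance_eq:
  assumes \<sigma>: "\<sigma> > 0" and b [measurable]: "b \<in> borel_measurable borel"
    and \<phi> [measurable]: "\<phi> \<in> borel_measurable (Rn n)"
    and mean: "\<And>x i. i \<in> {1..n} \<Longrightarrow> m x i = x i + \<sigma>\<^sup>2 / coord_scale \<kappa> i * b (x i / coord_scale \<kappa> i)"
  defines "x \<equiv> \<lambda>\<omega>. \<lambda>i\<in>{1..n}. coord_scale \<kappa> i * fst (\<omega> i)"
    and "y \<equiv> \<lambda>\<omega>. \<lambda>i\<in>{1..n}. coord_scale \<kappa> i * step b (\<sigma> * real i powr \<kappa>) (\<omega> i)"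
  shows "expected_acceptance n \<kappa> f \<phi> \<sigma> m = (\<integral>\<omega>. exp (- \<phi> (x \<omega>)) * min 1 (exp (\<phi> (x \<omega>) - \<phi> (y \<omega>)
    + (\<Sum>i\<in>{0<..n}. log_ratio b (\<sigma> * real i powr \<kappa>) (fst (\<omega> i)) (step b (\<sigma> * real i powr \<kappa>) (\<omega> i)))))
    \<partial>PiM UNIV (\<lambda>_. P))"
proof -
  interpret G: prob_space "std_gauss n" by (rule prob_space_std_gauss)
  let ?c = "coord_scale \<kappa>" and ?e = "\<lambda>i. \<sigma> * real i powr \<kappa>"
  define Y where "Y x z = (\<lambda>i\<in>{1..n}. ?c i * step b (?e i) (x i / ?c i, z i))" for x z :: "nat \<Rightarrow> real"
  \<comment> \<open>A form of the acceptance probability whose measurability in state and noise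
    jointly can be read off.\<close>
  define H where "H u = min 1 (exp (\<phi> (fst u) - \<phi> (Y (fst u) (snd u)) + (\<Sum>i\<in>{0<..n}. log_ratio b (?e i)
      (fst u i / ?c i) (step b (?e i) (fst u i / ?c i, snd u i)))))" for u :: "(nat \<Rightarrow> real) \<times> (nat \<Rightarrow> real)"
  have comp: "(\<lambda>u. fst u i) \<in> borel_measurable (Rn n \<Otimes>\<^sub>M std_gauss n)" "(\<lambda>u. snd u i) \<in> borel_measurable (Rn n \<Otimes>\<^sub>M std_gauss n)"
    if "i \<in> {1..n}" for i
  proof -
    have "(\<lambda>x. x i) \<in> borel_measurable (Rn n)" "(\<lambda>x. x i) \<in> borel_measurable (std_gauss n)"
      using that measurable_component_singleton[of i "{1..n}" "\<lambda>_. borel :: real measure"]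
      by (simp_all add: measurable_cong_sets[OF sets_Rn refl] measurable_cong_sets[OF sets_std_gauss refl])
    then show "(\<lambda>u. fst u i) \<in> borel_measurable (Rn n \<Otimes>\<^sub>M std_gauss n)" "(\<lambda>u. snd u i) \<in> borel_measurable (Rn n \<Otimes>\<^sub>M std_gauss n)"
      by measurable
  qed
  have step_meas: "(\<lambda>u. step b (?e i) (fst u i / ?c i, snd u i)) \<in> borel_measurable (Rn n \<Otimes>\<^sub>M std_gauss n)"
    if "i \<in> {1..n}" for i
    using comp[OF that] unfolding step_def by simp
  have Y_meas: "(\<lambda>u. Y (fst u) (snd u)) \<in> Rn n \<Otimes>\<^sub>M std_gauss n \<rightarrow>\<^sub>M Rn n"
    unfolding Y_def by (subst Rn_def) (rule measurable_restrict, use step_meas in simp)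
  have sum_meas: "(\<lambda>u. \<Sum>i\<in>{0<..n}. log_ratio b (?e i) (fst u i / ?c i) (step b (?e i) (fst u i / ?c i, snd u i)))
      \<in> borel_measurable (Rn n \<Otimes>\<^sub>M std_gauss n)"
  proof (rule borel_measurable_sum)
    fix i assume "i \<in> {0<..n}"
    then have "i \<in> {1..n}" by auto
    then show "(\<lambda>u. log_ratio b (?e i) (fst u i / ?c i) (step b (?e i) (fst u i / ?c i, snd u i)))
        \<in> borel_measurable (Rn n \<Otimes>\<^sub>M std_gauss n)"
      using comp step_meas by (intro log_ratio_measurable b) simp_all
  qed
  have H_meas [measurable]: "H \<in> borel_measurable (Rn n \<Otimes>\<^sub>M std_gauss n)"
    unfolding H_def using measurable_compose[OF Y_meas \<phi>] sum_meas by simp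
  have H: "0 \<le> H u" for u by (simp add: H_def)
  have sets_ref: "sets (ref_measure n \<kappa> f) = sets (Rn n)" by (simp add: ref_measure_def)
  have sets_target: "sets (target n \<kappa> f \<phi> \<Otimes>\<^sub>M std_gauss n) = sets (Rn n \<Otimes>\<^sub>M std_gauss n)"
    by (intro sets_pair_measure_cong) (simp_all add: target_def sets_ref)
  have exp_meas: "(\<lambda>x. ennreal (exp (- \<phi> x))) \<in> borel_measurable (Rn n)" by measurable
  have "expected_acceptance n \<kappa> f \<phi> \<sigma> m = (\<integral>u. H u \<partial>(target n \<kappa> f \<phi> \<Otimes>\<^sub>M std_gauss n))"
    unfolding expected_acceptance_def
  proof (rule Bochner_Integration.integral_cong[OF refl])
    fix u :: "(nat \<Rightarrow> real) \<times> (nat \<Rightarrow> real)"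
    obtain x z where u: "u = (x, z)" by (cases u)
    show "(case u of (x, z) \<Rightarrow> accept_prob (target_density n \<kappa> f \<phi>) (proposal_density n \<sigma> m) x (proposal n \<sigma> m x z)) = H u"
      unfolding u prod.case H_def Y_def fst_conv snd_conv
      by (rule accept_prob_eq[of \<sigma> n m \<kappa> b \<phi> x z, OF \<sigma> mean])
  qed
  \<comment> \<open>The chain runs through nonnegative integrals, where Tonelli and changes of
    density carry no integrability conditions, and returns to a Bochner integral at the end.\<close>
  also have "\<dots> = enn2real (\<integral>\<^sup>+u. ennreal (H u) \<partial>(target n \<kappa> f \<phi> \<Otimes>\<^sub>M std_gauss n))"
    using H_meas H by (intro integral_eq_nn_integral) (auto simp: measurable_cong_sets[OF sets_target refl])
  also have "(\<integral>\<^sup>+u. ennreal (H u) \<partial>(target n \<kappa> f \<phi> \<Otimes>\<^sub>M std_gauss n))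
      = (\<integral>\<^sup>+x. \<integral>\<^sup>+z. ennreal (H (x, z)) \<partial>std_gauss n \<partial>target n \<kappa> f \<phi>)"
    using H_meas by (intro G.nn_integral_fst[symmetric]) (auto simp: measurable_cong_sets[OF sets_target refl])
  also have "\<dots> = (\<integral>\<^sup>+x. ennreal (exp (- \<phi> x)) * (\<integral>\<^sup>+z. ennreal (H (x, z)) \<partial>std_gauss n) \<partial>ref_measure n \<kappa> f)"
    unfolding target_def
  proof (rule nn_integral_density)
    show "(\<lambda>x. ennreal (exp (- \<phi> x))) \<in> borel_measurable (ref_measure n \<kappa> f)"
      using exp_meas by (simp add: measurable_cong_sets[OF sets_ref refl])
    have "(\<lambda>x. \<integral>\<^sup>+z. ennreal (H (x, z)) \<partial>std_gauss n) \<in> borel_measurable (Rn n)"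
      by (rule G.borel_measurable_nn_integral_fst) (use H_meas in simp)
    then show "(\<lambda>x. \<integral>\<^sup>+z. ennreal (H (x, z)) \<partial>std_gauss n) \<in> borel_measurable (ref_measure n \<kappa> f)"
      by (simp add: measurable_cong_sets[OF sets_ref refl])
  qed
  also have "\<dots> = (\<integral>\<^sup>+x. \<integral>\<^sup>+z. ennreal (exp (- \<phi> (fst (x, z))) * H (x, z)) \<partial>std_gauss n \<partial>ref_measure n \<kappa> f)"
  proof (rule nn_integral_cong)
    fix x assume "x \<in> space (ref_measure n \<kappa> f)"
    then have "x \<in> space (Rn n)" by (simp add: ref_measure_def)
    from measurable_compose[OF measurable_Pair1'[OF this] H_meas]
    have "(\<lambda>z. ennreal (H (x, z))) \<in> borel_measurable (std_gauss n)" by simp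
    then show "ennreal (exp (- \<phi> x)) * (\<integral>\<^sup>+z. ennreal (H (x, z)) \<partial>std_gauss n)
        = (\<integral>\<^sup>+z. ennreal (exp (- \<phi> (fst (x, z))) * H (x, z)) \<partial>std_gauss n)"
      by (simp add: ennreal_mult' nn_integral_cmult)
  qed
  also have "\<dots> = (\<integral>\<^sup>+\<omega>. ennreal (exp (- \<phi> (fst (x \<omega>, \<lambda>i\<in>{1..n}. snd (\<omega> i)))) * H (x \<omega>, \<lambda>i\<in>{1..n}. snd (\<omega> i))) \<partial>PiM UNIV (\<lambda>_. P))"
    unfolding x_def
    by (rule nn_integral_ref_measure[where T = "\<lambda>u. ennreal (exp (- \<phi> (fst u)) * H u)"]) (use H_meas \<phi> in measurable)
  finally have 1: "expected_acceptance n \<kappa> f \<phi> \<sigma> m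
      = enn2real (\<integral>\<^sup>+\<omega>. ennreal (exp (- \<phi> (x \<omega>)) * H (x \<omega>, \<lambda>i\<in>{1..n}. snd (\<omega> i))) \<partial>PiM UNIV (\<lambda>_. P))"
    by simp
  have pair_meas: "(\<lambda>\<omega>. (x \<omega>, \<lambda>i\<in>{1..n}. snd (\<omega> i))) \<in> PiM UNIV (\<lambda>_. P) \<rightarrow>\<^sub>M Rn n \<Otimes>\<^sub>M std_gauss n"
  proof (rule measurable_Pair)
    show "x \<in> PiM UNIV (\<lambda>_. P) \<rightarrow>\<^sub>M Rn n" unfolding x_def Rn_def by (rule measurable_restrict) measurable
    show "(\<lambda>\<omega>. \<lambda>i\<in>{1..n}. snd (\<omega> i)) \<in> PiM UNIV (\<lambda>_. P) \<rightarrow>\<^sub>M std_gauss n"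
      unfolding std_gauss_def by (rule measurable_restrict) measurable
  qed
  have "(\<lambda>u. exp (- \<phi> (fst u)) * H u) \<in> borel_measurable (Rn n \<Otimes>\<^sub>M std_gauss n)" by measurable
  from measurable_compose[OF pair_meas this]
  have "(\<integral>\<omega>. exp (- \<phi> (x \<omega>)) * H (x \<omega>, \<lambda>i\<in>{1..n}. snd (\<omega> i)) \<partial>PiM UNIV (\<lambda>_. P))
      = enn2real (\<integral>\<^sup>+\<omega>. ennreal (exp (- \<phi> (x \<omega>)) * H (x \<omega>, \<lambda>i\<in>{1..n}. snd (\<omega> i))) \<partial>PiM UNIV (\<lambda>_. P))"
    by (intro integral_eq_nn_integral) (auto simp: H)
  then have "expected_acceptance n \<kappa> f \<phi> \<sigma> m = (\<integral>\<omega>. exp (- \<phi> (x \<omega>)) * H (x \<omega>, \<lambda>i\<in>{1..n}. snd (\<omega> i)) \<partial>PiM UNIV (\<lambda>_. P))"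
    using 1 by simp
  also have "\<dots> = (\<integral>\<omega>. exp (- \<phi> (x \<omega>)) * min 1 (exp (\<phi> (x \<omega>) - \<phi> (y \<omega>)
    + (\<Sum>i\<in>{0<..n}. log_ratio b (?e i) (fst (\<omega> i)) (step b (?e i) (\<omega> i))))) \<partial>PiM UNIV (\<lambda>_. P))"
  proof (rule Bochner_Integration.integral_cong[OF refl])
    fix \<omega> :: "nat \<Rightarrow> real \<times> real"
    have x_i: "x \<omega> i / ?c i = fst (\<omega> i)" if "i \<in> {1..n}" for i
      using that by (simp add: x_def coord_scale_def)
    have "Y (x \<omega>) (\<lambda>i\<in>{1..n}. snd (\<omega> i)) = y \<omega>"
      unfolding Y_def y_def by (rule restrict_ext) (simp add: x_i)
    moreover have "(\<Sum>i\<in>{0<..n}. log_ratio b (?e i) (x \<omega> i / ?c i) (step b (?e i) (x \<omega> i / ?c i, (\<lambda>i\<in>{1..n}. snd (\<omega> i)) i)))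
        = (\<Sum>i\<in>{0<..n}. log_ratio b (?e i) (fst (\<omega> i)) (step b (?e i) (\<omega> i)))"
      by (rule sum.cong) (auto simp: x_i)
    ultimately show "exp (- \<phi> (x \<omega>)) * H (x \<omega>, \<lambda>i\<in>{1..n}. snd (\<omega> i)) = exp (- \<phi> (x \<omega>)) * min 1 (exp (\<phi> (x \<omega>) - \<phi> (y \<omega>)
        + (\<Sum>i\<in>{0<..n}. log_ratio b (?e i) (fst (\<omega> i)) (step b (?e i) (\<omega> i)))))"
      unfolding H_def by simp
  qed
  finally show ?thesis .
qed

text \<open>The total mass of the target, transported with an integrand that is constant in the
  noise.\<close>

lemma expectation_exp_phi:
  assumes \<phi> [measurable]: "\<phi> \<in> borel_measurable (Rn n)" and prob: "prob_space (target n \<kappa> f \<phi>)"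
  shows "(\<integral>\<omega>. exp (- \<phi> (\<lambda>i\<in>{1..n}. coord_scale \<kappa> i * fst (\<omega> i))) \<partial>PiM UNIV (\<lambda>_. P)) = 1"
proof -
  interpret G: prob_space "std_gauss n" by (rule prob_space_std_gauss)
  have sets_ref: "sets (ref_measure n \<kappa> f) = sets (Rn n)" by (simp add: ref_measure_def)
  have exp_meas: "(\<lambda>x. ennreal (exp (- \<phi> x))) \<in> borel_measurable (Rn n)" by measurable
  have "1 = emeasure (target n \<kappa> f \<phi>) (space (target n \<kappa> f \<phi>))"
    using prob_space.emeasure_space_1[OF prob] by simp
  also have "\<dots> = (\<integral>\<^sup>+x. ennreal (exp (- \<phi> x)) * indicator (space (ref_measure n \<kappa> f)) x \<partial>ref_measure n \<kappa> f)"
    unfolding target_def using exp_meas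
    by (simp add: emeasure_density measurable_cong_sets[OF sets_ref refl])
  also have "\<dots> = (\<integral>\<^sup>+x. \<integral>\<^sup>+z. ennreal (exp (- \<phi> (fst (x, z)))) \<partial>std_gauss n \<partial>ref_measure n \<kappa> f)"
    by (intro nn_integral_cong) (simp add: G.emeasure_space_1)
  also have "\<dots> = (\<integral>\<^sup>+\<omega>. ennreal (exp (- \<phi> (fst (\<lambda>i\<in>{1..n}. coord_scale \<kappa> i * fst (\<omega> i), \<lambda>i\<in>{1..n}. snd (\<omega> i))))) \<partial>PiM UNIV (\<lambda>_. P))"
    by (rule nn_integral_ref_measure[where T = "\<lambda>u. ennreal (exp (- \<phi> (fst u)))"]) measurable
  finally have eq: "(\<integral>\<^sup>+\<omega>. ennreal (exp (- \<phi> (\<lambda>i\<in>{1..n}. coord_scale \<kappa> i * fst (\<omega> i)))) \<partial>PiM UNIV (\<lambda>_. P)) = 1"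
    by simp
  have "(\<lambda>\<omega>. \<lambda>i\<in>{1..n}. coord_scale \<kappa> i * fst (\<omega> i)) \<in> PiM UNIV (\<lambda>_. P) \<rightarrow>\<^sub>M Rn n"
    unfolding Rn_def by (rule measurable_restrict) measurable
  from measurable_compose[OF this \<phi>]
  have "(\<integral>\<omega>. exp (- \<phi> (\<lambda>i\<in>{1..n}. coord_scale \<kappa> i * fst (\<omega> i))) \<partial>PiM UNIV (\<lambda>_. P))
      = enn2real (\<integral>\<^sup>+\<omega>. ennreal (exp (- \<phi> (\<lambda>i\<in>{1..n}. coord_scale \<kappa> i * fst (\<omega> i)))) \<partial>PiM UNIV (\<lambda>_. P))"
    by (intro integral_eq_nn_integral) auto
  then show ?thesis unfolding eq by simp
qed

text \<open>The common statement for both algorithms: the drift \<open>b\<close> and the order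
  \<open>k\<close> are parameters, and comparing \<open>\<rho>\<close> with
  \<open>2 * \<kappa> + 1 / k\<close> amounts to the sign of \<open>\<gamma>\<close>.\<close>

lemma expected_acceptance_limits:
  fixes b :: "real \<Rightarrow> real" and C W :: "real \<times> real \<Rightarrow> real" and k :: nat
    and \<phi> :: "nat \<Rightarrow> (nat \<Rightarrow> real) \<Rightarrow> real" and \<sigma> :: "nat \<Rightarrow> real" and \<kappa> l \<rho> :: real
    and mean :: "nat \<Rightarrow> (nat \<Rightarrow> real) \<Rightarrow> nat \<Rightarrow> real"
  assumes step: "balanced_step P (\<lambda>\<epsilon> u. log_ratio b \<epsilon> (fst u) (step b \<epsilon> u)) (step b) C W k"
    and b: "b \<in> borel_measurable borel"
    and mean: "\<And>n x i. n \<ge> 1 \<Longrightarrow> i \<in> {1..n} \<Longrightarrow>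
      mean n x i = x i + (\<sigma> n)\<^sup>2 / coord_scale \<kappa> i * b (x i / coord_scale \<kappa> i)"
    and kappa: "\<kappa> \<ge> 0" and l: "l > 0" and rho: "2 * \<kappa> < \<rho>"
    and sigma: "\<And>n. n \<ge> 1 \<Longrightarrow> \<sigma> n > 0 \<and> (\<sigma> n)\<^sup>2 = l\<^sup>2 * real n powr (- \<rho>)"
    and phi_meas: "\<And>n. n \<ge> 1 \<Longrightarrow> \<phi> n \<in> borel_measurable (Rn n)"
    and target_prob: "\<And>n. n \<ge> 1 \<Longrightarrow> prob_space (target n \<kappa> f (\<phi> n))"
    and A: "\<exists>M::real. \<forall>\<^sub>F n in sequentially. \<forall>x\<in>space (Rn n). \<phi> n x \<ge> M"
    and B: "\<exists>(\<delta> :: real \<times> real \<Rightarrow> real) (C::real) (p::real) (s::real) (s'::real) (s''::real).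
        \<delta> \<in> {0..} \<times> {0..} \<rightarrow> {0..} \<and> locally_bounded_on ({0..} \<times> {0..}) \<delta> \<and>
        C > 0 \<and> p > 0 \<and> s < \<kappa> - 1/2 \<and> s' < \<kappa> - 1/2 \<and> s'' < \<kappa> - 1/2 \<and>
        (\<forall>\<^sub>F n in sequentially. \<forall>x\<in>space (Rn n). \<forall>y\<in>space (Rn n).
           \<bar>\<phi> n y - \<phi> n x\<bar> \<le> \<delta> (wnorm n s x, wnorm n s y) * wnorm n s' (\<lambda>i. y i - x i) \<and>
           \<bar>\<phi> n x\<bar> \<le> C * (1 + wnorm n s'' x powr p))"
  defines "a \<equiv> \<lambda>n. expected_acceptance n \<kappa> f (\<phi> n) (\<sigma> n) (mean n)"
  shows "\<rho> = 2 * \<kappa> + 1 / real k \<Longrightarrow>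
      a \<longlonglongrightarrow> 2 * std_normal_cdf (- (l ^ k / 2) * sqrt ((\<integral>u. (C u)\<^sup>2 \<partial>P) / (1 + 2 * \<kappa> * real k)))"
    and "\<rho> > 2 * \<kappa> + 1 / real k \<Longrightarrow> a \<longlonglongrightarrow> 1"
    and "\<rho> < 2 * \<kappa> + 1 / real k \<Longrightarrow> (\<lambda>n. real n powr q * a n) \<longlonglongrightarrow> 0"
proof -
  let ?r = "\<lambda>\<epsilon> u. log_ratio b \<epsilon> (fst u) (step b \<epsilon> u)"
  interpret S: balanced_step P ?r "step b" C W k by (rule step)
  interpret S: balanced_array P ?r "step b" C W k \<kappa> l \<rho> \<sigma>
    using kappa l rho sigma by unfold_locales
  obtain M where M: "\<forall>\<^sub>F n in sequentially. \<forall>x\<in>space (Rn n). M \<le> \<phi> n x" using A by auto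
  obtain \<delta> D p s s' s'' where \<delta>: "locally_bounded_on ({0..} \<times> {0..}) \<delta>" and pos: "D > 0" "p > 0"
    and exps: "s < \<kappa> - 1/2" "s' < \<kappa> - 1/2" "s'' < \<kappa> - 1/2"
    and bounds: "\<forall>\<^sub>F n in sequentially. \<forall>x\<in>space (Rn n). \<forall>y\<in>space (Rn n).
           \<bar>\<phi> n y - \<phi> n x\<bar> \<le> \<delta> (wnorm n s x, wnorm n s y) * wnorm n s' (\<lambda>i. y i - x i) \<and>
           \<bar>\<phi> n x\<bar> \<le> D * (1 + wnorm n s'' x powr p)"
    using B by blast
  have xv: "S.xv n n = (\<lambda>\<omega>. \<lambda>i\<in>{1..n}. coord_scale \<kappa> i * fst (\<omega> i))" for n
    by (auto simp: S.xv_def fun_eq_iff restrict_def)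
  interpret T: target_array P ?r "step b" C W k \<kappa> l \<rho> \<sigma> \<phi> M \<delta> D p s s' s''
  proof (intro target_array.intro S.balanced_array_axioms target_array_axioms.intro phi_meas M \<delta> pos exps)
    show "(\<integral>\<omega>. exp (- \<phi> n (S.xv n n \<omega>)) \<partial>S.\<Omega>) = 1" if "n \<ge> 1" for n
      unfolding xv S.\<Omega>_def by (rule expectation_exp_phi[OF phi_meas[OF that] target_prob[OF that]])
    show "\<forall>\<^sub>F n in sequentially. \<forall>x\<in>space (Rn n). \<forall>y\<in>space (Rn n).
        \<bar>\<phi> n y - \<phi> n x\<bar> \<le> \<delta> (wnorm n s x, wnorm n s y) * wnorm n s' (\<lambda>i. y i - x i)"
      using bounds by eventually_elim blast
    show "\<forall>\<^sub>F n in sequentially. \<forall>x\<in>space (Rn n). \<bar>\<phi> n x\<bar> \<le> D * (1 + wnorm n s'' x powr p)"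
      using bounds by eventually_elim blast
  qed
  \<comment> \<open>Dimension 0 is outside the hypotheses, so the identification is eventual, which
    suffices for limits.\<close>
  have a_eq: "\<forall>\<^sub>F n in sequentially. (\<integral>\<omega>. T.accept n \<omega> \<partial>S.\<Omega>) = a n"
    using eventually_ge_at_top[of 1]
  proof eventually_elim
    case (elim n)
    have "a n = (\<integral>\<omega>. T.accept n \<omega> \<partial>S.\<Omega>)"
      unfolding a_def T.accept_def xv S.yv_def S.R_def S.eps_def S.\<Omega>_def
      by (rule expected_acceptance_eq[where \<sigma> = "\<sigma> n" and m = "mean n", OF _ b phi_meas[OF elim] mean[OF elim]]) (use sigma[OF elim] in simp)
    then show ?case by simp
  qed
  have k: "real k > 0" using S.k_pos by simp
  show "a \<longlonglongrightarrow> 2 * std_normal_cdf (- (l ^ k / 2) * sqrt ((\<integral>u. (C u)\<^sup>2 \<partial>P) / (1 + 2 * \<kappa> * real k)))"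
    if "\<rho> = 2 * \<kappa> + 1 / real k"
  proof -
    have "S.\<gamma> = 0" unfolding S.\<gamma>_def using that k by (simp add: field_simps)
    from Lim_transform_eventually[OF T.accept_critical[OF this] a_eq] show ?thesis
      by (simp only: S.K_def)
  qed
  show "a \<longlonglongrightarrow> 1" if "\<rho> > 2 * \<kappa> + 1 / real k"
  proof -
    have "S.\<gamma> < 0" unfolding S.\<gamma>_def using that k by (simp add: field_simps)
    from Lim_transform_eventually[OF T.accept_subcritical[OF this] a_eq] show ?thesis .
  qed
  show "(\<lambda>n. real n powr q * a n) \<longlonglongrightarrow> 0" if "\<rho> < 2 * \<kappa> + 1 / real k"
  proof (rule Lim_transform_eventually)
    have "S.\<gamma> > 0" unfolding S.\<gamma>_def using that k by (simp add: field_simps)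
    then show "(\<lambda>n. real n powr q * (\<integral>\<omega>. T.accept n \<omega> \<partial>S.\<Omega>)) \<longlonglongrightarrow> 0" by (rule T.accept_supercritical)
    show "\<forall>\<^sub>F n in sequentially. real n powr q * (\<integral>\<omega>. T.accept n \<omega> \<partial>S.\<Omega>) = real n powr q * a n"
      using a_eq by eventually_elim simp
  qed
qed

end

section \<open>Specialization to the two algorithms\<close>

theorem theorem3:
  fixes f g :: "real \<Rightarrow> real"
    and \<phi> :: "nat \<Rightarrow> (nat \<Rightarrow> real) \<Rightarrow> real"
    and \<sigma> :: "nat \<Rightarrow> real"
    and \<kappa> l \<rho> :: real
  assumes f_def: "\<And>x. f x = exp (- g x)"
    and f_prob: "prob_space (density lborel (\<lambda>x. ennreal (f x)))"
    and g_smooth: "\<And>k x. (deriv ^^ k) g differentiable (at x)"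
    and g_poly: "\<And>k. \<exists>P :: real poly. \<forall>x. \<bar>(deriv ^^ k) g x\<bar> \<le> poly P x"
    and f_moments: "\<And>k::nat. integrable (density lborel (\<lambda>x. ennreal (f x))) (\<lambda>x. x ^ k)"
    and kappa: "\<kappa> \<ge> 0"
    and phi_meas: "\<And>n. n \<ge> 1 \<Longrightarrow> \<phi> n \<in> borel_measurable (Rn n)"
    and target_prob: "\<And>n. n \<ge> 1 \<Longrightarrow> prob_space (target n \<kappa> f (\<phi> n))"
    and l_rho: "l > 0" "\<rho> > 0"
    and sigma: "\<And>n. n \<ge> 1 \<Longrightarrow> \<sigma> n > 0 \<and> (\<sigma> n)\<^sup>2 = l\<^sup>2 * real n powr (- \<rho>)"
    and A: "\<exists>M::real. \<forall>\<^sub>F n in sequentially. \<forall>x\<in>space (Rn n). \<phi> n x \<ge> M"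
    and B: "\<exists>(\<delta> :: real \<times> real \<Rightarrow> real) (C::real) (p::real) (s::real) (s'::real) (s''::real).
        \<delta> \<in> {0..} \<times> {0..} \<rightarrow> {0..} \<and> locally_bounded_on ({0..} \<times> {0..}) \<delta> \<and>
        C > 0 \<and> p > 0 \<and> s < \<kappa> - 1/2 \<and> s' < \<kappa> - 1/2 \<and> s'' < \<kappa> - 1/2 \<and>
        (\<forall>\<^sub>F n in sequentially. \<forall>x\<in>space (Rn n). \<forall>y\<in>space (Rn n).
           \<bar>\<phi> n y - \<phi> n x\<bar> \<le> \<delta> (wnorm n s x, wnorm n s y) * wnorm n s' (\<lambda>i. y i - x i) \<and>
           \<bar>\<phi> n x\<bar> \<le> C * (1 + wnorm n s'' x powr p))"
  shows
    "\<comment> \<open>RWM, with I = 1\<close>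
     (\<rho> = 2 * \<kappa> + 1 \<longrightarrow>
        (\<lambda>n. expected_acceptance n \<kappa> f (\<phi> n) (\<sigma> n) rwm_mean)
          \<longlonglongrightarrow> 2 * std_normal_cdf (- (l / 2) * sqrt (K_RWM f g / (1 + 2 * \<kappa>)))) \<and>
     (\<rho> > 2 * \<kappa> + 1 \<longrightarrow>
        (\<lambda>n. expected_acceptance n \<kappa> f (\<phi> n) (\<sigma> n) rwm_mean) \<longlonglongrightarrow> 1) \<and>
     (2 * \<kappa> < \<rho> \<and> \<rho> < 2 * \<kappa> + 1 \<longrightarrow>
        (\<forall>p::real\<ge>0. (\<lambda>n. real n powr p *
           expected_acceptance n \<kappa> f (\<phi> n) (\<sigma> n) rwm_mean) \<longlonglongrightarrow> 0)) \<and>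
     \<comment> \<open>SLA, with I = 1/3\<close>
     (\<rho> = 2 * \<kappa> + 1/3 \<longrightarrow>
        (\<lambda>n. expected_acceptance n \<kappa> f (\<phi> n) (\<sigma> n) (sla_mean n \<kappa> f (\<sigma> n)))
          \<longlonglongrightarrow> 2 * std_normal_cdf (- (l ^ 3 / 2) * sqrt (K_SLA f g / (1 + 6 * \<kappa>)))) \<and>
     (\<rho> > 2 * \<kappa> + 1/3 \<longrightarrow>
        (\<lambda>n. expected_acceptance n \<kappa> f (\<phi> n) (\<sigma> n) (sla_mean n \<kappa> f (\<sigma> n))) \<longlonglongrightarrow> 1) \<and>
     (2 * \<kappa> < \<rho> \<and> \<rho> < 2 * \<kappa> + 1/3 \<longrightarrow>
        (\<forall>p::real\<ge>0. (\<lambda>n. real n powr p *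
           expected_acceptance n \<kappa> f (\<phi> n) (\<sigma> n) (sla_mean n \<kappa> f (\<sigma> n))) \<longlonglongrightarrow> 0))"
proof -
  interpret smooth_density f g
    by (rule smooth_density.intro) (fact f_def f_prob g_smooth g_poly f_moments)+
  obtain W where rwm: "balanced_step P (\<lambda>\<epsilon> u. log_ratio (\<lambda>_. 0) \<epsilon> (fst u) (step (\<lambda>_. 0) \<epsilon> u)) (step (\<lambda>_. 0))
      (\<lambda>u. - snd u * d 1 (fst u)) W 1"
    by (rule rwm_balanced_step)
  obtain V where sla: "balanced_step P
      (\<lambda>\<epsilon> u. log_ratio (\<lambda>x. - d 1 x / 2) \<epsilon> (fst u) (step (\<lambda>x. - d 1 x / 2) \<epsilon> u)) (step (\<lambda>x. - d 1 x / 2))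
      (\<lambda>u. snd u ^ 3 * d 3 (fst u) / 12 - snd u * d 1 (fst u) * d 2 (fst u) / 4) V 3"
    by (rule sla_balanced_step)
  \<comment> \<open>The gradient step in the shape demanded of \<open>mean\<close>: the factor
    \<open>1 / 2\<close> goes into the drift \<open>b = - g' / 2\<close>.\<close>
  have sla_mean: "sla_mean n \<kappa> f (\<sigma> n) x i = x i + (\<sigma> n)\<^sup>2 / coord_scale \<kappa> i * (- d 1 (x i / coord_scale \<kappa> i) / 2)"
    if "i \<in> {1..n}" for n x i
    using sla_mean_eq[of f g x i \<kappa> n "\<sigma> n"] f_def g_smooth[of 0] that by (simp add: d_def)
  have b: "(\<lambda>x. - d 1 x / 2) \<in> borel_measurable borel" by measurable
  note rwm_limits = expected_acceptance_limits[OF rwm, where mean = "\<lambda>_. rwm_mean", simplified rwm_expectation,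
      OF _ _ kappa l_rho(1) _ sigma phi_meas target_prob A B]
  note sla_limits = expected_acceptance_limits[OF sla, where mean = "\<lambda>n. sla_mean n \<kappa> f (\<sigma> n)", simplified sla_expectation(1),
      OF b sla_mean kappa l_rho(1) _ sigma phi_meas target_prob A B]
  show ?thesis
  proof (intro conjI impI allI)
    assume "\<rho> = 2 * \<kappa> + 1"
    then show "(\<lambda>n. expected_acceptance n \<kappa> f (\<phi> n) (\<sigma> n) rwm_mean)
        \<longlonglongrightarrow> 2 * std_normal_cdf (- (l / 2) * sqrt (K_RWM f g / (1 + 2 * \<kappa>)))"
      using rwm_limits(1) by (simp add: rwm_mean_def)
  next
    assume "\<rho> > 2 * \<kappa> + 1"
    then show "(\<lambda>n. expected_acceptance n \<kappa> f (\<phi> n) (\<sigma> n) rwm_mean) \<longlonglongrightarrow> 1"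
      using rwm_limits(2) by (simp add: rwm_mean_def)
  next
    fix q :: real
    assume "2 * \<kappa> < \<rho> \<and> \<rho> < 2 * \<kappa> + 1"
    then show "(\<lambda>n. real n powr q * expected_acceptance n \<kappa> f (\<phi> n) (\<sigma> n) rwm_mean) \<longlonglongrightarrow> 0"
      using rwm_limits(3) by (simp add: rwm_mean_def)
  next
    \<comment> \<open>With \<open>k = 3\<close> the denominator \<open>1 + 2 * \<kappa> * k\<close>
      becomes \<open>1 + 6 * \<kappa>\<close>.\<close>
    assume "\<rho> = 2 * \<kappa> + 1/3"
    then show "(\<lambda>n. expected_acceptance n \<kappa> f (\<phi> n) (\<sigma> n) (sla_mean n \<kappa> f (\<sigma> n)))
        \<longlonglongrightarrow> 2 * std_normal_cdf (- (l ^ 3 / 2) * sqrt (K_SLA f g / (1 + 6 * \<kappa>)))"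
      using sla_limits(1) by (simp add: mult.commute)
  next
    assume "\<rho> > 2 * \<kappa> + 1/3"
    then show "(\<lambda>n. expected_acceptance n \<kappa> f (\<phi> n) (\<sigma> n) (sla_mean n \<kappa> f (\<sigma> n))) \<longlonglongrightarrow> 1"
      using sla_limits(2) by simp
  next
    fix q :: real
    assume "2 * \<kappa> < \<rho> \<and> \<rho> < 2 * \<kappa> + 1/3"
    then show "(\<lambda>n. real n powr q * expected_acceptance n \<kappa> f (\<phi> n) (\<sigma> n) (sla_mean n \<kappa> f (\<sigma> n))) \<longlonglongrightarrow> 0"
      using sla_limits(3) by simp
  qed
qed

end
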